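(* Let $\mathscr{P}_\bullet$ be an irreducible subfactor planar algebra, let $0<p,q\le\infty$ and let $x\in\mathscr{P}_{2,\pm}$. Then $$K(1/q,1/p)^{-1}\,\|x\|_p\ \le\ \|\mathfrak{F}_s(x)\|_q\ \le\ K(1/p,1/q)\,\|x\|_p .$$
   Context: Let $\mathscr{P}_\bullet=\{\mathscr{P}_{n,\pm}\}_{n\ge 0}$ be a subfactor planar algebra in the sense of Jones, with $\delta$ the square root of the Jones index (the value of a closed loop). It is irreducible if $\mathscr{P}_{1,\pm}$ is one-dimensional. Each $\mathscr{P}_{n,\pm}$ is a finite-dimensional C$^*$-algebra and $tr_2$ denotes the unnormalized Markov trace on $\mathscr{P}_{2,\pm}$, so $tr_2(1)=\delta^2$. The string Fourier transform $\mathfrak{F}_s:\mathscr{P}_{2,\pm}\to\mathscr{P}_{2,\mp}$ is the clockwise 1-click rotation. For $x\in\mathscr{P}_{2,\pm}$, $|x|=(x^*x)^{1/2}$, $\|x\|_p=(tr_2(|x|^p))^{1/p}$ for $0<p<\infty$, and $\|x\|_\infty$ is the operator norm. Convention: $1/\infty=0$. Define the regions $R_F=\{(s,t): s,t\ge 0,\ s+t\le 1,\ t\le 1/2\}$, $R_T=\{(s,t): s,t\ge 0,\ s+t\ge 1,\ s\ge 1/2\}$, $R_{TF}=\{(s,t): s,t\ge 0,\ s\le 1/2,\ t\ge 1/2\}$, and the function $K$ on $[0,\infty)^2$ by $K(s,t)=\delta^{1-2s}$ for $(s,t)\in R_F$, $K(s,t)=\delta^{2t-1}$ for $(s,t)\in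 R_T$, $K(s,t)=\delta^{2t-2s}$ for $(s,t)\in R_{TF}$ (the formulas agree on overlaps). *)

theory Defs
  imports "HOL-Library.Extended_Real"
begin

section \<open>Shaded planar tangles\<close>

text \<open>
  The axioms of a planar algebra see a shaded planar tangle only up to orientation-preserving
  diffeomorphism, and such a class is recorded here by its finite incidence data: discs, strings
  and regions, and which of them meet.

  \<^item> The output disc is \<open>None\<close>, the input discs are \<open>Some d\<close> for \<open>d\<close> in \<open>discs T\<close>.
  \<^item> A disc of colour \<open>(n, s)\<close> has boundary points \<open>0, \<dots>, 2n - 1\<close>, numbered clockwise,
    and boundary intervals \<open>0, \<dots>, 2n - 1\<close>; interval \<open>0\<close> is the distinguished one and point \<open>j\<close>
    lies between intervals \<open>j\<close> and \<open>j + 1\<close> (mod \<open>2n\<close>). If \<open>n = 0\<close> the whole boundary circle is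
    interval \<open>0\<close>.
  \<^item> The Boolean \<open>s\<close> says whether the distinguished interval meets a shaded region:
    \<open>(n, False)\<close> is the colour \<open>(n, +)\<close> and \<open>(n, True)\<close> is \<open>(n, -)\<close>.
  \<^item> \<open>point_string T d j\<close> is the string ending at point \<open>j\<close> of disc \<open>d\<close>, \<open>interval_region T d j\<close>
    is the region touching interval \<open>j\<close>, and \<open>side_region T e c\<close> is the region
    on the shaded (\<open>c = True\<close>) or unshaded (\<open>c = False\<close>) side of the string \<open>e\<close>.
    A string without end points is a closed loop.

  The fields are meaningful only at the discs, points, intervals and strings of the tangle.
\<close>

type_synonym colour = "nat \<times> bool"

record tangle =
  discs :: "nat set"
  strings :: "nat set"
  regions :: "nat set"
  colour_of :: "nat option \<Rightarrow> colour"
  point_string :: "nat option \<Rightarrow> nat \<Rightarrow> nat"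
  interval_region :: "nat option \<Rightarrow> nat \<Rightarrow> nat"
  side_region :: "nat \<Rightarrow> bool \<Rightarrow> nat"
  shaded :: "nat \<Rightarrow> bool"

definition all_discs :: "tangle \<Rightarrow> nat option set" where
  "all_discs T = insert None (Some ` discs T)"

definition npoints :: "tangle \<Rightarrow> nat option \<Rightarrow> nat" where
  "npoints T d = 2 * fst (colour_of T d)"

definition nintervals :: "tangle \<Rightarrow> nat option \<Rightarrow> nat" where
  "nintervals T d = max 1 (npoints T d)"

definition interval_shade :: "tangle \<Rightarrow> nat option \<Rightarrow> nat \<Rightarrow> bool" where
  "interval_shade T d j = (odd j \<noteq> snd (colour_of T d))"

definition points :: "tangle \<Rightarrow> (nat option \<times> nat) set" where
  "points T = (SIGMA d : all_discs T. {..<npoints T d})"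

definition ends :: "tangle \<Rightarrow> nat \<Rightarrow> (nat option \<times> nat) set" where
  "ends T e = {(d, j) \<in> points T. point_string T d j = e}"

text \<open>
  Orient strings with the shaded side on the left. Looking along a string away from an input disc
  at point \<open>j\<close>, interval \<open>j\<close> is on the left; looking from the output disc into the tangle,
  interval \<open>j + 1\<close> is on the left. So these are the points where a string starts.
\<close>

definition starts_at :: "tangle \<Rightarrow> nat option \<times> nat \<Rightarrow> bool" where
  "starts_at T = (\<lambda>(d, j). if d = None then \<not> interval_shade T d j else interval_shade T d j)"

text \<open>
  The boundary of the regions is made of the intervals and of the two sides of each string.
  Consecutive pieces meet at the boundary points of discs; the classes of the generated equivalence
  relation are the boundary curves of the regions.
\<close>

datatype piece = Interval "nat option" nat | Side nat bool

definition pieces :: "tangle \<Rightarrow> piece set" where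
  "pieces T = {Interval d j |d j. d \<in> all_discs T \<and> j < nintervals T d}
              \<union> {Side e c |e c. e \<in> strings T}"

fun piece_region :: "tangle \<Rightarrow> piece \<Rightarrow> nat" where
  "piece_region T (Interval d j) = interval_region T d j"
| "piece_region T (Side e c) = side_region T e c"

fun piece_shade :: "tangle \<Rightarrow> piece \<Rightarrow> bool" where
  "piece_shade T (Interval d j) = interval_shade T d j"
| "piece_shade T (Side e c) = c"

definition meeting :: "tangle \<Rightarrow> (piece \<times> piece) set" where
  "meeting T =
     {(Interval d j, Side (point_string T d j) (interval_shade T d j)) |d j. (d, j) \<in> points T}
     \<union> {(Interval d (Suc j mod npoints T d), Side (point_string T d j) (\<not> interval_shade T d j))
        |d j. (d, j) \<in> points T}"

definition gen_equiv :: "('b \<times> 'b) set \<Rightarrow> ('b \<times> 'b) set" where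
  "gen_equiv r = (r \<union> r\<inverse>)\<^sup>*"

definition boundary_curves :: "tangle \<Rightarrow> piece set set" where
  "boundary_curves T = pieces T // gen_equiv (meeting T)"

definition adjacent_regions :: "tangle \<Rightarrow> (nat \<times> nat) set" where
  "adjacent_regions T =
     {(interval_region T d j, interval_region T d k) |d j k.
        d \<in> all_discs T \<and> j < nintervals T d \<and> k < nintervals T d}
     \<union> {(side_region T e b, side_region T e c) |e b c. e \<in> strings T}"

text \<open>
  Glueing the discs and the regions (genus \<open>0\<close> surfaces, one boundary component for each of their
  boundary curves) along intervals and strings gives a closed oriented surface. As a region with
  \<open>b\<close> boundary curves has Euler characteristic \<open>2 - b\<close> and there are as many boundary points
  as intervals on the discs with \<open>n > 0\<close>, the Euler characteristic of the surface is
  \<open>#discs - #(strings that are not loops) + 2 #regions - #(boundary curves)\<close>.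
  The tangle is planar iff the surface is a sphere, the output disc being the complement of the
  disc in which the tangle is drawn.
\<close>

definition planar_tangle :: "tangle \<Rightarrow> bool" where
  "planar_tangle T \<longleftrightarrow>
     finite (discs T) \<and> finite (strings T) \<and> finite (regions T)
     \<and> (\<forall>(d, j) \<in> points T. point_string T d j \<in> strings T)
     \<and> (\<forall>a \<in> pieces T. piece_region T a \<in> regions T \<and> shaded T (piece_region T a) = piece_shade T a)
     \<and> (\<forall>(a, b) \<in> meeting T. piece_region T a = piece_region T b)
     \<and> (\<forall>e \<in> strings T. ends T e = {}
          \<or> (\<exists>!a. a \<in> ends T e \<and> starts_at T a) \<and> (\<exists>!a. a \<in> ends T e \<and> \<not> starts_at T a))
     \<and> (\<forall>r \<in> regions T. \<forall>r' \<in> regions T. (r, r') \<in> (adjacent_regions T)\<^sup>*)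
     \<and> int (card (all_discs T)) - int (card {e \<in> strings T. ends T e \<noteq> {}})
         + 2 * int (card (regions T)) - int (card (boundary_curves T)) = 2"

text \<open>
  \<open>carried T U D fd fe fr\<close>: the discs in \<open>D\<close>, the strings and the regions of \<open>T\<close> are mapped to
  those of \<open>U\<close> by \<open>fd, fe, fr\<close>, preserving all incidences.
\<close>

definition carried :: "tangle \<Rightarrow> tangle \<Rightarrow> nat option set \<Rightarrow>
    (nat option \<Rightarrow> nat option) \<Rightarrow> (nat \<Rightarrow> nat) \<Rightarrow> (nat \<Rightarrow> nat) \<Rightarrow> bool" where
  "carried T U D fd fe fr \<longleftrightarrow>
     (\<forall>d \<in> D. colour_of U (fd d) = colour_of T d
        \<and> (\<forall>j < npoints T d. point_string U (fd d) j = fe (point_string T d j))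
        \<and> (\<forall>j < nintervals T d. interval_region U (fd d) j = fr (interval_region T d j)))
     \<and> (\<forall>e \<in> strings T. \<forall>c. side_region U (fe e) c = fr (side_region T e c))
     \<and> (\<forall>r \<in> regions T. shaded U (fr r) = shaded T r)"

definition isotopy :: "tangle \<Rightarrow> tangle \<Rightarrow> (nat \<Rightarrow> nat) \<Rightarrow> bool" where
  "isotopy T U f \<longleftrightarrow> bij_betw f (discs T) (discs U)
     \<and> (\<exists>fe fr. bij_betw fe (strings T) (strings U) \<and> bij_betw fr (regions T) (regions U)
          \<and> carried T U (all_discs T) (map_option f) fe fr)"

text \<open>\<open>C\<close> is the quotient of the disjoint union of \<open>A\<close> and \<open>B\<close> by the equivalence generated by \<open>r\<close>.\<close>

definition is_glued_union ::
    "nat set \<Rightarrow> nat set \<Rightarrow> ((nat + nat) \<times> (nat + nat)) set \<Rightarrow> nat set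
      \<Rightarrow> (nat \<Rightarrow> nat) \<Rightarrow> (nat \<Rightarrow> nat) \<Rightarrow> bool" where
  "is_glued_union A B r C f g \<longleftrightarrow> case_sum f g ` (A <+> B) = C
     \<and> (\<forall>u \<in> A <+> B. \<forall>v \<in> A <+> B. case_sum f g u = case_sum f g v \<longleftrightarrow> (u, v) \<in> gen_equiv r)"

text \<open>
  \<open>glueing T i S U f g\<close>: the tangle \<open>U\<close> is obtained by inserting \<open>S\<close> into the input disc \<open>i\<close> of \<open>T\<close>
  and erasing the common circle; \<open>f\<close> and \<open>g\<close> name the input discs of \<open>T\<close> (other than \<open>i\<close>)
  and of \<open>S\<close> as discs of \<open>U\<close>.
\<close>

definition glueing :: "tangle \<Rightarrow> nat \<Rightarrow> tangle \<Rightarrow> tangle \<Rightarrow> (nat \<Rightarrow> nat) \<Rightarrow> (nat \<Rightarrow> nat) \<Rightarrow> bool" where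
  "glueing T i S U f g \<longleftrightarrow>
     i \<in> discs T \<and> colour_of T (Some i) = colour_of S None
     \<and> bij_betw (case_sum f g) ((discs T - {i}) <+> discs S) (discs U)
     \<and> (\<exists>fe ge fr gr.
          is_glued_union (strings T) (strings S)
            {(Inl (point_string T (Some i) j), Inr (point_string S None j)) |j. j < npoints S None}
            (strings U) fe ge
        \<and> is_glued_union (regions T) (regions S)
            {(Inl (interval_region T (Some i) j), Inr (interval_region S None j))
             |j. j < nintervals S None}
            (regions U) fr gr
        \<and> carried T U (all_discs T - {Some i}) (map_option f) fe fr
        \<and> carried S U (Some ` discs S) (map_option g) ge gr)"

text \<open>The mirror image fixes the distinguished intervals and reverses the numbering.\<close>

definition mirror :: "tangle \<Rightarrow> tangle" where
  "mirror T = T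
    \<lparr> point_string := \<lambda>d j. point_string T d (npoints T d - 1 - j),
      interval_region := \<lambda>d j. interval_region T d ((npoints T d - j) mod npoints T d) \<rparr>"

text \<open>
  For a tangle whose output disc has no boundary points, move the point at infinity (that is, the
  output disc) to the region \<open>r\<close>. These moves and isotopies generate isotopy on the sphere.
\<close>

definition move_infinity :: "nat \<Rightarrow> tangle \<Rightarrow> tangle" where
  "move_infinity r T = T
    \<lparr> colour_of := (colour_of T)(None := (0, shaded T r)),
      interval_region := (interval_region T)(None := (\<lambda>_. r)) \<rparr>"


subsection \<open>The tangles used below\<close>

text \<open>\<open>side_by sh a b\<close>: the string \<open>e\<close> separates the regions \<open>a e\<close> and \<open>b e\<close>.\<close>

definition side_by :: "(nat \<Rightarrow> bool) \<Rightarrow> (nat \<Rightarrow> nat) \<Rightarrow> (nat \<Rightarrow> nat) \<Rightarrow> nat \<Rightarrow> bool \<Rightarrow> nat" where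
  "side_by sh a b e c = (if sh (a e) = c then a e else b e)"

definition identity_tangle :: "colour \<Rightarrow> tangle" where
  "identity_tangle = (\<lambda>(n, s).
    \<lparr> discs = {0}, strings = {..<2 * n}, regions = {..<max 1 (2 * n)},
      colour_of = (\<lambda>_. (n, s)),
      point_string = (\<lambda>d j. j),
      interval_region = (\<lambda>d j. j),
      side_region = side_by (\<lambda>r. odd r \<noteq> s) (\<lambda>e. e) (\<lambda>e. Suc e mod (2 * n)),
      shaded = (\<lambda>r. odd r \<noteq> s) \<rparr>)"

text \<open>
  A box of colour \<open>(n, s)\<close> is drawn with its distinguished interval on the left, the points
  \<open>0, \<dots>, n - 1\<close> on top from left to right and the points \<open>n, \<dots>, 2n - 1\<close> at the bottom from right
  to left. The unit consists of \<open>n\<close> vertical strings; the one of colour \<open>(0, s)\<close> is the empty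
  tangle.
\<close>

definition unit_tangle :: "colour \<Rightarrow> tangle" where
  "unit_tangle = (\<lambda>(n, s).
    \<lparr> discs = {}, strings = {..<n}, regions = {..n},
      colour_of = (\<lambda>_. (n, s)),
      point_string = (\<lambda>d j. if j < n then j else 2 * n - 1 - j),
      interval_region = (\<lambda>d j. if j \<le> n then j else 2 * n - j),
      side_region = side_by (\<lambda>r. odd r \<noteq> s) (\<lambda>e. e) Suc,
      shaded = (\<lambda>r. odd r \<noteq> s) \<rparr>)"

text \<open>
  Multiplication: input disc \<open>0\<close> above input disc \<open>1\<close>. The strings \<open>2n, \<dots>, 3n - 1\<close> join the two
  input discs, and the regions \<open>2n + 1, \<dots>, 3n - 1\<close> lie between them.
\<close>

definition mult_tangle :: "colour \<Rightarrow> tangle" where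
  "mult_tangle = (\<lambda>(n, s).
    let top = (\<lambda>j. if j \<le> n then j else 4 * n - j);
        bot = (\<lambda>j. if 0 < j \<and> j < n then 2 * n + j else j)
    in
    \<lparr> discs = {0, 1}, strings = {..<3 * n},
      regions = {..<max 1 (2 * n)} \<union> {2 * n<..<3 * n},
      colour_of = (\<lambda>_. (n, s)),
      point_string = (\<lambda>d j. if d = None then j
         else if d = Some 0 then (if j < n then j else 4 * n - 1 - j)
         else (if j < n then 2 * n + j else j)),
      interval_region = (\<lambda>d. if d = None then (\<lambda>j. j) else if d = Some 0 then top else bot),
      side_region = side_by (\<lambda>r. odd r \<noteq> s)
         (\<lambda>e. if e < 2 * n then e else bot (e - 2 * n))
         (\<lambda>e. if e < 2 * n then Suc e mod (2 * n) else bot (Suc (e - 2 * n))),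
      shaded = (\<lambda>r. odd r \<noteq> s) \<rparr>)"

text \<open>The Markov trace closes a box to the right.\<close>

definition trace_tangle :: "colour \<Rightarrow> tangle" where
  "trace_tangle = (\<lambda>(n, s).
    \<lparr> discs = {0}, strings = {..<n}, regions = {..n},
      colour_of = (\<lambda>d. if d = None then (0, s) else (n, s)),
      point_string = (\<lambda>d j. if j < n then j else 2 * n - 1 - j),
      interval_region = (\<lambda>d j. if j \<le> n then j else 2 * n - j),
      side_region = side_by (\<lambda>r. odd r \<noteq> s) (\<lambda>e. e) Suc,
      shaded = (\<lambda>r. odd r \<noteq> s) \<rparr>)"

definition loop_tangle :: "bool \<Rightarrow> tangle" where
  "loop_tangle s =
    \<lparr> discs = {}, strings = {0}, regions = {0, 1},
      colour_of = (\<lambda>_. (0, s)),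
      point_string = (\<lambda>d j. 0),
      interval_region = (\<lambda>d j. 0),
      side_region = side_by (\<lambda>r. odd r \<noteq> s) (\<lambda>e. 0) (\<lambda>e. 1),
      shaded = (\<lambda>r. odd r \<noteq> s) \<rparr>"

text \<open>
  The clockwise rotation by one click of a box of colour \<open>(2, s)\<close>: point \<open>j\<close> of the box is joined to
  point \<open>j + 1\<close> (mod \<open>4\<close>) of the output disc, whose colour is \<open>(2, \<not> s)\<close>. Strings and regions are
  numbered from the output disc.
\<close>

definition fourier_tangle :: "bool \<Rightarrow> tangle" where
  "fourier_tangle s =
    \<lparr> discs = {0}, strings = {..<4}, regions = {..<4},
      colour_of = (\<lambda>d. if d = None then (2, \<not> s) else (2, s)),
      point_string = (\<lambda>d j. if d = None then j else Suc j mod 4),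
      interval_region = (\<lambda>d j. if d = None then j else Suc j mod 4),
      side_region = side_by (\<lambda>r. odd r = s) (\<lambda>e. e) (\<lambda>e. Suc e mod 4),
      shaded = (\<lambda>r. odd r = s) \<rparr>"


section \<open>Subfactor planar algebras\<close>

text \<open>
  The complex vector spaces \<open>box_space A (n, s)\<close> are subspaces of one ambient vector space, with scalar
  multiplication \<open>scl A\<close>; the ambient space plays no role (it can always be taken to be the direct
  sum of the spaces). The inputs of a tangle are given as a function on its input discs.
\<close>

record 'a planar_structure =
  scl :: "complex \<Rightarrow> 'a \<Rightarrow> 'a"
  box_space :: "colour \<Rightarrow> 'a set"
  act :: "tangle \<Rightarrow> (nat \<Rightarrow> 'a) \<Rightarrow> 'a"
  star :: "colour \<Rightarrow> 'a \<Rightarrow> 'a"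

definition inputs :: "'a planar_structure \<Rightarrow> tangle \<Rightarrow> (nat \<Rightarrow> 'a) set" where
  "inputs A T = {x. \<forall>d \<in> discs T. x d \<in> box_space A (colour_of T (Some d))}"

definition planar_algebra :: "'a::ab_group_add planar_structure \<Rightarrow> bool" where
  "planar_algebra A \<longleftrightarrow>
     vector_space (scl A)
     \<and> (\<forall>k. module.subspace (scl A) (box_space A k))
     \<and> (\<forall>T x. planar_tangle T \<and> x \<in> inputs A T \<longrightarrow> act A T x \<in> box_space A (colour_of T None))
     \<and> (\<forall>T x y. planar_tangle T \<and> x \<in> inputs A T \<and> (\<forall>d \<in> discs T. x d = y d)
          \<longrightarrow> act A T x = act A T y)
     \<and> (\<forall>T x d a b c. planar_tangle T \<and> x \<in> inputs A T \<and> d \<in> discs T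
          \<and> a \<in> box_space A (colour_of T (Some d)) \<and> b \<in> box_space A (colour_of T (Some d))
          \<longrightarrow> act A T (x(d := a + b)) = act A T (x(d := a)) + act A T (x(d := b))
            \<and> act A T (x(d := scl A c a)) = scl A c (act A T (x(d := a))))
     \<and> (\<forall>T U f x. planar_tangle T \<and> planar_tangle U \<and> isotopy T U f \<and> x \<in> inputs A U
          \<longrightarrow> act A U x = act A T (x \<circ> f))
     \<and> (\<forall>T i S U f g x. planar_tangle T \<and> planar_tangle S \<and> planar_tangle U
          \<and> glueing T i S U f g \<and> x \<in> inputs A U
          \<longrightarrow> act A U x = act A T ((x \<circ> f)(i := act A S (x \<circ> g))))
     \<and> (\<forall>k x. x 0 \<in> box_space A k \<longrightarrow> act A (identity_tangle k) x = x 0)"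

definition planar_star_algebra :: "'a::ab_group_add planar_structure \<Rightarrow> bool" where
  "planar_star_algebra A \<longleftrightarrow> planar_algebra A
     \<and> (\<forall>k. \<forall>a \<in> box_space A k. star A k a \<in> box_space A k \<and> star A k (star A k a) = a
          \<and> (\<forall>b \<in> box_space A k. star A k (a + b) = star A k a + star A k b)
          \<and> (\<forall>c. star A k (scl A c a) = scl A (cnj c) (star A k a)))
     \<and> (\<forall>T x. planar_tangle T \<and> x \<in> inputs A T
          \<longrightarrow> star A (colour_of T None) (act A T x)
              = act A (mirror T) (\<lambda>d. star A (colour_of T (Some d)) (x d)))"

definition unit_of :: "'a planar_structure \<Rightarrow> colour \<Rightarrow> 'a" where
  "unit_of A k = act A (unit_tangle k) (\<lambda>_. undefined)"

definition box_mult :: "'a planar_structure \<Rightarrow> colour \<Rightarrow> 'a \<Rightarrow> 'a \<Rightarrow> 'a" where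
  "box_mult A k x y = act A (mult_tangle k) (\<lambda>d. if d = 0 then x else y)"

text \<open>The identification of the one-dimensional space \<open>box_space A (0, s)\<close> with the complex numbers.\<close>

definition scalar :: "'a planar_structure \<Rightarrow> bool \<Rightarrow> 'a \<Rightarrow> complex" where
  "scalar A s x = (THE c. x = scl A c (unit_of A (0, s)))"

definition tr :: "'a planar_structure \<Rightarrow> colour \<Rightarrow> 'a \<Rightarrow> complex" where
  "tr A k x = scalar A (snd k) (act A (trace_tangle k) (\<lambda>_. x))"

definition spherical :: "'a planar_structure \<Rightarrow> bool" where
  "spherical A \<longleftrightarrow> (\<forall>T s r x. planar_tangle T \<and> colour_of T None = (0, s) \<and> r \<in> regions T
     \<and> x \<in> inputs A T
     \<longrightarrow> scalar A s (act A T x) = scalar A (shaded T r) (act A (move_infinity r T) x))"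

definition subfactor_planar_algebra :: "'a::ab_group_add planar_structure \<Rightarrow> bool" where
  "subfactor_planar_algebra A \<longleftrightarrow> planar_star_algebra A
     \<and> (\<forall>k. \<exists>B. finite B \<and> module.span (scl A) B = box_space A k)
     \<and> (\<forall>s. vector_space.dim (scl A) (box_space A (0, s)) = 1)
     \<and> spherical A
     \<and> (\<forall>k. \<forall>x \<in> box_space A k. x \<noteq> 0 \<longrightarrow>
          tr A k (box_mult A k (star A k x) x) \<in> \<real> \<and> 0 < Re (tr A k (box_mult A k (star A k x) x)))"

definition irreducible_planar_algebra :: "'a::ab_group_add planar_structure \<Rightarrow> bool" where
  "irreducible_planar_algebra A \<longleftrightarrow> (\<forall>s. vector_space.dim (scl A) (box_space A (1, s)) = 1)"

text \<open>By sphericality the value of a closed loop does not depend on the shading.\<close>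

definition loop_value :: "'a planar_structure \<Rightarrow> real" where
  "loop_value A = Re (scalar A False (act A (loop_tangle False) (\<lambda>_. undefined)))"

definition fourier :: "'a planar_structure \<Rightarrow> bool \<Rightarrow> 'a \<Rightarrow> 'a" where
  "fourier A s x = act A (fourier_tangle s) (\<lambda>_. x)"


section \<open>Norms\<close>

definition spectral_decomposition ::
    "'a::ab_group_add planar_structure \<Rightarrow> colour \<Rightarrow> 'a \<Rightarrow> real set \<Rightarrow> (real \<Rightarrow> 'a) \<Rightarrow> bool" where
  "spectral_decomposition A k a L e \<longleftrightarrow> finite L
     \<and> (\<forall>l \<in> L. e l \<in> box_space A k \<and> star A k (e l) = e l \<and> box_mult A k (e l) (e l) = e l)
     \<and> (\<forall>l \<in> L. \<forall>m \<in> L. l \<noteq> m \<longrightarrow> box_mult A k (e l) (e m) = 0)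
     \<and> (\<Sum>l \<in> L. e l) = unit_of A k
     \<and> (\<Sum>l \<in> L. scl A (complex_of_real l) (e l)) = a"

text \<open>
  Functional calculus of a self-adjoint element; the value does not depend on the
  decomposition, in which projections are allowed to vanish.
\<close>

definition fun_calc ::
    "'a::ab_group_add planar_structure \<Rightarrow> colour \<Rightarrow> (real \<Rightarrow> real) \<Rightarrow> 'a \<Rightarrow> 'a" where
  "fun_calc A k f a = (THE b. \<exists>L e. spectral_decomposition A k a L e
     \<and> b = (\<Sum>l \<in> L. scl A (complex_of_real (f l)) (e l)))"

definition abs_elt :: "'a::ab_group_add planar_structure \<Rightarrow> colour \<Rightarrow> 'a \<Rightarrow> 'a" where
  "abs_elt A k x = fun_calc A k sqrt (box_mult A k (star A k x) x)"

text \<open>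
  The operator norm is that of left multiplication on the Hilbert space \<open>box_space A k\<close> with inner
  product given by the trace.
\<close>

definition norm2 :: "'a planar_structure \<Rightarrow> colour \<Rightarrow> 'a \<Rightarrow> real" where
  "norm2 A k x = sqrt (Re (tr A k (box_mult A k (star A k x) x)))"

definition op_norm :: "'a planar_structure \<Rightarrow> colour \<Rightarrow> 'a \<Rightarrow> real" where
  "op_norm A k x = (SUP y \<in> {y \<in> box_space A k. norm2 A k y \<le> 1}. norm2 A k (box_mult A k x y))"

definition p_norm :: "'a::ab_group_add planar_structure \<Rightarrow> colour \<Rightarrow> ereal \<Rightarrow> 'a \<Rightarrow> real" where
  "p_norm A k p x =
     (if p = \<infinity> then op_norm A k x
      else Re (tr A k (fun_calc A k (\<lambda>l. l powr real_of_ereal p) (abs_elt A k x)))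
             powr (1 / real_of_ereal p))"


section \<open>The constant\<close>

definition R_F :: "(real \<times> real) set" where
  "R_F = {(s, t). s \<ge> 0 \<and> t \<ge> 0 \<and> s + t \<le> 1 \<and> t \<le> 1/2}"

definition R_T :: "(real \<times> real) set" where
  "R_T = {(s, t). s \<ge> 0 \<and> t \<ge> 0 \<and> s + t \<ge> 1 \<and> s \<ge> 1/2}"

definition R_TF :: "(real \<times> real) set" where
  "R_TF = {(s, t). s \<ge> 0 \<and> t \<ge> 0 \<and> s \<le> 1/2 \<and> t \<ge> 1/2}"

definition K :: "real \<Rightarrow> real \<Rightarrow> real \<Rightarrow> real" where
  "K \<delta> s t =
     (if (s, t) \<in> R_F then \<delta> powr (1 - 2 * s)
      else if (s, t) \<in> R_T then \<delta> powr (2 * t - 1)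
      else if (s, t) \<in> R_TF then \<delta> powr (2 * t - 2 * s)
      else undefined)"

text \<open>The convention \<open>1 / \<infinity> = 0\<close> is that of \<^typ>\<open>ereal\<close>.\<close>

definition recip :: "ereal \<Rightarrow> real" where
  "recip p = real_of_ereal (1 / p)"

end

theory Submission
  imports Defs "HOL-Complex_Analysis.Complex_Analysis" "HOL-Computational_Algebra.Fundamental_Theorem_Algebra"
begin


text \<open>
  Throughout, \<open>\<tau>\<close> is the trace \<open>tr_2\<close>, \<open>F\<close> the string Fourier transform, \<open>\<langle>a, b\<rangle> = \<tau>(a\<^sup>* b)\<close>, and \<open>t\<close> stands for
  the exponent \<open>1/p\<close>, so that \<open>t = 0\<close> is the operator norm.

  Everything rests on one estimate. Let \<open>u\<close> be a partial isometry in one 2-box space and \<open>c, y\<close>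
  elements of the other. Then
  \<open>|\<langle>c, F(u) y\<rangle>| \<le> \<delta>\<^sup>-\<^sup>1 \<tau>(u\<^sup>* u) \<parallel>c\<parallel>\<^sub>2 \<parallel>y\<parallel>\<^sub>2\<close> (lemma \<open>partial_isometry_bound_neg\<close>).
  To see this, write \<open>u = u (u\<^sup>* u)\<close> in the closed diagram of \<open>\<tau>(c\<^sup>* F(u) y)\<close> and cut the diagram
  between \<open>u\<close> and \<open>u\<^sup>* u\<close>. It becomes an inner product of two elements of the 3-box space, one
  made of \<open>u\<close> and \<open>c\<close>, the other of \<open>u\<^sup>* u\<close> and \<open>y\<close>. The squared norm of each is a closed diagram
  that contains a partial closure of a 2-box product as a bead on a string. By irreducibility that
  bead is a multiple of the string, hence each squared norm is \<open>\<delta>\<^sup>-\<^sup>1\<close> times a product of two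
  traces (lemmas \<open>norm_leg_c\<close> and \<open>norm_leg_y\<close>), and the Cauchy--Schwarz inequality gives the claim.

  With \<open>y = g\<^sup>* g\<close> and \<open>c = g\<close> for a second partial isometry \<open>g\<close>, the estimate becomes
  \<open>|\<langle>g, F(u)\<rangle>| \<le> \<delta>\<^sup>-\<^sup>1 \<tau>(u\<^sup>* u) \<tau>(g\<^sup>* g)\<close>. Every element is a combination \<open>\<Sum> i u\<^sub>i\<close> of partial
  isometries over its singular values \<open>i > 0\<close>, and \<open>\<parallel>x\<parallel>\<^sub>p\<close> is the \<open>l\<^sup>p\<close> norm of the family of
  singular values with the weights \<open>\<tau>(u\<^sub>i\<^sup>* u\<^sub>i)\<close>. So the estimate says that \<open>F\<close> maps \<open>L\<^sup>1\<close> to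
  \<open>L\<^sup>\<infinity>\<close> with norm at most \<open>\<delta>\<^sup>-\<^sup>1\<close>. As \<open>F\<close> preserves \<open>\<parallel>\<cdot>\<parallel>\<^sub>2\<close> by sphericality, complex
  interpolation gives \<open>\<parallel>F(x)\<parallel>\<^sub>q \<le> \<delta> powr (2/q - 1) \<parallel>x\<parallel>\<^sub>p\<close> for \<open>1/p + 1/q = 1\<close> and \<open>p \<le> 2\<close> (lemma
  \<open>Hausdorff_Young\<close>). Only a bilinear interpolation theorem for the finite matrix
  \<open>\<langle>g\<^sub>j, F(u\<^sub>i)\<rangle>\<close> is needed for this, because the singular value decompositions of \<open>x\<close> and \<open>F(x)\<close>
  stay fixed and only the singular values vary.

  Two elementary comparisons complete the upper bound. The weights sum up to at most
  \<open>\<tau>(1) = \<delta>\<^sup>2\<close>, hence \<open>\<parallel>x\<parallel>\<^sub>p \<le> \<delta> powr (2 t - 2 t') \<parallel>x\<parallel>\<^sub>r\<close> for \<open>t = 1/p \<ge> t' = 1/r\<close>. And every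
  weight is at least \<open>1\<close>: for a partial isometry \<open>u \<noteq> 0\<close>, the \<open>L\<^sup>1\<close>--\<open>L\<^sup>\<infinity>\<close> bound applied to
  \<open>F(u)\<^sup>*\<close>, whose transform is \<open>u\<^sup>*\<close>, gives
  \<open>1 = \<parallel>u\<^sup>*\<parallel>\<^sub>\<infinity> \<le> \<delta>\<^sup>-\<^sup>1 \<parallel>F(u)\<parallel>\<^sub>1 \<le> \<parallel>F(u)\<parallel>\<^sub>2 = \<parallel>u\<parallel>\<^sub>2\<close>. So the norms decrease in \<open>p\<close>. In each of
  the three regions the constant \<open>K\<close> is what one obtains by going from \<open>p\<close> to \<open>q\<close> through these
  comparisons and the Hausdorff--Young or the Plancherel identity. The lower bound is the upper
  bound for \<open>F(x)\<^sup>*\<close>, since \<open>F(F(x)\<^sup>*) = x\<^sup>*\<close>.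

  A planar algebra is an action of combinatorial tangles, so each diagrammatic step is a statement
  that some tangle is planar or is a glueing of two others. Such statements about concrete
  tangles are finite. They are decided by executable checks on numbered tables, which are proved
  sound in full generality (\<open>planar_tangle_of_table\<close> and \<open>glueing_of_tables\<close>) and then evaluated by
  rewriting.
\<close>

section \<open>Tables of planar tangles\<close>

text \<open>
  A table \<open>(P, R, S)\<close> lists, for each disc, the strings at its boundary points (\<open>P\<close>) and the regions
  at its boundary intervals (\<open>R\<close>), and for each string the regions on its two sides (\<open>S\<close>). Disc
  \<open>0\<close> is the output disc, and disc \<open>i + 1\<close> is the input disc \<open>i\<close>. Neighbouring regions have numbers of
  different parity, the even ones having a shade \<open>s\<close> that is not part of the table; thus one table
  describes a tangle together with the tangle of the opposite shading.
\<close>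

type_synonym table = "nat list list \<times> nat list list \<times> (nat \<times> nat) list"

definition disc_index :: "nat option \<Rightarrow> nat" where
  "disc_index d = (case d of None \<Rightarrow> 0 | Some i \<Rightarrow> Suc i)"

definition table_regions :: "table \<Rightarrow> nat list" where
  "table_regions = (\<lambda>(P, R, S). concat R @ map fst S @ map snd S)"

definition presented :: "tangle \<Rightarrow> bool \<Rightarrow> table \<Rightarrow> bool" where
  "presented T s = (\<lambda>(P, R, S).
     discs T = {..<length P - 1} \<and> strings T = {..<length S}
     \<and> regions T = set (table_regions (P, R, S))
     \<and> (\<forall>d \<in> all_discs T.
          colour_of T d = (length (P ! disc_index d) div 2, odd (R ! disc_index d ! 0) \<noteq> s)
          \<and> (\<forall>j < length (P ! disc_index d). point_string T d j = P ! disc_index d ! j)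
          \<and> (\<forall>j < length (R ! disc_index d). interval_region T d j = R ! disc_index d ! j))
     \<and> (\<forall>e < length S. side_region T e s = fst (S ! e) \<and> side_region T e (\<not> s) = snd (S ! e))
     \<and> (\<forall>r \<in> regions T. shaded T r = (odd r \<noteq> s)))"

definition corners :: "'b list list \<Rightarrow> (nat \<times> nat) list" where
  "corners X = concat (map (\<lambda>d. map (Pair d) [0..<length (X ! d)]) [0..<length X])"

definition entry :: "'b list list \<Rightarrow> nat \<times> nat \<Rightarrow> 'b" where
  "entry X = (\<lambda>(d, j). X ! d ! j)"

text \<open>
  A corner \<open>(d, j)\<close> is the boundary point \<open>j\<close> of disc \<open>d\<close> or the interval that precedes it. Where the even
  regions have shade \<open>s\<close>, the points in \<open>half_ends t s\<close> are those where a string starts; this is the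
  parity form of \<open>starts_at\<close>, which treats the output disc in the opposite way.
\<close>

definition half_ends :: "table \<Rightarrow> bool \<Rightarrow> (nat \<times> nat) list" where
  "half_ends = (\<lambda>(P, R, S) b. filter (\<lambda>a. (even (entry R a) = (fst a \<noteq> 0)) = b) (corners P))"

text \<open>
  A walk along the boundary of a region keeps the region on one side. It runs along a boundary
  interval of a disc, then along the string \<open>leave P a\<close> to the interval of the next corner \<open>b\<close>, for
  which that string is \<open>arrive P b\<close>. The output disc is seen from its inside, so its boundary is
  traversed in the opposite sense.
\<close>

definition leave :: "nat list list \<Rightarrow> nat \<times> nat \<Rightarrow> nat" where
  "leave P = (\<lambda>(d, j). let n = length (P ! d) in P ! d ! (if d = 0 then (j + n - 1) mod n else j))"

definition arrive :: "nat list list \<Rightarrow> nat \<times> nat \<Rightarrow> nat" where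
  "arrive P = (\<lambda>(d, j). let n = length (P ! d) in P ! d ! (if d = 0 then j else (j + n - 1) mod n))"

definition linked :: "table \<Rightarrow> nat \<times> nat \<Rightarrow> nat \<times> nat \<Rightarrow> bool" where
  "linked = (\<lambda>(P, R, S) a b. P ! fst a \<noteq> [] \<and> P ! fst b \<noteq> []
     \<and> leave P a = arrive P b \<and> entry R a = entry R b)"

fun walk :: "table \<Rightarrow> (nat \<times> nat) list \<Rightarrow> bool" where
  "walk t [] = False"
| "walk t [a] = True"
| "walk t (a # b # w) = (linked t a b \<and> walk t (b # w))"

text \<open>
  The boundary walks are found by a search. Nothing is proved about it: its results are checked
  afterwards to be walks that cover all corners.
\<close>

fun trail :: "table \<Rightarrow> (nat \<times> nat) list \<Rightarrow> nat \<Rightarrow> nat \<times> nat \<Rightarrow> nat \<times> nat \<Rightarrow> (nat \<times> nat) list" where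
  "trail t cs 0 a0 a = [a]"
| "trail t cs (Suc k) a0 a = a # (case find (linked t a) cs of None \<Rightarrow> []
      | Some b \<Rightarrow> if b = a0 then [] else trail t cs k a0 b)"

definition walks :: "table \<Rightarrow> (nat \<times> nat) list list" where
  "walks t = (let cs = corners (fst (snd t)) in
     fold (\<lambda>a W. if list_ex (\<lambda>w. List.member w a) W then W else trail t cs (length cs) a a # W) cs [])"

fun spread_string :: "nat \<times> nat \<Rightarrow> nat list \<Rightarrow> nat list" where
  "spread_string (a, b) X = (if List.member X a then List.insert b X
     else if List.member X b then List.insert a X else X)"

definition spread :: "(nat \<times> nat) list \<Rightarrow> nat list \<Rightarrow> nat list" where
  "spread S = fold spread_string S"

text \<open>
  The condition on the corners says that the regions on both sides of a string are those
  of the intervals next to its end points. It forces the parities to alternate around each disc.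
\<close>

definition well_formed :: "table \<Rightarrow> bool" where
  "well_formed = (\<lambda>(P, R, S).
    P \<noteq> [] \<and> length R = length P
    \<and> list_all2 (\<lambda>ps rs. even (length ps) \<and> length rs = max 1 (length ps)) P R
    \<and> list_all (\<lambda>(d, j). let e = P ! d ! j; a = R ! d ! j; b = R ! d ! (Suc j mod length (P ! d)) in
         e < length S \<and> S ! e = (if even a then (a, b) else (b, a))) (corners P)
    \<and> list_all (\<lambda>(a, b). even a \<and> odd b) S)"

text \<open>
  The strings at \<open>A\<close> and at \<open>B\<close> are those with a start and those with an end, so every string is a loop
  or has exactly one of each. Any two pieces of one boundary curve lie in the same region, hence
  walks in different regions belong to different curves; a disc without boundary points is a curve
  of its own. Since each loop has two further curves, the last equation is Euler's formula for
  the sphere. It gives the right number of curves only if every region has at most one boundary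
  curve with corners on discs that have points, which is what distinctness of the labels demands.
  Three passes through the strings suffice to reach all regions of the tables below; a
  connected table for which they do not is merely rejected.
\<close>

definition planar_table :: "table \<Rightarrow> bool" where
  "planar_table t = (case t of (P, R, S) \<Rightarrow>
    let A = map (entry P) (half_ends t True); B = map (entry P) (half_ends t False); W = walks t in
    well_formed t
    \<and> distinct A \<and> distinct B \<and> list_all (List.member A) B \<and> list_all (List.member B) A
    \<and> list_all (List.member (spread (S @ S @ S) [hd (hd R)])) (table_regions t)
    \<and> list_all (walk t) W
    \<and> distinct (map (\<lambda>w. (entry R (hd w), if P ! fst (hd w) = [] then Suc (fst (hd w)) else 0)) W)
    \<and> list_all (List.member (corners R)) (concat W)
    \<and> list_all (List.member (concat W)) (corners R)
    \<and> length P + 2 * length (remdups (table_regions t)) + length A = length W + 2 * length S + 2)"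

lemma set_corners: "set (corners X) = {(d, j). d < length X \<and> j < length (X ! d)}"
  by (auto simp: corners_def)

definition disc_of :: "nat \<Rightarrow> nat option" where
  "disc_of d = (case d of 0 \<Rightarrow> None | Suc i \<Rightarrow> Some i)"

lemma disc_of_index [simp]: "disc_of (disc_index d) = d"
  by (cases d) (auto simp: disc_of_def disc_index_def)

lemma disc_index_of [simp]: "disc_index (disc_of d) = d"
  by (cases d) (auto simp: disc_of_def disc_index_def)

lemma disc_index_eq_0 [simp]: "disc_index d = 0 \<longleftrightarrow> d = None"
  by (cases d) (auto simp: disc_index_def)

lemma disc_of_eq_None [simp]: "disc_of d = None \<longleftrightarrow> d = 0"
  by (cases d) (auto simp: disc_of_def)

lemma gen_equiv_refl [simp]: "(a, a) \<in> gen_equiv r"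
  by (simp add: gen_equiv_def)

lemma gen_equiv_base: "(a, b) \<in> r \<Longrightarrow> (a, b) \<in> gen_equiv r"
  by (auto simp: gen_equiv_def)

lemma gen_equiv_sym: "(a, b) \<in> gen_equiv r \<Longrightarrow> (b, a) \<in> gen_equiv r"
proof -
  have "sym (r \<union> r\<inverse>)" by (auto simp: sym_def)
  then show "(a, b) \<in> gen_equiv r \<Longrightarrow> (b, a) \<in> gen_equiv r"
    unfolding gen_equiv_def by (blast intro: symD sym_rtrancl)
qed

lemma gen_equiv_trans: "(a, b) \<in> gen_equiv r \<Longrightarrow> (b, c) \<in> gen_equiv r \<Longrightarrow> (a, c) \<in> gen_equiv r"
  unfolding gen_equiv_def by (rule rtrancl_trans)

text \<open>
  A function that is constant along the generators is constant on the classes.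
\<close>

lemma gen_equiv_invariant:
  assumes "(a, b) \<in> gen_equiv r" and "\<And>x y. (x, y) \<in> r \<Longrightarrow> f x = f y"
  shows "f a = f b"
  using assms(1) unfolding gen_equiv_def
  by (induction rule: rtrancl_induct) (use assms(2) in auto)

text \<open>
  Classes are counted by a set \<open>X\<close> of representatives: the invariant \<open>f\<close> separates them, so no
  explicit description of the classes is necessary.
\<close>

lemma card_quotient_gen_equiv:
  assumes "X \<subseteq> A" and "inj_on f X" and "\<And>x y. (x, y) \<in> r \<Longrightarrow> f x = f y"
    and "\<And>a. a \<in> A \<Longrightarrow> \<exists>x \<in> X. (x, a) \<in> gen_equiv r"
  shows "card (A // gen_equiv r) = card X"
proof -
  have cls: "gen_equiv r `` {a} = gen_equiv r `` {b}" if "(a, b) \<in> gen_equiv r" for a b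
    using that by (auto intro: gen_equiv_trans gen_equiv_sym)
  have "A // gen_equiv r = (\<lambda>x. gen_equiv r `` {x}) ` X"
  proof (intro subset_antisym subsetI)
    fix C assume "C \<in> A // gen_equiv r"
    then obtain a where "a \<in> A" "C = gen_equiv r `` {a}" by (auto simp: quotient_def)
    with assms(4)[of a] cls show "C \<in> (\<lambda>x. gen_equiv r `` {x}) ` X" by blast
  next
    fix C assume "C \<in> (\<lambda>x. gen_equiv r `` {x}) ` X"
    with assms(1) show "C \<in> A // gen_equiv r" by (auto simp: quotient_def)
  qed
  moreover have "inj_on (\<lambda>x. gen_equiv r `` {x}) X"
  proof (rule inj_onI)
    fix x y assume xy: "x \<in> X" "y \<in> X" "gen_equiv r `` {x} = gen_equiv r `` {y}"
    have "y \<in> gen_equiv r `` {y}" by simp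
    with xy(3) have "y \<in> gen_equiv r `` {x}" by simp
    then have "(x, y) \<in> gen_equiv r" by simp
    then have "f x = f y" by (rule gen_equiv_invariant) (rule assms(3))
    with xy assms(2) show "x = y" by (auto dest: inj_onD)
  qed
  ultimately show ?thesis by (simp add: card_image)
qed

text \<open>
  The tangle \<open>T\<close> need not be constructed from the table. This allows tables of the tangles that define
  multiplication, trace and Fourier transform, whose strings and regions are numbered by the
  same naturals.
\<close>

locale presented_tangle =
  fixes T :: tangle and s :: bool and P R :: "nat list list" and S :: "(nat \<times> nat) list"
  assumes pres: "presented T s (P, R, S)" and wf: "well_formed (P, R, S)"
begin

lemma nonempty: "P \<noteq> []" "length R = length P"
  using wf by (auto simp: well_formed_def)

lemma disc_index_less: "d \<in> all_discs T \<Longrightarrow> disc_index d < length P"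
  using pres nonempty by (auto simp: presented_def all_discs_def disc_index_def)

lemma disc_of_all: "d < length P \<Longrightarrow> disc_of d \<in> all_discs T"
  using pres nonempty by (auto simp: presented_def all_discs_def disc_of_def split: nat.splits)

lemma lengths:
  assumes "d < length P"
  shows "even (length (P ! d))" "length (R ! d) = max 1 (length (P ! d))"
proof -
  have "list_all2 (\<lambda>ps rs. even (length ps) \<and> length rs = max 1 (length ps)) P R"
    using wf by (simp add: well_formed_def)
  from list_all2_nthD[OF this assms] show "even (length (P ! d))" "length (R ! d) = max 1 (length (P ! d))"
    by blast+
qed

lemma npoints: "d \<in> all_discs T \<Longrightarrow> npoints T d = length (P ! disc_index d)"
  using pres lengths(1)[OF disc_index_less] by (auto simp: presented_def npoints_def)

lemma nintervals: "d \<in> all_discs T \<Longrightarrow> nintervals T d = length (R ! disc_index d)"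
  by (simp add: nintervals_def npoints lengths(2) disc_index_less)

lemma points_iff:
  "(d, j) \<in> points T \<longleftrightarrow> d \<in> all_discs T \<and> j < length (P ! disc_index d)"
  by (auto simp: points_def npoints)

lemma point_string: "(d, j) \<in> points T \<Longrightarrow> point_string T d j = P ! disc_index d ! j"
  using pres by (auto simp: presented_def points_iff)

lemma interval_region:
  "d \<in> all_discs T \<Longrightarrow> j < length (R ! disc_index d) \<Longrightarrow> interval_region T d j = R ! disc_index d ! j"
  using pres by (auto simp: presented_def)

lemma string_sides:
  assumes "d < length P" "j < length (P ! d)"
  shows "P ! d ! j < length S"
    and "S ! (P ! d ! j) = (let a = R ! d ! j; b = R ! d ! (Suc j mod length (P ! d))
           in if even a then (a, b) else (b, a))"
  using wf assms by (auto simp: well_formed_def list_all_iff set_corners Let_def)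

lemma parity_sides: "e < length S \<Longrightarrow> even (fst (S ! e)) \<and> odd (snd (S ! e))"
proof -
  assume "e < length S"
  then have "S ! e \<in> set S" by simp
  moreover have "\<forall>(a, b) \<in> set S. even a \<and> odd b" using wf by (simp add: well_formed_def list_all_iff)
  ultimately show "even (fst (S ! e)) \<and> odd (snd (S ! e))" by (metis case_prod_beta)
qed

lemma parity_step:
  assumes "d < length P" "j < length (P ! d)"
  shows "even (R ! d ! (Suc j mod length (P ! d))) \<longleftrightarrow> odd (R ! d ! j)"
  using parity_sides[OF string_sides(1)[OF assms]] string_sides(2)[OF assms]
  by (auto simp: Let_def split: if_splits)

lemma parity_interval:
  assumes "d < length P" "j < length (R ! d)"
  shows "odd (R ! d ! j) \<longleftrightarrow> odd j \<noteq> odd (R ! d ! 0)"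
  using assms(2)
proof (induction j)
  case (Suc j)
  then have "Suc j < length (P ! d)" using lengths(2)[OF assms(1)] by auto
  with parity_step[OF assms(1), of j] Suc show ?case by auto
qed simp

lemma interval_shade:
  assumes "d \<in> all_discs T" "j < length (R ! disc_index d)"
  shows "interval_shade T d j \<longleftrightarrow> odd (R ! disc_index d ! j) \<noteq> s"
proof -
  have "colour_of T d = (length (P ! disc_index d) div 2, odd (R ! disc_index d ! 0) \<noteq> s)"
    using pres assms(1) by (auto simp: presented_def)
  with parity_interval[OF disc_index_less[OF assms(1)] assms(2)] show ?thesis
    by (auto simp: interval_shade_def)
qed

lemma length_P_R: "d < length P \<Longrightarrow> j < length (P ! d) \<Longrightarrow> j < length (R ! d)"
  using lengths(2) by simp

lemma side_region:
  assumes "e < length S"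
  shows "side_region T e c = (if c = s then fst (S ! e) else snd (S ! e))"
  using pres assms by (cases "c = s") (auto simp: presented_def)

lemma corner_sides:
  assumes "(d, j) \<in> points T"
  shows "point_string T d j < length S"
    and "side_region T (point_string T d j) (interval_shade T d j) = R ! disc_index d ! j"
    and "side_region T (point_string T d j) (\<not> interval_shade T d j)
           = R ! disc_index d ! (Suc j mod length (P ! disc_index d))"
proof -
  have d: "d \<in> all_discs T" "disc_index d < length P" "j < length (P ! disc_index d)"
    using assms by (auto simp: points_iff disc_index_less)
  show e: "point_string T d j < length S"
    using string_sides(1)[OF d(2,3)] by (simp add: point_string[OF assms])
  note sh = interval_shade[OF d(1) length_P_R[OF d(2,3)]]
  show "side_region T (point_string T d j) (interval_shade T d j) = R ! disc_index d ! j"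
    and "side_region T (point_string T d j) (\<not> interval_shade T d j)
           = R ! disc_index d ! (Suc j mod length (P ! disc_index d))"
    using string_sides(2)[OF d(2,3)] 
    by (auto simp: side_region[OF e[unfolded point_string[OF assms]]] sh point_string[OF assms] Let_def)
qed

lemma Suc_mod_interval:
  assumes "(d, j) \<in> points T"
  shows "Suc j mod length (P ! disc_index d) < length (R ! disc_index d)"
  using assms lengths(2)[OF disc_index_less] by (auto simp: points_iff intro: less_le_trans[OF mod_less_divisor])

lemma meeting_cases:
  assumes "(a, b) \<in> meeting T"
  obtains (left) d j where "(d, j) \<in> points T" "a = Interval d j"
      "b = Side (point_string T d j) (interval_shade T d j)"
  | (right) d j where "(d, j) \<in> points T" "a = Interval d (Suc j mod length (P ! disc_index d))"
      "b = Side (point_string T d j) (\<not> interval_shade T d j)"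
proof -
  from assms consider d j where "(d, j) \<in> points T" "a = Interval d j"
      "b = Side (point_string T d j) (interval_shade T d j)"
    | d j where "(d, j) \<in> points T" "a = Interval d (Suc j mod npoints T d)"
      "b = Side (point_string T d j) (\<not> interval_shade T d j)"
    unfolding meeting_def by blast
  then show thesis
  proof cases
    case 1
    then show thesis by (rule left)
  next
    case 2
    then have "d \<in> all_discs T" by (simp add: points_iff)
    with 2 show thesis by (intro right) (simp_all add: npoints)
  qed
qed

lemma regions_eq: "regions T = set (table_regions (P, R, S))"
  using pres by (simp add: presented_def)

lemma strings_eq: "strings T = {..<length S}"
  using pres by (simp add: presented_def)

lemma region_of_interval: "d \<in> all_discs T \<Longrightarrow> j < length (R ! disc_index d) \<Longrightarrow> R ! disc_index d ! j \<in> regions T"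
  using disc_index_less[of d] nonempty nth_mem by (fastforce simp: regions_eq table_regions_def)

lemma interval_to_side:
  assumes "d \<in> all_discs T" "j < length (P ! disc_index d)"
  shows "(Interval d j, Side (leave P (disc_index d, j)) (interval_shade T d j)) \<in> meeting T"
    and "(Interval d j, Side (arrive P (disc_index d, j)) (interval_shade T d j)) \<in> meeting T"
proof -
  let ?n = "length (P ! disc_index d)" let ?i = "(j + ?n - 1) mod ?n"
  have n: "even ?n" "0 < ?n" using assms lengths(1)[OF disc_index_less] by auto
  have pt: "(d, j) \<in> points T" "(d, ?i) \<in> points T" using assms n by (auto simp: points_iff)
  have i: "Suc ?i mod ?n = j" "odd ?i \<longleftrightarrow> even j"
  proof -
    show "Suc ?i mod ?n = j" using assms(2) n
      by (cases j) (auto simp: mod_Suc)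
    show "odd ?i \<longleftrightarrow> even j" using assms(2) n by (cases j) auto
  qed
  have 1: "(Interval d j, Side (point_string T d j) (interval_shade T d j)) \<in> meeting T"
    using pt(1) by (auto simp: meeting_def)
  have "(Interval d (Suc ?i mod npoints T d), Side (point_string T d ?i) (\<not> interval_shade T d ?i)) \<in> meeting T"
    using pt(2) unfolding meeting_def by blast
  moreover have "(\<not> interval_shade T d ?i) = interval_shade T d j"
    using i(2) by (auto simp: interval_shade_def)
  ultimately have 2: "(Interval d j, Side (point_string T d ?i) (interval_shade T d j)) \<in> meeting T"
    using i(1) assms(1) by (simp add: npoints)
  have l: "leave P (disc_index d, j) = (if d = None then point_string T d ?i else point_string T d j)"
    and r: "arrive P (disc_index d, j) = (if d = None then point_string T d j else point_string T d ?i)"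
    unfolding point_string[OF pt(1)] point_string[OF pt(2)] leave_def arrive_def Let_def by simp_all
  show "(Interval d j, Side (leave P (disc_index d, j)) (interval_shade T d j)) \<in> meeting T"
    unfolding l by (rule if_split[THEN iffD2]) (use 1 2 in blast)
  show "(Interval d j, Side (arrive P (disc_index d, j)) (interval_shade T d j)) \<in> meeting T"
    unfolding r by (rule if_split[THEN iffD2]) (use 1 2 in blast)
qed

text \<open>
  An interval meets the string that leaves it, and that string meets the next interval, on
  the side of the common region.
\<close>

lemma linked_equiv:
  assumes "linked (P, R, S) (d, j) (d', j')" "(d, j) \<in> set (corners R)" "(d', j') \<in> set (corners R)"
  shows "(Interval (disc_of d) j, Interval (disc_of d') j') \<in> gen_equiv (meeting T)"
proof -
  have *: "disc_of d \<in> all_discs T" "disc_of d' \<in> all_discs T" "j < length (P ! d)" "j' < length (P ! d')"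
    "j < length (R ! d)" "j' < length (R ! d')"
    using assms nonempty lengths(2) 
    by (auto simp: set_corners linked_def disc_of_all max_def Suc_le_eq less_Suc_eq_le split: if_splits)
  have "interval_shade T (disc_of d) j = interval_shade T (disc_of d') j'"
    using assms(1) * by (simp add: interval_shade linked_def entry_def)
  moreover have "leave P (d, j) = arrive P (d', j')" using assms(1) by (simp add: linked_def)
  moreover have "(Interval (disc_of d) j, Side (leave P (d, j)) (interval_shade T (disc_of d) j)) \<in> meeting T"
    using interval_to_side(1)[of "disc_of d" j] * by simp
  moreover have "(Interval (disc_of d') j', Side (arrive P (d', j')) (interval_shade T (disc_of d') j')) \<in> meeting T"
    using interval_to_side(2)[of "disc_of d'" j'] * by simp
  ultimately show ?thesis
    by (simp del: disc_index_of) (rule gen_equiv_trans[OF gen_equiv_base gen_equiv_sym[OF gen_equiv_base]])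
qed

lemma walk_equiv:
  assumes "walk (P, R, S) w" "set w \<subseteq> set (corners R)" "(d, j) \<in> set w"
  shows "(Interval (disc_of (fst (hd w))) (snd (hd w)), Interval (disc_of d) j) \<in> gen_equiv (meeting T)"
  using assms
proof (induction w rule: induct_list012)
  case (3 a b w)
  show ?case
  proof (cases "(d, j) = a")
    case False
    have "(Interval (disc_of (fst a)) (snd a), Interval (disc_of (fst b)) (snd b)) \<in> gen_equiv (meeting T)"
      using 3 by (intro linked_equiv) auto
    moreover have "(Interval (disc_of (fst b)) (snd b), Interval (disc_of d) j) \<in> gen_equiv (meeting T)"
      using 3 False by auto
    ultimately show ?thesis by (auto intro: gen_equiv_trans)
  qed auto
qed auto

lemma flag:
  assumes "(d, j) \<in> points T"
  shows "starts_at T (d, j) \<longleftrightarrow> ((even (R ! disc_index d ! j) = (disc_index d \<noteq> 0)) = s)"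
  using assms length_P_R[OF disc_index_less]
  by (auto simp: starts_at_def interval_shade points_iff)

lemma half_ends_iff:
  "(d, j) \<in> set (half_ends (P, R, S) (b = s)) \<longleftrightarrow> (disc_of d, j) \<in> points T \<and> (starts_at T (disc_of d, j) = b)"
proof -
  have "(d, j) \<in> set (corners P) \<longleftrightarrow> (disc_of d, j) \<in> points T"
    using disc_index_less[of "disc_of d"] by (auto simp: set_corners points_iff disc_of_all)
  then show ?thesis using flag[of "disc_of d" j] by (auto simp: half_ends_def entry_def)
qed

end

text \<open>
  The boundary curves are counted by representatives: the first interval of each walk, and both
  sides of each loop. The label of a piece is its region, together with the disc if the disc has no
  boundary points and the string and side if it is a loop. Labels are constant on curves
  and separate the representatives.
\<close>

lemma planar_tangle_of_table:
  assumes pr: "presented T s t" and pl: "planar_table t"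
  shows "planar_tangle T"
proof -
  obtain P R S where t: "t = (P, R, S)" by (cases t)
  define A where "A b = map (entry P) (half_ends t b)" for b
  define W where "W = walks t"
  have dist: "distinct (A b)" for b
    using pl by (cases b) (simp_all add: planar_table_def t A_def Let_def)
  from pl have wf: "well_formed t" 
    and AB: "set (A True) = set (A False)"
    and conn: "\<forall>r \<in> set (table_regions t). r \<in> set (spread (S @ S @ S) [hd (hd R)])"
    and W: "\<forall>w \<in> set W. walk t w"
    and Wd: "distinct (map (\<lambda>w. (entry R (hd w), if P ! fst (hd w) = [] then Suc (fst (hd w)) else 0)) W)"
    and Wc: "set (concat W) = set (corners R)"
    and eul: "length P + 2 * length (remdups (table_regions t)) + length (A True) = length W + 2 * length S + 2"
    by (auto simp: planar_table_def t A_def W_def Let_def list_all_iff)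
  interpret presented_tangle T s P R S using pr wf by unfold_locales (simp_all add: t)
  have string_end: "e \<in> set (A b) \<longleftrightarrow> (\<exists>a \<in> ends T e. starts_at T a = (b = s))" for e b
  proof
    assume "e \<in> set (A b)"
    then obtain d j where dj: "(d, j) \<in> set (half_ends t b)" "e = P ! d ! j"
      by (auto simp: A_def entry_def)
    then have "(disc_of d, j) \<in> points T \<and> (starts_at T (disc_of d, j) = (b = s))"
      using half_ends_iff[of d j "b = s"] by (cases s) (auto simp: t)
    with dj point_string[of "disc_of d" j] show "\<exists>a \<in> ends T e. starts_at T a = (b = s)"
      by (auto simp: ends_def)
  next
    assume "\<exists>a \<in> ends T e. starts_at T a = (b = s)"
    then obtain d j where dj: "(d, j) \<in> points T" "point_string T d j = e" "starts_at T (d, j) = (b = s)"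
      by (auto simp: ends_def)
    then have "(disc_index d, j) \<in> set (half_ends t b)"
      using half_ends_iff[of "disc_index d" j "b = s"] by (cases s) (auto simp: t)
    with dj point_string[of d j] show "e \<in> set (A b)" by (force simp: A_def entry_def)
  qed
  have unique: "a = a'" if "a \<in> ends T e" "a' \<in> ends T e" "starts_at T a = starts_at T a'" for a a' e
  proof -
    obtain d j d' j' where a: "a = (d, j)" "a' = (d', j')" by (cases a, cases a')
    define b where "b = (starts_at T a = s)"
    have pt: "(d, j) \<in> points T" "(d', j') \<in> points T" using that a by (auto simp: ends_def)
    have "(disc_index d, j) \<in> set (half_ends t b)" "(disc_index d', j') \<in> set (half_ends t b)"
      using half_ends_iff[of "disc_index d" j "starts_at T a"] half_ends_iff[of "disc_index d'" j' "starts_at T a"]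
        pt that(3) by (auto simp: t b_def a)
    moreover have "entry P (disc_index d, j) = entry P (disc_index d', j')"
      using that point_string pt by (auto simp: a entry_def ends_def)
    ultimately have "(disc_index d, j) = (disc_index d', j')"
      using dist[of b] by (auto simp: A_def distinct_map dest: inj_onD)
    then show ?thesis by (metis a disc_of_index prod.inject)
  qed
  have ex1: "(\<exists>!a. a \<in> ends T e \<and> starts_at T a = c)" if "ends T e \<noteq> {}" for e c
  proof -
    from that obtain a where "a \<in> ends T e" by auto
    then have "e \<in> set (A (starts_at T a = s))" using string_end by (cases s) auto
    then have "e \<in> set (A (c = s))" using AB by (cases "starts_at T a = s"; cases "c = s") auto
    then obtain a' where "a' \<in> ends T e" "starts_at T a' = c" using string_end by (cases s) auto
    then show ?thesis using unique by blast
  qed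
  have attached: "{e \<in> strings T. ends T e \<noteq> {}} = set (A True)"
  proof -
    have "e \<in> set (A True) \<longleftrightarrow> ends T e \<noteq> {}" for e
      using string_end[of e True] ex1[of e "True = s"] by auto
    moreover have "ends T e \<noteq> {} \<Longrightarrow> e \<in> strings T" for e
      using corner_sides(1) by (auto simp: ends_def strings_eq)
    ultimately show ?thesis by blast
  qed
  have discs_card: "card (all_discs T) = length P"
    using pr nonempty by (auto simp: presented_def t all_discs_def card_insert_if card_image)
  have region_card: "card (regions T) = length (remdups (table_regions t))"
    by (simp add: regions_eq t length_remdups_card_conv)
  have string_card: "card {e \<in> strings T. ends T e \<noteq> {}} = length (A True)"
    using dist by (simp add: attached distinct_card)

  (* Strings without end points are closed loops, and contribute two boundary curves each. *)
  define loops where "loops = {..<length S} - set (A True)"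
  have loops_ends: "e \<in> loops \<Longrightarrow> ends T e = {}" for e
    using attached by (auto simp: loops_def strings_eq)
  have attached_sub: "set (A True) \<subseteq> {..<length S}"
    using attached by (auto simp: strings_eq)
  define hd_piece where "hd_piece w = Interval (disc_of (fst (hd w))) (snd (hd w))" for w :: "(nat \<times> nat) list"
  define X where "X = hd_piece ` set W \<union> case_prod Side ` (loops \<times> UNIV)"
  define lab where "lab a = (case a of
      Interval d j \<Rightarrow> (R ! disc_index d ! j, if P ! disc_index d = [] then Suc (disc_index d) else 0, None)
    | Side e c \<Rightarrow> (side_region T e c, 0, if e \<in> loops then Some (e, c) else None))" for a
  have W_ne: "w \<noteq> [] \<and> hd w \<in> set (corners R)" if "w \<in> set W" for w
  proof -
    have "w \<noteq> []" using W that by (cases w) (auto simp: t)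
    moreover from this that have "hd w \<in> set (concat W)" by (auto intro!: bexI[of _ w])
    ultimately show ?thesis unfolding Wc by simp
  qed
  have lab_hd: "lab (hd_piece w) = (entry R (hd w), if P ! fst (hd w) = [] then Suc (fst (hd w)) else 0, None)" for w
    by (simp add: lab_def hd_piece_def entry_def split: prod.splits)
  have Wd': "inj_on (lab \<circ> hd_piece) (set W)" "distinct W"
    using Wd by (auto simp: lab_hd distinct_map inj_on_def)
  have inj_lab: "inj_on lab X"
  proof (rule inj_onI)
    fix x y assume x: "x \<in> X" and y: "y \<in> X" and xy: "lab x = lab y"
    have loop_lab: "lab (Side e c) = (side_region T e c, 0, Some (e, c))" if "e \<in> loops" for e c
      using that by (simp add: lab_def)
    show "x = y"
    proof (cases "x \<in> hd_piece ` set W"; cases "y \<in> hd_piece ` set W")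
      assume "x \<in> hd_piece ` set W" "y \<in> hd_piece ` set W"
      with Wd'(1) xy show ?thesis by (auto simp: inj_on_def)
    qed (use x y xy in \<open>auto simp: X_def loop_lab lab_hd\<close>)
  qed
  have card_X: "card X = length W + 2 * card loops"
  proof -
    have fin: "finite loops" by (simp add: loops_def)
    have "inj_on hd_piece (set W)" using Wd'(1) by (rule inj_on_imageI2)
    then have 1: "card (hd_piece ` set W) = length W"
      using Wd'(2) by (simp add: card_image distinct_card)
    have "inj_on (case_prod Side) (loops \<times> UNIV)" by (auto simp: inj_on_def)
    then have 2: "card (case_prod Side ` (loops \<times> UNIV)) = 2 * card loops"
      by (simp add: card_image card_cartesian_product)
    have "hd_piece ` set W \<inter> case_prod Side ` (loops \<times> UNIV) = {}"
      by (auto simp: hd_piece_def)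
    with 1 2 fin show ?thesis unfolding X_def by (subst card_Un_disjoint) auto
  qed
  have lab_inv: "lab a = lab b" if "(a, b) \<in> meeting T" for a b
    using that
  proof (cases rule: meeting_cases)
    case (left d j)
    have "point_string T d j \<notin> loops" using left loops_ends[of "point_string T d j"] by (auto simp: ends_def)
    moreover have "P ! disc_index d \<noteq> []" using left(1) by (auto simp: points_iff)
    ultimately show ?thesis using left corner_sides(2)[OF left(1)] by (simp add: lab_def)
  next
    case (right d j)
    have "point_string T d j \<notin> loops" using right loops_ends[of "point_string T d j"] by (auto simp: ends_def)
    moreover have "P ! disc_index d \<noteq> []" using right(1) by (auto simp: points_iff)
    ultimately show ?thesis using right corner_sides(3)[OF right(1)] by (simp add: lab_def)
  qed
  have intervals: "\<exists>x \<in> X. (x, Interval d j) \<in> gen_equiv (meeting T)"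
    if "d \<in> all_discs T" "j < length (R ! disc_index d)" for d j
  proof -
    have "(disc_index d, j) \<in> set (concat W)"
      unfolding Wc using that disc_index_less nonempty by (simp add: set_corners)
    then obtain w where w: "w \<in> set W" "(disc_index d, j) \<in> set w" by auto
    then have "(hd_piece w, Interval (disc_of (disc_index d)) j) \<in> gen_equiv (meeting T)"
      unfolding hd_piece_def using W Wc by (intro walk_equiv) (auto simp: t)
    with w show ?thesis by (auto simp: X_def)
  qed
  have "card (boundary_curves T) = card X"
    unfolding boundary_curves_def
  proof (rule card_quotient_gen_equiv[where f = lab])
    show "X \<subseteq> pieces T"
    proof
      fix x assume "x \<in> X"
      then consider w where "w \<in> set W" "x = hd_piece w" | e c where "e \<in> loops" "x = Side e c"
        by (auto simp: X_def)
      then show "x \<in> pieces T"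
      proof cases
        case 1
        with W_ne[OF 1(1)] nonempty show ?thesis
          by (auto simp: pieces_def hd_piece_def set_corners disc_of_all nintervals)
      next
        case 2
        then show ?thesis by (auto simp: pieces_def strings_eq loops_def)
      qed
    qed
    show "\<exists>x \<in> X. (x, a) \<in> gen_equiv (meeting T)" if "a \<in> pieces T" for a
    proof -
      from that consider d j where "d \<in> all_discs T" "j < length (R ! disc_index d)" "a = Interval d j"
        | e c where "e < length S" "a = Side e c"
        by (auto simp: pieces_def nintervals strings_eq)
      then show ?thesis
      proof cases
        case 1
        then show ?thesis using intervals by simp
      next
        case 2
        show ?thesis
        proof (cases "e \<in> loops")
          case True
          then show ?thesis using 2 by (auto simp: X_def intro!: bexI[of _ "Side e c"])
        next
          case False
          then have "ends T e \<noteq> {}" using attached 2 by (auto simp: loops_def)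
          then obtain d j where dj: "(d, j) \<in> points T" "point_string T d j = e" by (auto simp: ends_def)
          have "\<exists>i < length (R ! disc_index d). (Interval d i, Side e c) \<in> meeting T"
          proof (cases "c = interval_shade T d j")
            case True
            then show ?thesis using dj length_P_R[OF disc_index_less]
              by (intro exI[of _ j]) (auto simp: meeting_def points_iff)
          next
            case False
            then have c: "c = (\<not> interval_shade T d j)" by auto
            show ?thesis using dj Suc_mod_interval[OF dj(1)] npoints
              by (intro exI[of _ "Suc j mod length (P ! disc_index d)"]) (fastforce simp: meeting_def points_iff c)
          qed
          then obtain i where i: "i < length (R ! disc_index d)" "(Interval d i, Side e c) \<in> meeting T" by auto
          have "d \<in> all_discs T" using dj by (auto simp: points_iff)
          from intervals[OF this i(1)] i(2) 2 show ?thesis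
            by (auto intro: gen_equiv_trans gen_equiv_base)
        qed
      qed
    qed
  qed (fact inj_lab lab_inv)+
  then have curve_card: "card (boundary_curves T) + 2 * length (A True) = length W + 2 * length S"
    using card_X dist card_mono[OF _ attached_sub]
    by (simp add: loops_def card_Diff_subset attached_sub distinct_card)

  have connected: "(r, r') \<in> (adjacent_regions T)\<^sup>*" if "r \<in> regions T" "r' \<in> regions T" for r r'
  proof -
    have adj: "(a, b) \<in> adjacent_regions T \<and> (b, a) \<in> adjacent_regions T" if ab: "(a, b) \<in> set S" for a b
    proof -
      from ab obtain e where "e < length S" "S ! e = (a, b)" by (auto simp: in_set_conv_nth)
      then have "a = side_region T e s" "b = side_region T e (\<not> s)" "e \<in> strings T"
        by (auto simp: side_region strings_eq)
      then show ?thesis by (auto simp: adjacent_regions_def)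
    qed
    have step: "set (spread S' Y) \<subseteq> Z" if "set S' \<subseteq> set S" "set Y \<subseteq> Z"
      "\<And>a b. (a, b) \<in> set S \<Longrightarrow> a \<in> Z \<longleftrightarrow> b \<in> Z" for S' Y Z
      using that(1,2)
    proof (induction S' arbitrary: Y)
      case Nil
      then show ?case by (simp add: spread_def)
    next
      case (Cons ab S')
      obtain a b where ab: "ab = (a, b)" by (cases ab)
      define Y' where "Y' = spread_string ab Y"
      have "set Y' \<subseteq> Z" using Cons.prems that(3)[of a b] by (auto simp: Y'_def ab)
      moreover have "spread (ab # S') Y = spread S' Y'" by (simp add: spread_def Y'_def)
      ultimately show ?case using Cons by auto
    qed
    (* The regions that can be reached from the region at the first interval of the output disc, and back. *)
    define Z where "Z = {r. (hd (hd R), r) \<in> (adjacent_regions T)\<^sup>* \<and> (r, hd (hd R)) \<in> (adjacent_regions T)\<^sup>*}"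
    have Z: "a \<in> Z \<longleftrightarrow> b \<in> Z" if "(a, b) \<in> set S" for a b
      using adj[OF that] by (auto simp: Z_def intro: rtrancl_into_rtrancl converse_rtrancl_into_rtrancl)
    have "set (spread (S @ S @ S) [hd (hd R)]) \<subseteq> Z"
      by (rule step[OF _ _ Z]) (auto simp: Z_def)
    then have "regions T \<subseteq> Z" using conn by (auto simp: regions_eq t)
    with that show ?thesis by (auto simp: Z_def intro: rtrancl_trans)
  qed

  have shade: "shaded T r = (odd r \<noteq> s)" if "r \<in> regions T" for r
    using pr that by (auto simp: presented_def t)
  have side_reg: "side_region T e c \<in> regions T \<and> shaded T (side_region T e c) = c" if "e < length S" for e c
  proof -
    have "side_region T e c \<in> regions T" using nth_mem[OF that]
      by (auto simp: side_region[OF that] regions_eq table_regions_def)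
    then show ?thesis using that parity_sides[OF that] shade by (auto simp: side_region split: if_splits)
  qed
  have piece: "piece_region T a \<in> regions T \<and> shaded T (piece_region T a) = piece_shade T a" if "a \<in> pieces T" for a
  proof -
    from that consider d j where "d \<in> all_discs T" "j < length (R ! disc_index d)" "a = Interval d j"
        | e c where "e < length S" "a = Side e c"
        by (auto simp: pieces_def nintervals strings_eq)
    then show ?thesis
    proof cases
      case 1
      then show ?thesis using region_of_interval by (simp add: interval_region interval_shade shade)
    next
      case 2
      then show ?thesis using side_reg by simp
    qed
  qed
  have meet: "piece_region T a = piece_region T b" if "(a, b) \<in> meeting T" for a b
    using that
  proof (cases rule: meeting_cases)
    case (left d j)
    then have "j < length (R ! disc_index d)" "d \<in> all_discs T"
      using length_P_R[OF disc_index_less] by (auto simp: points_iff)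
    then show ?thesis using left corner_sides(2)[OF left(1)] by (simp add: interval_region)
  next
    case (right d j)
    then have "d \<in> all_discs T" by (auto simp: points_iff)
    then show ?thesis using right corner_sides(3)[OF right(1)] Suc_mod_interval[OF right(1)] 
      by (simp add: interval_region)
  qed
  have fin: "finite (discs T)" "finite (strings T)" "finite (regions T)"
    using pr by (auto simp: presented_def t)
  have euler: "int (card (all_discs T)) - int (card {e \<in> strings T. ends T e \<noteq> {}})
      + 2 * int (card (regions T)) - int (card (boundary_curves T)) = 2"
    using eul curve_card unfolding discs_card region_card string_card by linarith
  have ends_ok: "ends T e = {} \<or> (\<exists>!a. a \<in> ends T e \<and> starts_at T a) \<and> (\<exists>!a. a \<in> ends T e \<and> \<not> starts_at T a)" for e
    using ex1[of e True] ex1[of e False] by (simp only: eq_True eq_False) blast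
  have "\<forall>(d, j) \<in> points T. point_string T d j \<in> strings T"
    using corner_sides(1) by (auto simp: strings_eq)
  then show ?thesis
    unfolding planar_tangle_def using fin piece meet ends_ok connected euler by blast
qed



section \<open>Glueing tables\<close>

text \<open>
  Strings (or regions) of the outer and of the inner tangle are glued along a list of links. The set
  of elements connected to a given one is grown by passing through the links; as every result
  is connected by construction, too few passes can only make the check fail.
\<close>

fun sweep_link :: "nat \<times> nat \<Rightarrow> (nat + nat) list \<Rightarrow> (nat + nat) list" where
  "sweep_link (a, b) X = (if List.member X (Inl a) \<or> List.member X (Inr b)
     then List.insert (Inl a) (List.insert (Inr b) X) else X)"

definition sweep :: "(nat \<times> nat) list \<Rightarrow> (nat + nat) list \<Rightarrow> (nat + nat) list" where
  "sweep links = fold sweep_link links"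

fun joined :: "(nat \<times> nat) list \<Rightarrow> (nat + nat) list \<Rightarrow> bool" where
  "joined links [] = False"
| "joined links (u # vs) = list_all (List.member (sweep (links @ links @ links) [u])) vs"

definition fibre_joined ::
    "(nat \<times> nat) list \<Rightarrow> nat list \<Rightarrow> nat list \<Rightarrow> (nat + nat) list \<Rightarrow> nat \<Rightarrow> bool" where
  "fibre_joined links f g us c = joined links (filter (\<lambda>u. case_sum (nth f) (nth g) u = c) us)"

text \<open>
  An executable form of \<open>is_glued_union\<close>: the quotient maps \<open>f\<close> and \<open>g\<close> agree along links, and the elements
  that they send to the same place are connected by links.
\<close>

definition merged ::
    "nat list \<Rightarrow> nat list \<Rightarrow> (nat \<times> nat) list \<Rightarrow> nat list \<Rightarrow> nat list \<Rightarrow> nat list \<Rightarrow> bool" where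
  "merged As Bs links Cs f g \<longleftrightarrow>
    list_all (\<lambda>(a, b). f ! a = g ! b) links
     \<and> list_all (List.member Cs) (map (nth f) As @ map (nth g) Bs)
     \<and> list_all (fibre_joined links f g (map Inl As @ map Inr Bs)) Cs"

definition outer_disc_carried ::
    "table \<Rightarrow> nat \<Rightarrow> table \<Rightarrow> nat list \<Rightarrow> nat list \<Rightarrow> nat list \<Rightarrow> nat \<Rightarrow> bool" where
  "outer_disc_carried t i t2 f fe fr d \<longleftrightarrow> d = Suc i \<or>
     (let d' = (case d of 0 \<Rightarrow> 0 | Suc j \<Rightarrow> Suc (f ! j)) in
      fst t2 ! d' = map (nth fe) (fst t ! d) \<and> fst (snd t2) ! d' = map (nth fr) (fst (snd t) ! d))"

definition inner_disc_carried ::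
    "table \<Rightarrow> table \<Rightarrow> nat list \<Rightarrow> nat list \<Rightarrow> nat list \<Rightarrow> nat \<Rightarrow> bool" where
  "inner_disc_carried t1 t2 g ge gr d \<longleftrightarrow>
     fst t2 ! Suc (g ! d) = map (nth ge) (fst t1 ! Suc d)
     \<and> fst (snd t2) ! Suc (g ! d) = map (nth gr) (fst (snd t1) ! Suc d)"

definition string_carried ::
    "(nat \<times> nat) list \<Rightarrow> (nat \<times> nat) list \<Rightarrow> bool \<Rightarrow> nat list \<Rightarrow> nat list \<Rightarrow> nat \<Rightarrow> bool" where
  "string_carried S S2 flip fe fr e \<longleftrightarrow>
     S2 ! (fe ! e) = (let (x, y) = S ! e in if flip then (fr ! y, fr ! x) else (fr ! x, fr ! y))"

text \<open>
  The table \<open>t1\<close> is inserted into the input disc \<open>i\<close> of \<open>t\<close>, and the result is \<open>t2\<close>. Since the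
  parity of region numbers is only relative to a shade, the flags \<open>b\<close> and \<open>c\<close> say whether the
  even regions of \<open>t1\<close> and of \<open>t2\<close> have the shade opposite to that of the even regions of
  \<open>t\<close>. Discs are renamed by \<open>f\<close> and \<open>g\<close>, strings by \<open>fe\<close> and \<open>ge\<close>, regions by
  \<open>fr\<close> and \<open>gr\<close>.
\<close>

definition glue_table ::
    "table \<Rightarrow> nat \<Rightarrow> table \<Rightarrow> table \<Rightarrow> bool \<Rightarrow> bool \<Rightarrow> nat list \<Rightarrow> nat list
      \<Rightarrow> nat list \<Rightarrow> nat list \<Rightarrow> nat list \<Rightarrow> nat list \<Rightarrow> bool" where
  "glue_table t i t1 t2 b c f g fe ge fr gr =
    (case (t, t1, t2) of ((P, R, S), (P1, R1, S1), (P2, R2, S2)) \<Rightarrow>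
      Suc i < length P \<and> length f = length P - 1 \<and> length g = length P1 - 1
      \<and> length (P ! Suc i) = length (P1 ! 0)
      \<and> odd (R ! Suc i ! 0) = (odd (R1 ! 0 ! 0) \<noteq> b)
      \<and> (let ds = map (nth f) (filter (\<lambda>j. j \<noteq> i) [0..<length P - 1]) @ map (nth g) [0..<length P1 - 1] in
          distinct ds \<and> length ds = length P2 - 1 \<and> list_all (\<lambda>d. d < length P2 - 1) ds)
      \<and> merged [0..<length S] [0..<length S1] (zip (P ! Suc i) (P1 ! 0)) [0..<length S2] fe ge
      \<and> merged (table_regions t) (table_regions t1) (zip (R ! Suc i) (R1 ! 0)) (table_regions t2) fr gr
      \<and> list_all (outer_disc_carried t i t2 f fe fr) [0..<length P]
      \<and> list_all (inner_disc_carried t1 t2 g ge gr) [0..<length P1 - 1]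
      \<and> list_all (string_carried S S2 c fe fr) [0..<length S]
      \<and> list_all (string_carried S1 S2 (b \<noteq> c) ge gr) [0..<length S1]
      \<and> list_all (\<lambda>r. odd (fr ! r) = (odd r \<noteq> c)) (table_regions t)
      \<and> list_all (\<lambda>r. odd (gr ! r) = (odd r \<noteq> (b \<noteq> c))) (table_regions t1))"

lemma sweep_equiv:
  assumes "set links' \<subseteq> set links" 
    and "\<forall>x \<in> set X. (u, x) \<in> gen_equiv {(Inl a, Inr b) |a b. (a, b) \<in> set links}"
  shows "\<forall>x \<in> set (sweep links' X). (u, x) \<in> gen_equiv {(Inl a, Inr b) |a b. (a, b) \<in> set links}"
  (is "\<forall>x \<in> _. _ \<in> ?E")
  using assms
proof (induction links' arbitrary: X)
  case Nil
  then show ?case by (simp add: sweep_def)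
  next
  case (Cons ab links')
  obtain a b where ab: "ab = (a, b)" by (cases ab)
  define X' where "X' = sweep_link ab X"
  have base: "(Inl a, Inr b) \<in> ?E"
    by (rule gen_equiv_base) (use Cons.prems(1) ab in auto)
  have "\<forall>x \<in> set X'. (u, x) \<in> ?E"
  proof (cases "Inl a \<in> set X \<or> Inr b \<in> set X")
    case True
    have "(u, Inl a) \<in> ?E \<and> (u, Inr b) \<in> ?E"
    proof (cases "Inl a \<in> set X")
      case True
      then have "(u, Inl a) \<in> ?E" using Cons.prems(2) by (rule bspec[rotated])
      from this gen_equiv_trans[OF this base] show ?thesis by (rule conjI)
    next
      case False
      with True have "Inr b \<in> set X" by simp
      then have "(u, Inr b) \<in> ?E" using Cons.prems(2) by (rule bspec[rotated])
      from gen_equiv_trans[OF this gen_equiv_sym[OF base]] this show ?thesis by (rule conjI)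
    qed
    then show ?thesis using Cons.prems(2) by (simp add: X'_def ab)
  next
    case False
    then show ?thesis using Cons.prems(2) by (simp add: X'_def ab)
  qed
  moreover have "sweep (ab # links') X = sweep links' X'" by (simp add: sweep_def X'_def)
  ultimately show ?case using Cons.IH[of X'] Cons.prems(1) by simp
qed

lemma glued_union_of_merged:
  assumes "merged As Bs links Cs f g"
  shows "is_glued_union (set As) (set Bs) {(Inl a, Inr b) |a b. (a, b) \<in> set links} (set Cs) (nth f) (nth g)"
proof -
  let ?r = "{(Inl a, Inr b) |a b. (a, b) \<in> set links}" let ?h = "case_sum (nth f) (nth g)"
  define us where "us = (map Inl As @ map Inr Bs :: (nat + nat) list)"
  have us: "set us = set As <+> set Bs" by (auto simp: us_def)
  have links: "\<And>a b. (a, b) \<in> set links \<Longrightarrow> f ! a = g ! b"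
    and sub: "\<And>u. u \<in> set us \<Longrightarrow> ?h u \<in> set Cs"
    and fibre: "\<And>c. c \<in> set Cs \<Longrightarrow> joined links (filter (\<lambda>u. ?h u = c) us)"
    using assms by (auto simp: merged_def fibre_joined_def list_all_iff us_def)
  have invariant: "?h u = ?h v" if "(u, v) \<in> gen_equiv ?r" for u v
    using that by (rule gen_equiv_invariant) (use links in auto)
  have rep: "\<exists>w. w \<in> set us \<and> ?h w = c \<and> (\<forall>u \<in> set us. ?h u = c \<longrightarrow> (w, u) \<in> gen_equiv ?r)"
    if c: "c \<in> set Cs" for c
  proof -
    obtain w vs where w: "filter (\<lambda>u. ?h u = c) us = w # vs"
      and vs: "\<forall>v \<in> set vs. v \<in> set (sweep (links @ links @ links) [w])"
      using fibre[OF c] by (cases "filter (\<lambda>u. ?h u = c) us") (auto simp: list_all_iff)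
    have "\<forall>x \<in> set (sweep (links @ links @ links) [w]). (w, x) \<in> gen_equiv ?r"
      by (rule sweep_equiv) auto
    with vs have "\<forall>v \<in> set (w # vs). (w, v) \<in> gen_equiv ?r" by simp
    moreover have *: "set (w # vs) = {u \<in> set us. ?h u = c}" unfolding w[symmetric] by auto
    moreover have "w \<in> set (w # vs)" by simp
    ultimately show ?thesis by (intro exI[of _ w]) blast
  qed
  have conv: "(u, v) \<in> gen_equiv ?r" if uv: "u \<in> set us" "v \<in> set us" "?h u = ?h v" for u v
  proof -
    obtain w where "\<forall>u' \<in> set us. ?h u' = ?h u \<longrightarrow> (w, u') \<in> gen_equiv ?r"
      using rep[OF sub[OF uv(1)]] by blast
    with uv have "(w, u) \<in> gen_equiv ?r" "(w, v) \<in> gen_equiv ?r" by simp_all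
    then show ?thesis by (rule gen_equiv_trans[OF gen_equiv_sym])
  qed
  have "?h ` set us = set Cs" using sub rep by blast
  then show ?thesis
    unfolding is_glued_union_def us[symmetric] using invariant conv by blast
qed

text \<open>
  The checks range over the finitely many corners, strings and regions listed in the tables, which
  are all those of the tangles.
\<close>

lemma glueing_of_tables:
  assumes T: "presented T s t" "well_formed t" and T1: "presented T1 s1 t1" "well_formed t1"
    and T2: "presented T2 s2 t2" "well_formed t2" and s1: "s1 = (s \<noteq> b)" and s2: "s2 = (s \<noteq> c)"
    and gl: "glue_table t i t1 t2 b c f g fe ge fr gr"
  shows "glueing T i T1 T2 (nth f) (nth g)"
proof -
  obtain P R S where t: "t = (P, R, S)" by (cases t)
  obtain P1 R1 S1 where t1: "t1 = (P1, R1, S1)" by (cases t1)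
  obtain P2 R2 S2 where t2: "t2 = (P2, R2, S2)" by (cases t2)
  interpret T: presented_tangle T s P R S using T by unfold_locales (simp_all add: t)
  interpret T1: presented_tangle T1 s1 P1 R1 S1 using T1 by unfold_locales (simp_all add: t1)
  interpret T2: presented_tangle T2 s2 P2 R2 S2 using T2 by unfold_locales (simp_all add: t2)
  define ds where "ds = map (nth f) (filter (\<lambda>j. j \<noteq> i) [0..<length P - 1]) @ map (nth g) [0..<length P1 - 1]"
  from gl have i: "Suc i < length P" "length (P ! Suc i) = length (P1 ! 0)"
      "odd (R ! Suc i ! 0) = (odd (R1 ! 0 ! 0) \<noteq> b)"
    and ds: "distinct ds" "length ds = length P2 - 1" "\<And>d. d \<in> set ds \<Longrightarrow> d < length P2 - 1"
    and ms: "merged [0..<length S] [0..<length S1] (zip (P ! Suc i) (P1 ! 0)) [0..<length S2] fe ge"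
    and mr: "merged (table_regions t) (table_regions t1) (zip (R ! Suc i) (R1 ! 0)) (table_regions t2) fr gr"
    and out: "\<And>d. d < length P \<Longrightarrow> d \<noteq> Suc i \<Longrightarrow> (let d' = (case d of 0 \<Rightarrow> 0 | Suc j \<Rightarrow> Suc (f ! j)) in
           P2 ! d' = map (nth fe) (P ! d) \<and> R2 ! d' = map (nth fr) (R ! d))"
    and inn: "\<And>d. d < length P1 - 1 \<Longrightarrow> P2 ! Suc (g ! d) = map (nth ge) (P1 ! Suc d)
           \<and> R2 ! Suc (g ! d) = map (nth gr) (R1 ! Suc d)"
    and so: "\<And>e. e < length S \<Longrightarrow> S2 ! (fe ! e) = (let (x, y) = S ! e in
           if c then (fr ! y, fr ! x) else (fr ! x, fr ! y))"
    and si: "\<And>e. e < length S1 \<Longrightarrow> S2 ! (ge ! e) = (let (x, y) = S1 ! e in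
           if b \<noteq> c then (gr ! y, gr ! x) else (gr ! x, gr ! y))"
    and po: "\<And>r. r \<in> set (table_regions t) \<Longrightarrow> odd (fr ! r) = (odd r \<noteq> c)"
    and pi: "\<And>r. r \<in> set (table_regions t1) \<Longrightarrow> odd (gr ! r) = (odd r \<noteq> (b \<noteq> c))"
    unfolding glue_table_def outer_disc_carried_def inner_disc_carried_def string_carried_def
      t t1 t2 Let_def prod.case prod.sel list_all_iff ds_def[symmetric] by auto
  have discs: "discs T = {..<length P - 1}" "discs T1 = {..<length P1 - 1}" "discs T2 = {..<length P2 - 1}"
    using T(1) T1(1) T2(1) by (auto simp: presented_def t t1 t2)
  have iT: "i \<in> discs T" using i(1) by (auto simp: discs)
  have some_i: "Some i \<in> all_discs T" using iT by (auto simp: all_discs_def)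
  have none: "None \<in> all_discs X" for X by (simp add: all_discs_def)
  have ix [simp]: "disc_index None = 0" "disc_index (Some j) = Suc j" for j
    by (simp_all add: disc_index_def)
  have colour: "colour_of T d = (length (P ! disc_index d) div 2, odd (R ! disc_index d ! 0) \<noteq> s)" 
    if "d \<in> all_discs T" for d using T(1) that by (auto simp: presented_def t)
  have colour1: "colour_of T1 d = (length (P1 ! disc_index d) div 2, odd (R1 ! disc_index d ! 0) \<noteq> s1)" 
    if "d \<in> all_discs T1" for d using T1(1) that by (auto simp: presented_def t1)
  have colour2: "colour_of T2 d = (length (P2 ! disc_index d) div 2, odd (R2 ! disc_index d ! 0) \<noteq> s2)" 
    if "d \<in> all_discs T2" for d using T2(1) that by (auto simp: presented_def t2)
  have bij: "bij_betw (case_sum (nth f) (nth g)) ((discs T - {i}) <+> discs T1) (discs T2)"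
  proof -
    define us where "us = (map Inl (filter (\<lambda>j. j \<noteq> i) [0..<length P - 1]) @ map Inr [0..<length P1 - 1] :: (nat + nat) list)"
    have us: "set us = (discs T - {i}) <+> discs T1" by (auto simp: us_def discs)
    have h: "map (case_sum (nth f) (nth g)) us = ds" by (simp add: us_def ds_def)
    have "set ds = {..<length P2 - 1}"
      using ds by (intro card_subset_eq) (auto simp: distinct_card)
    moreover have "set ds = case_sum (nth f) (nth g) ` set us" by (simp flip: h)
    moreover have "inj_on (case_sum (nth f) (nth g)) (set us)"
      using ds(1) by (simp flip: h add: distinct_map)
    ultimately show ?thesis unfolding bij_betw_def us[symmetric] discs(3) by simp
  qed
  have col: "colour_of T (Some i) = colour_of T1 None"
    using i by (simp add: colour[OF some_i] colour1[OF none] s1) argo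
  have links_s: "{(Inl (point_string T (Some i) j), Inr (point_string T1 None j)) |j. j < npoints T1 None}
      = {(Inl a, Inr b) |a b. (a, b) \<in> set (zip (P ! Suc i) (P1 ! 0))}"
  proof -
    have "point_string T (Some i) j = P ! Suc i ! j \<and> point_string T1 None j = P1 ! 0 ! j" if "j < length (P1 ! 0)" for j
      using that T.point_string[of "Some i" j] T1.point_string[of None j] i some_i none
      by (simp add: T.points_iff T1.points_iff)
    then show ?thesis unfolding T1.npoints[OF none] using i(2) by (auto simp: set_zip) metis+
  qed
  have lenR: "length (R ! Suc i) = length (R1 ! 0)"
    using T.lengths(2)[OF i(1)] T1.lengths(2)[of 0] T1.nonempty i(2) by simp
  have links_r: "{(Inl (interval_region T (Some i) j), Inr (interval_region T1 None j)) |j. j < nintervals T1 None}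
      = {(Inl a, Inr b) |a b. (a, b) \<in> set (zip (R ! Suc i) (R1 ! 0))}"
  proof -
    have "interval_region T (Some i) j = R ! Suc i ! j \<and> interval_region T1 None j = R1 ! 0 ! j" if "j < length (R1 ! 0)" for j
      using that T.interval_region[of "Some i" j] T1.interval_region[of None j] lenR some_i none by simp
    then show ?thesis unfolding T1.nintervals[OF none] using lenR by (auto simp: set_zip) metis+
  qed
  have gs: "is_glued_union (strings T) (strings T1)
      {(Inl (point_string T (Some i) j), Inr (point_string T1 None j)) |j. j < npoints T1 None} (strings T2) (nth fe) (nth ge)"
    using glued_union_of_merged[OF ms] unfolding links_s T.strings_eq T1.strings_eq T2.strings_eq
    by (simp add: atLeast0LessThan)
  have gr: "is_glued_union (regions T) (regions T1)
      {(Inl (interval_region T (Some i) j), Inr (interval_region T1 None j)) |j. j < nintervals T1 None} (regions T2) (nth fr) (nth gr)"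
    using glued_union_of_merged[OF mr] unfolding links_r T.regions_eq T1.regions_eq T2.regions_eq t t1 t2 .
  have regs: "regions T = set (table_regions t)" "regions T1 = set (table_regions t1)" "regions T2 = set (table_regions t2)"
    by (simp_all add: T.regions_eq T1.regions_eq T2.regions_eq t t1 t2)
  have region_image: "case_sum (nth fr) (nth gr) ` (regions T <+> regions T1) = regions T2"
    and string_image: "case_sum (nth fe) (nth ge) ` (strings T <+> strings T1) = strings T2"
    using gr gs unfolding is_glued_union_def by blast+
  have fr_mem: "fr ! r \<in> regions T2" if "r \<in> regions T" for r
    unfolding region_image[symmetric] by (rule image_eqI[of _ _ "Inl r"]) (simp_all add: that InlI InrI)
  have gr_mem: "gr ! r \<in> regions T2" if "r \<in> regions T1" for r
    unfolding region_image[symmetric] by (rule image_eqI[of _ _ "Inr r"]) (simp_all add: that InlI InrI)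
  have fe_mem: "fe ! e < length S2" if "e < length S" for e
  proof -
    have "fe ! e \<in> strings T2"
      unfolding string_image[symmetric] by (rule image_eqI[of _ _ "Inl e"]) (simp_all add: that T.strings_eq InlI)
    then show ?thesis by (simp add: T2.strings_eq)
  qed
  have ge_mem: "ge ! e < length S2" if "e < length S1" for e
  proof -
    have "ge ! e \<in> strings T2"
      unfolding string_image[symmetric] by (rule image_eqI[of _ _ "Inr e"]) (simp_all add: that T1.strings_eq InrI)
    then show ?thesis by (simp add: T2.strings_eq)
  qed
  have shade2: "shaded T2 r = (odd r \<noteq> s2)" if "r \<in> regions T2" for r
    using T2(1) that by (auto simp: presented_def t2)
  have shade: "shaded T r = (odd r \<noteq> s)" if "r \<in> regions T" for r
    using T(1) that by (auto simp: presented_def t)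
  have shade1: "shaded T1 r = (odd r \<noteq> s1)" if "r \<in> regions T1" for r
    using T1(1) that by (auto simp: presented_def t1)
  have outer: "carried T T2 (all_discs T - {Some i}) (map_option (nth f)) (nth fe) (nth fr)"
    unfolding carried_def
  proof (intro conjI ballI allI impI)
    fix d assume d: "d \<in> all_discs T - {Some i}"
    let ?d = "map_option (nth f) d"
    have d': "?d \<in> all_discs T2"
    proof (cases d)
      case (Some j)
      then have "Inl j \<in> (discs T - {i}) <+> discs T1" using d by (auto simp: all_discs_def)
      from bij_betwE[OF bij, rule_format, OF this] Some show ?thesis by (auto simp: all_discs_def)
    qed (simp add: none)
    have ne: "disc_index d \<noteq> Suc i" using d by (cases d) auto
    have dl: "disc_index d < length P" using d T.disc_index_less by auto
    have "(case disc_index d of 0 \<Rightarrow> 0 | Suc j \<Rightarrow> Suc (f ! j)) = disc_index ?d"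
      by (cases d) auto
    with out[OF dl ne] have PR: "P2 ! disc_index ?d = map (nth fe) (P ! disc_index d)"
      "R2 ! disc_index ?d = map (nth fr) (R ! disc_index d)" by (simp_all add: Let_def)
    have "0 < length (R ! disc_index d)" using T.lengths(2)[OF dl] by simp
    moreover from this have "R ! disc_index d ! 0 \<in> regions T" using d T.region_of_interval by simp
    ultimately show "colour_of T2 ?d = colour_of T d"
      using d by (simp add: colour colour2[OF d'] PR po regs s2) auto
    show "point_string T2 ?d j = fe ! point_string T d j" if "j < Defs.npoints T d" for j
      using that d d' T.point_string[of d j] T2.point_string[of ?d j]
      by (simp add: T.npoints T.points_iff T2.points_iff PR)
    show "interval_region T2 ?d j = fr ! interval_region T d j" if "j < Defs.nintervals T d" for j
      using that d d' by (simp add: T.nintervals T.interval_region T2.interval_region PR)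
  next
    fix e k assume "e \<in> strings T"
    then have e: "e < length S" by (simp add: T.strings_eq)
    show "side_region T2 (fe ! e) k = fr ! side_region T e k"
      using so[OF e] by (auto simp: T2.side_region[OF fe_mem[OF e]] T.side_region[OF e] s2 split: prod.splits)
  next
    fix r assume r: "r \<in> regions T"
    show "shaded T2 (fr ! r) = shaded T r"
      unfolding shade2[OF fr_mem[OF r]] shade[OF r] po[OF r[unfolded regs]] s2 by auto
  qed
  have inner: "carried T1 T2 (Some ` discs T1) (map_option (nth g)) (nth ge) (nth gr)"
    unfolding carried_def
  proof (intro conjI ballI allI impI)
    fix d assume "d \<in> Some ` discs T1"
    then obtain k where k: "d = Some k" "k \<in> discs T1" by auto
    let ?d = "map_option (nth g) d"
    have d: "d \<in> all_discs T1" using k by (auto simp: all_discs_def)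
    have "Inr k \<in> (discs T - {i}) <+> discs T1" using k by auto
    from bij_betwE[OF bij, rule_format, OF this] k have d': "?d \<in> all_discs T2" by (auto simp: all_discs_def)
    have dl: "disc_index d < length P1" using d T1.disc_index_less by auto
    have PR: "P2 ! disc_index ?d = map (nth ge) (P1 ! disc_index d)"
      "R2 ! disc_index ?d = map (nth gr) (R1 ! disc_index d)" using inn[of k] k by (simp_all add: discs)
    have "0 < length (R1 ! disc_index d)" using T1.lengths(2)[OF dl] by simp
    moreover from this have "R1 ! disc_index d ! 0 \<in> regions T1" using d T1.region_of_interval by simp
    ultimately show "colour_of T2 ?d = colour_of T1 d"
      using d by (simp add: colour1 colour2[OF d'] PR pi regs s1 s2) auto
    show "point_string T2 ?d j = ge ! point_string T1 d j" if "j < Defs.npoints T1 d" for j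
      using that d d' T1.point_string[of d j] T2.point_string[of ?d j]
      by (simp add: T1.npoints T1.points_iff T2.points_iff PR)
    show "interval_region T2 ?d j = gr ! interval_region T1 d j" if "j < Defs.nintervals T1 d" for j
      using that d d' by (simp add: T1.nintervals T1.interval_region T2.interval_region PR)
  next
    fix e k assume "e \<in> strings T1"
    then have e: "e < length S1" by (simp add: T1.strings_eq)
    show "side_region T2 (ge ! e) k = gr ! side_region T1 e k"
      using si[OF e] by (auto simp: T2.side_region[OF ge_mem[OF e]] T1.side_region[OF e] s1 s2 split: prod.splits)
  next
    fix r assume r: "r \<in> regions T1"
    show "shaded T2 (gr ! r) = shaded T1 r"
      unfolding shade2[OF gr_mem[OF r]] shade1[OF r] pi[OF r[unfolded regs]] s1 s2 by auto
  qed
  show ?thesis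
    unfolding glueing_def using iT col bij gs gr outer inner by blast
qed



section \<open>The tangles of the operations\<close>

text \<open>
  The standard tangle with a given table, the even regions having shade \<open>s\<close>.
\<close>

definition web :: "bool \<Rightarrow> table \<Rightarrow> tangle" where
  "web s = (\<lambda>(P, R, S).
    \<lparr> discs = {..<length P - 1}, strings = {..<length S}, regions = set (table_regions (P, R, S)),
      colour_of = (\<lambda>d. (length (P ! disc_index d) div 2, odd (R ! disc_index d ! 0) \<noteq> s)),
      point_string = (\<lambda>d j. P ! disc_index d ! j),
      interval_region = (\<lambda>d j. R ! disc_index d ! j),
      side_region = (\<lambda>e c. if c = s then fst (S ! e) else snd (S ! e)),
      shaded = (\<lambda>r. odd r \<noteq> s) \<rparr>)"

definition drawn :: "tangle \<Rightarrow> bool \<Rightarrow> table \<Rightarrow> bool" where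
  "drawn T s t \<longleftrightarrow> presented T s t \<and> planar_table t"

lemma planar_table_well_formed: "planar_table t \<Longrightarrow> well_formed t"
  by (cases t) (simp add: planar_table_def Let_def)

lemma drawn_planar: "drawn T s t \<Longrightarrow> planar_tangle T"
  by (auto simp: drawn_def intro: planar_tangle_of_table)

lemma drawn_web: "planar_table t \<Longrightarrow> drawn (web s t) s t"
  by (auto simp: drawn_def presented_def web_def)

lemma drawn_glueing:
  assumes "drawn T s t" "drawn T1 s1 t1" "drawn T2 s2 t2" "s1 = (s \<noteq> b)" "s2 = (s \<noteq> c)"
    and "glue_table t i t1 t2 b c f g fe ge fr gr"
  shows "glueing T i T1 T2 (nth f) (nth g)"
  using assms unfolding drawn_def by (blast intro: glueing_of_tables planar_table_well_formed)

text \<open>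
  Executable form of \<open>presented\<close>: quantifiers over discs, points and regions become bounded
  quantifiers over lists.
\<close>

definition presented_check :: "tangle \<Rightarrow> bool \<Rightarrow> table \<Rightarrow> bool" where
  "presented_check T s t = (case t of (P, R, S) \<Rightarrow>
     discs T = set [0..<length P - 1] \<and> strings T = set [0..<length S]
     \<and> regions T = set (table_regions (P, R, S))
     \<and> list_all (\<lambda>d.
          colour_of T (disc_of d) = (length (P ! d) div 2, odd (R ! d ! 0) \<noteq> s)
          \<and> list_all (\<lambda>j. point_string T (disc_of d) j = P ! d ! j) [0..<length (P ! d)]
          \<and> list_all (\<lambda>j. interval_region T (disc_of d) j = R ! d ! j) [0..<length (R ! d)]) [0..<length P]
     \<and> list_all (\<lambda>e. side_region T e s = fst (S ! e) \<and> side_region T e (\<not> s) = snd (S ! e)) [0..<length S]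
     \<and> list_all (\<lambda>r. shaded T r = (odd r \<noteq> s)) (table_regions t))"

lemma drawnI:
  assumes "planar_table t" and "presented_check T s t"
  shows "drawn T s t"
proof -
  obtain P R S where t: "t = (P, R, S)" by (cases t)
  have P: "P \<noteq> []" using planar_table_well_formed[OF assms(1)] by (simp add: well_formed_def t)
  have "disc_index d < length P" if "d \<in> all_discs T" for d
    using that P assms(2) by (auto simp: presented_check_def t all_discs_def disc_index_def)
  moreover from assms(2) have "\<forall>d < length P.
          colour_of T (disc_of d) = (length (P ! d) div 2, odd (R ! d ! 0) \<noteq> s)
          \<and> (\<forall>j < length (P ! d). point_string T (disc_of d) j = P ! d ! j)
          \<and> (\<forall>j < length (R ! d). interval_region T (disc_of d) j = R ! d ! j)"
    by (auto simp: presented_check_def t list_all_iff)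
  ultimately have "\<forall>d \<in> all_discs T.
          colour_of T d = (length (P ! disc_index d) div 2, odd (R ! disc_index d ! 0) \<noteq> s)
          \<and> (\<forall>j < length (P ! disc_index d). point_string T d j = P ! disc_index d ! j)
          \<and> (\<forall>j < length (R ! disc_index d). interval_region T d j = R ! disc_index d ! j)"
    by (metis disc_of_index)
  moreover have "discs T = {..<length P - 1} \<and> strings T = {..<length S} \<and> regions T = set (table_regions (P, R, S))
     \<and> (\<forall>e < length S. side_region T e s = fst (S ! e) \<and> side_region T e (\<not> s) = snd (S ! e))
     \<and> (\<forall>r \<in> set (table_regions (P, R, S)). shaded T r = (odd r \<noteq> s))"
    using assms(2) unfolding presented_check_def t list_all_iff prod.case by auto
  ultimately have "presented T s t" unfolding presented_def t prod.case by simp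
  with assms(1) show ?thesis by (simp add: drawn_def)
qed

text \<open>
  With the quantifier over the two shades on the right, both cases are evaluated in one run.
\<close>

lemma drawn_all: "planar_table t \<Longrightarrow> \<forall>s. presented_check (T s) s t \<Longrightarrow> drawn (T s) s t"
  by (rule drawnI) simp_all

definition mult2_table :: table where
  "mult2_table = ([[0, 1, 2, 3], [0, 1, 5, 4], [4, 5, 2, 3]],
    [[0, 1, 2, 3], [0, 1, 2, 5], [0, 5, 2, 3]],
    [(0, 1), (2, 1), (2, 3), (0, 3), (0, 5), (2, 5)])"

definition mult3_table :: table where
  "mult3_table = ([[0, 1, 2, 3, 4, 5], [0, 1, 2, 8, 7, 6], [6, 7, 8, 3, 4, 5]],
    [[0, 1, 2, 3, 4, 5], [0, 1, 2, 3, 8, 7], [0, 7, 8, 3, 4, 5]],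
    [(0, 1), (2, 1), (2, 3), (4, 3), (4, 5), (0, 5), (0, 7), (8, 7), (8, 3)])"

definition mult0_table :: table where
  "mult0_table = ([[], [], []],
    [[0], [0], [0]],
    [])"

definition mult1_table :: table where
  "mult1_table = ([[0, 1], [0, 2], [2, 1]],
    [[0, 1], [0, 1], [0, 1]],
    [(0, 1), (0, 1), (0, 1)])"

definition trace1_table :: table where
  "trace1_table = ([[], [0, 0]],
    [[0], [0, 1]],
    [(0, 1)])"

definition trace2_table :: table where
  "trace2_table = ([[], [0, 1, 1, 0]],
    [[0], [0, 1, 2, 1]],
    [(0, 1), (2, 1)])"

definition trace3_table :: table where
  "trace3_table = ([[], [0, 1, 2, 2, 1, 0]],
    [[0], [0, 1, 2, 3, 2, 1]],
    [(0, 1), (2, 1), (2, 3)])"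

definition unit0_table :: table where
  "unit0_table = ([[]],
    [[0]],
    [])"

definition unit1_table :: table where
  "unit1_table = ([[0, 0]],
    [[0, 1]],
    [(0, 1)])"

definition unit2_table :: table where
  "unit2_table = ([[0, 1, 1, 0]],
    [[0, 1, 2, 1]],
    [(0, 1), (2, 1)])"

definition id0_table :: table where
  "id0_table = ([[], []],
    [[0], [0]],
    [])"

definition id1_table :: table where
  "id1_table = ([[0, 1], [0, 1]],
    [[0, 1], [0, 1]],
    [(0, 1), (0, 1)])"

definition id2_table :: table where
  "id2_table = ([[0, 1, 2, 3], [0, 1, 2, 3]],
    [[0, 1, 2, 3], [0, 1, 2, 3]],
    [(0, 1), (2, 1), (2, 3), (0, 3)])"

definition loop_table :: table where
  "loop_table = ([[]],
    [[0]],
    [(0, 1)])"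

definition rotation_table :: table where
  "rotation_table = ([[0, 1, 2, 3], [1, 2, 3, 0]],
    [[0, 1, 2, 3], [1, 2, 3, 0]],
    [(0, 1), (2, 1), (2, 3), (0, 3)])"

lemma drawn_mult2: "drawn (mult_tangle (2, s)) s mult2_table"
  by (rule drawn_all; code_simp)

lemma drawn_mult3: "drawn (mult_tangle (3, s)) s mult3_table"
  by (rule drawn_all; code_simp)

lemma drawn_mult0: "drawn (mult_tangle (0, s)) s mult0_table"
  by (rule drawn_all; code_simp)

lemma drawn_mult1: "drawn (mult_tangle (1, s)) s mult1_table"
  by (rule drawn_all; code_simp)

lemma drawn_trace1: "drawn (trace_tangle (1, s)) s trace1_table"
  by (rule drawn_all; code_simp)

lemma drawn_trace2: "drawn (trace_tangle (2, s)) s trace2_table"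
  by (rule drawn_all; code_simp)

lemma drawn_trace3: "drawn (trace_tangle (3, s)) s trace3_table"
  by (rule drawn_all; code_simp)

lemma drawn_unit0: "drawn (unit_tangle (0, s)) s unit0_table"
  by (rule drawn_all; code_simp)

lemma drawn_unit1: "drawn (unit_tangle (1, s)) s unit1_table"
  by (rule drawn_all; code_simp)

lemma drawn_unit2: "drawn (unit_tangle (2, s)) s unit2_table"
  by (rule drawn_all; code_simp)

lemma drawn_id0: "drawn (identity_tangle (0, s)) s id0_table"
  by (rule drawn_all; code_simp)

lemma drawn_id1: "drawn (identity_tangle (1, s)) s id1_table"
  by (rule drawn_all; code_simp)

lemma drawn_id2: "drawn (identity_tangle (2, s)) s id2_table"
  by (rule drawn_all; code_simp)

lemma drawn_loop: "drawn (loop_tangle s) s loop_table"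
  by (rule drawn_all; code_simp)

lemma drawn_rotation: "drawn (fourier_tangle (\<not> s)) s rotation_table"
  by (rule drawn_all; code_simp)



section \<open>The tangles of the proof and their glueings\<close>

text \<open>
  The names refer to the cut of the diagram of \<open>\<tau>(c\<^sup>* F(u) y)\<close> for which \<open>c, y\<close> have colour \<open>(2, s)\<close>
  and \<open>u, v, e\<close> have colour \<open>(2, \<not> s)\<close>. The two halves are \<open>leg_c\<close>, with inputs \<open>v, c\<close> joined by one string, and
  \<open>leg_y\<close>, with inputs \<open>e, y\<close>; both have six outer points. Glueing a leg with the mirror image
  of the same leg gives \<open>norm_leg_c\<close> and \<open>norm_leg_y\<close>, and glueing the two different legs gives
  \<open>cross\<close>. A \<open>half_trace\<close> is the product of two inputs with one of its two pairs of strings closed.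
  A \<open>bead\<close> is the closed pairing of two 2-boxes with a 1-box on one of the four strings.
\<close>

definition mult_three_table :: table where
  "mult_three_table = ([[0, 1, 6, 7], [0, 1, 2, 3], [3, 2, 4, 5], [5, 4, 6, 7]],
    [[0, 1, 2, 3], [0, 1, 2, 5], [0, 5, 2, 7], [0, 7, 2, 3]],
    [(0, 1), (2, 1), (2, 5), (0, 5), (2, 7), (0, 7), (2, 3), (0, 3)])"

definition pairing2_table :: table where
  "pairing2_table = ([[], [0, 1, 2, 3], [3, 2, 1, 0]],
    [[0], [0, 1, 2, 3], [0, 3, 2, 1]],
    [(0, 1), (2, 1), (2, 3), (0, 3)])"

definition pairing3_table :: table where
  "pairing3_table = ([[], [0, 1, 2, 3, 4, 5], [5, 4, 3, 2, 1, 0]],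
    [[0], [0, 1, 2, 3, 4, 5], [0, 5, 4, 3, 2, 1]],
    [(0, 1), (2, 1), (2, 3), (4, 3), (4, 5), (0, 5)])"

definition two_loops_table :: table where
  "two_loops_table = ([[]],
    [[0]],
    [(0, 1), (2, 1)])"

definition leg_c_table :: table where
  "leg_c_table = ([[4, 0, 1, 2, 5, 6], [0, 1, 2, 3], [4, 3, 5, 6]],
    [[0, 1, 2, 3, 4, 5], [1, 2, 3, 4], [0, 1, 4, 5]],
    [(2, 1), (2, 3), (4, 3), (4, 1), (0, 1), (4, 5), (0, 5)])"

definition leg_y_table :: table where
  "leg_y_table = ([[3, 0, 1, 4, 5, 6], [0, 1, 2, 3], [2, 4, 5, 6]],
    [[0, 1, 2, 3, 4, 5], [1, 2, 3, 0], [0, 3, 4, 5]],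
    [(2, 1), (2, 3), (0, 3), (0, 1), (4, 3), (4, 5), (0, 5)])"

definition half_trace_table :: table where
  "half_trace_table = ([[0, 4], [0, 1, 2, 3], [3, 2, 1, 4]],
    [[0, 1], [0, 1, 2, 3], [0, 3, 2, 1]],
    [(0, 1), (2, 1), (2, 3), (0, 3), (0, 1)])"

definition bead_c_table :: table where
  "bead_c_table = ([[], [0, 1, 2, 3], [3, 4, 1, 0], [2, 4]],
    [[0], [0, 1, 2, 3], [0, 3, 2, 1], [3, 2]],
    [(0, 1), (2, 1), (2, 3), (0, 3), (2, 3)])"

definition bead_e_table :: table where
  "bead_e_table = ([[], [0, 1, 2, 3], [3, 2, 4, 0], [4, 1]],
    [[0], [1, 0, 3, 2], [1, 2, 3, 0], [0, 3]],
    [(0, 1), (0, 3), (2, 3), (2, 1), (0, 3)])"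

definition triple_table :: table where
  "triple_table = ([[], [0, 1, 2, 3], [3, 2, 4, 5], [5, 4, 1, 0]],
    [[0], [0, 1, 2, 3], [0, 3, 2, 5], [0, 5, 2, 1]],
    [(0, 1), (2, 1), (2, 3), (0, 3), (2, 5), (0, 5)])"

definition fourier_mult_table :: table where
  "fourier_mult_table = ([[5, 0, 1, 4], [0, 1, 2, 3], [3, 2, 4, 5]],
    [[0, 1, 2, 3], [1, 2, 3, 4], [1, 4, 3, 0]],
    [(2, 1), (2, 3), (4, 3), (4, 1), (0, 3), (0, 1)])"

definition pair_leg_c_table :: table where
  "pair_leg_c_table = ([[], [0, 1, 2, 3], [4, 5, 0, 6], [6, 3, 2, 1, 5, 4]],
    [[0], [1, 2, 3, 4], [0, 5, 2, 1], [0, 1, 4, 3, 2, 5]],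
    [(2, 1), (2, 3), (4, 3), (4, 1), (0, 5), (2, 5), (0, 1)])"

definition pair_leg_y_table :: table where
  "pair_leg_y_table = ([[], [0, 1, 2, 3], [4, 5, 6, 1], [0, 3, 2, 6, 5, 4]],
    [[0], [1, 0, 3, 2], [0, 5, 4, 3], [0, 1, 2, 3, 4, 5]],
    [(0, 1), (0, 3), (2, 3), (2, 1), (0, 5), (4, 5), (4, 3)])"

definition norm_leg_c_table :: table where
  "norm_leg_c_table = ([[], [0, 1, 2, 3], [4, 5, 0, 6], [3, 2, 1, 7], [6, 7, 5, 4]],
    [[0], [1, 2, 3, 4], [0, 5, 2, 1], [1, 4, 3, 2], [0, 1, 2, 5]],
    [(2, 1), (2, 3), (4, 3), (4, 1), (0, 5), (2, 5), (0, 1), (2, 1)])"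

definition norm_leg_y_table :: table where
  "norm_leg_y_table = ([[], [0, 1, 2, 3], [4, 5, 6, 1], [3, 2, 7, 0], [7, 6, 5, 4]],
    [[0], [1, 0, 3, 2], [0, 5, 4, 3], [1, 2, 3, 0], [0, 3, 4, 5]],
    [(0, 1), (0, 3), (2, 3), (2, 1), (0, 5), (4, 5), (4, 3), (0, 3)])"

definition cross_table :: table where
  "cross_table = ([[], [0, 1, 2, 3], [4, 5, 0, 6], [3, 2, 7, 6], [7, 1, 5, 4]],
    [[0], [1, 2, 3, 4], [0, 5, 2, 1], [1, 4, 3, 0], [0, 3, 2, 5]],
    [(2, 1), (2, 3), (4, 3), (4, 1), (0, 5), (2, 5), (0, 1), (0, 3)])"

definition pair_fourier_table :: table where
  "pair_fourier_table = ([[], [0, 1, 2, 3], [0, 3, 2, 1]],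
    [[0], [1, 0, 3, 2], [0, 1, 2, 3]],
    [(0, 1), (0, 3), (2, 3), (2, 1)])"

definition loop_around_table :: table where
  "loop_around_table = ([[], []],
    [[0], [1]],
    [(0, 1)])"

lemma drawn_mult_three: "drawn (web s mult_three_table) s mult_three_table"
  by (rule drawn_web) code_simp

lemma drawn_pairing2: "drawn (web s pairing2_table) s pairing2_table"
  by (rule drawn_web) code_simp

lemma drawn_pairing3: "drawn (web s pairing3_table) s pairing3_table"
  by (rule drawn_web) code_simp

lemma drawn_two_loops: "drawn (web s two_loops_table) s two_loops_table"
  by (rule drawn_web) code_simp

lemma drawn_leg_c: "drawn (web s leg_c_table) s leg_c_table"
  by (rule drawn_web) code_simp

lemma drawn_leg_y: "drawn (web s leg_y_table) s leg_y_table"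
  by (rule drawn_web) code_simp

lemma drawn_half_trace: "drawn (web s half_trace_table) s half_trace_table"
  by (rule drawn_web) code_simp

lemma drawn_bead_c: "drawn (web s bead_c_table) s bead_c_table"
  by (rule drawn_web) code_simp

lemma drawn_bead_e: "drawn (web s bead_e_table) s bead_e_table"
  by (rule drawn_web) code_simp

lemma drawn_triple: "drawn (web s triple_table) s triple_table"
  by (rule drawn_web) code_simp

lemma drawn_fourier_mult: "drawn (web s fourier_mult_table) s fourier_mult_table"
  by (rule drawn_web) code_simp

lemma drawn_pair_leg_c: "drawn (web s pair_leg_c_table) s pair_leg_c_table"
  by (rule drawn_web) code_simp

lemma drawn_pair_leg_y: "drawn (web s pair_leg_y_table) s pair_leg_y_table"
  by (rule drawn_web) code_simp

lemma drawn_norm_leg_c: "drawn (web s norm_leg_c_table) s norm_leg_c_table"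
  by (rule drawn_web) code_simp

lemma drawn_norm_leg_y: "drawn (web s norm_leg_y_table) s norm_leg_y_table"
  by (rule drawn_web) code_simp

lemma drawn_cross: "drawn (web s cross_table) s cross_table"
  by (rule drawn_web) code_simp

lemma drawn_pair_fourier: "drawn (web s pair_fourier_table) s pair_fourier_table"
  by (rule drawn_web) code_simp

lemma drawn_loop_around: "drawn (web s loop_around_table) s loop_around_table"
  by (rule drawn_web) code_simp

text \<open>
  A reflection fixes the distinguished intervals and reverses the order of the other intervals
  and of the points.
\<close>

definition mirror_table :: "table \<Rightarrow> table" where
  "mirror_table = (\<lambda>(P, R, S). (map rev P, map (\<lambda>rs. hd rs # rev (tl rs)) R, S))"

text \<open>
  The same diagrams on the sphere, drawn with another region, of the opposite shade, at infinity.
  Their output disc has no points, so only its region changes.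
\<close>

definition pairing2_moved_table :: table where
  "pairing2_moved_table = ([[], [0, 1, 2, 3], [3, 2, 1, 0]],
    [[1], [0, 1, 2, 3], [0, 3, 2, 1]],
    [(0, 1), (2, 1), (2, 3), (0, 3)])"

definition loop_moved_table :: table where
  "loop_moved_table = ([[]], [[1]], [(0, 1)])"

lemma drawn_mirror_mult2: "drawn (mirror (mult_tangle (2, s))) s (mirror_table mult2_table)"
  by (rule drawn_all; code_simp)

lemma drawn_mirror_rotation: "drawn (mirror (fourier_tangle (\<not> s))) s (mirror_table rotation_table)"
  by (rule drawn_all; code_simp)

lemma drawn_mirror_leg_c: "drawn (mirror (web s leg_c_table)) s (mirror_table leg_c_table)"
  by (rule drawn_all; code_simp)

lemma drawn_mirror_leg_y: "drawn (mirror (web s leg_y_table)) s (mirror_table leg_y_table)"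
  by (rule drawn_all; code_simp)

lemma drawn_pairing2_moved: "drawn (move_infinity 1 (web s pairing2_table)) s pairing2_moved_table"
  by (rule drawn_all; code_simp)

lemma drawn_loop_moved: "drawn (move_infinity 1 (loop_tangle s)) s loop_moved_table"
  by (rule drawn_all; code_simp)

text \<open>
  In each of these lemmas the two pairs of lists after the disc renamings give the strings and the
  regions of the result to which those of the outer and of the inner tangle are sent.
\<close>

lemma glue_mult2_mult2_0:
  "glue_table mult2_table 0 mult2_table mult_three_table False False [0, 2] [0, 1]
     [0, 1, 6, 7, 5, 4] [0, 1, 4, 5, 3, 2]
     [0, 1, 2, 3, 0, 7] [0, 1, 2, 7, 0, 5]"
  by code_simp

lemma glue_mult2_mult2_1:
  "glue_table mult2_table 1 mult2_table mult_three_table False False [0, 0] [1, 2]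
     [0, 1, 6, 7, 3, 2] [3, 2, 6, 7, 5, 4]
     [0, 1, 2, 3, 0, 5] [0, 5, 2, 3, 0, 7]"
  by code_simp

lemma glue_mult2_unit2_0:
  "glue_table mult2_table 0 unit2_table id2_table False False [0, 0] []
     [0, 1, 2, 3, 0, 1] [0, 1]
     [0, 1, 2, 3, 0, 1] [0, 1, 2]"
  by code_simp

lemma glue_mult2_unit2_1:
  "glue_table mult2_table 1 unit2_table id2_table False False [0, 0] []
     [0, 1, 2, 3, 3, 2] [3, 2]
     [0, 1, 2, 3, 0, 3] [0, 3, 2]"
  by code_simp

lemma glue_mult0_unit0:
  "glue_table mult0_table 0 unit0_table id0_table False False [0, 0] []
     [] []
     [0] [0]"
  by code_simp

lemma glue_trace2_mult2:
  "glue_table trace2_table 0 mult2_table pairing2_table False False [0] [0, 1]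
     [0, 1] [0, 1, 1, 0, 3, 2]
     [0, 1, 2] [0, 1, 2, 1, 0, 3]"
  by code_simp

lemma glue_trace3_mult3:
  "glue_table trace3_table 0 mult3_table pairing3_table False False [0] [0, 1]
     [0, 1, 2] [0, 1, 2, 2, 1, 0, 5, 4, 3]
     [0, 1, 2, 3] [0, 1, 2, 3, 2, 1, 0, 5, 4]"
  by code_simp

lemma glue_trace2_unit2:
  "glue_table trace2_table 0 unit2_table two_loops_table False False [0] []
     [0, 1] [0, 1]
     [0, 1, 2] [0, 1, 2]"
  by code_simp

lemma glue_pairing2_mult2:
  "glue_table pairing2_table 1 mult2_table triple_table False False [0, 0] [1, 2]
     [0, 1, 2, 3] [3, 2, 1, 0, 5, 4]
     [0, 1, 2, 3] [0, 3, 2, 1, 0, 5]"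
  by code_simp

lemma glue_rotation_mult2:
  "glue_table rotation_table 0 mult2_table fourier_mult_table True False [0] [0, 1]
     [5, 0, 1, 4] [0, 1, 4, 5, 3, 2]
     [0, 1, 2, 3] [1, 2, 3, 0, 0, 4]"
  by code_simp

lemma glue_pairing3_mirror_leg_c:
  "glue_table pairing3_table 0 (mirror_table leg_c_table) pair_leg_c_table False False [0, 2] [0, 1]
     [4, 5, 1, 2, 3, 6] [3, 2, 1, 0, 6, 5, 4]
     [0, 5, 2, 3, 4, 1] [0, 1, 4, 3, 2, 5]"
  by code_simp

lemma glue_pairing3_mirror_leg_y:
  "glue_table pairing3_table 0 (mirror_table leg_y_table) pair_leg_y_table False False [0, 2] [0, 1]
     [4, 5, 6, 2, 3, 0] [3, 2, 1, 0, 6, 5, 4]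
     [0, 5, 4, 3, 2, 1] [0, 1, 2, 3, 4, 5]"
  by code_simp

lemma glue_pair_leg_c_leg_c:
  "glue_table pair_leg_c_table 2 leg_c_table norm_leg_c_table False False [0, 1, 0] [2, 3]
     [0, 1, 2, 3, 4, 5, 6] [3, 2, 1, 7, 6, 5, 4]
     [0, 1, 2, 3, 4, 5] [0, 1, 4, 3, 2, 5]"
  by code_simp

lemma glue_pair_leg_y_leg_y:
  "glue_table pair_leg_y_table 2 leg_y_table norm_leg_y_table False False [0, 1, 0] [2, 3]
     [0, 1, 2, 3, 4, 5, 6] [3, 2, 7, 0, 6, 5, 4]
     [0, 1, 2, 3, 4, 5] [0, 1, 2, 3, 4, 5]"
  by code_simp

lemma glue_pair_leg_c_leg_y:
  "glue_table pair_leg_c_table 2 leg_y_table cross_table False False [0, 1, 0] [2, 3]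
     [0, 1, 2, 3, 4, 5, 6] [3, 2, 7, 6, 1, 5, 4]
     [0, 1, 2, 3, 4, 5] [0, 1, 4, 3, 2, 5]"
  by code_simp

lemma glue_triple_fourier_mult:
  "glue_table triple_table 1 fourier_mult_table cross_table False False [1, 0, 3] [0, 2]
     [4, 5, 0, 6, 1, 7] [0, 1, 2, 3, 7, 6]
     [0, 5, 2, 1, 0, 3] [0, 1, 2, 3, 4]"
  by code_simp

lemma glue_bead_c_half_trace:
  "glue_table bead_c_table 2 half_trace_table norm_leg_c_table True False [1, 3, 0] [0, 2]
     [4, 5, 0, 6, 7] [0, 1, 2, 3, 7]
     [0, 5, 2, 1] [1, 2, 3, 4]"
  by code_simp

lemma glue_bead_e_half_trace:
  "glue_table bead_e_table 2 half_trace_table norm_leg_y_table False False [0, 2, 0] [3, 1]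
     [0, 1, 2, 3, 7] [7, 6, 5, 4, 1]
     [0, 1, 2, 3] [0, 3, 4, 5]"
  by code_simp

lemma glue_bead_c_unit1:
  "glue_table bead_c_table 2 unit1_table pairing2_table True False [0, 1, 0] []
     [0, 1, 2, 3, 2] [2]
     [0, 1, 2, 3] [3, 2]"
  by code_simp

lemma glue_trace1_half_trace:
  "glue_table trace1_table 0 half_trace_table pairing2_table False False [0] [0, 1]
     [0] [0, 1, 2, 3, 0]
     [0, 1] [0, 1, 2, 3]"
  by code_simp

lemma glue_trace1_unit1:
  "glue_table trace1_table 0 unit1_table loop_table False False [0] []
     [0] [0]
     [0, 1] [0, 1]"
  by code_simp

lemma glue_pairing2_mirror_rotation:
  "glue_table pairing2_table 0 (mirror_table rotation_table) pair_fourier_table False False [0, 1] [0]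
     [1, 2, 3, 0] [0, 3, 2, 1]
     [0, 3, 2, 1] [0, 1, 2, 3]"
  by code_simp

lemma glue_pair_fourier_rotation:
  "glue_table pair_fourier_table 1 rotation_table pairing2_moved_table False True [0, 0] [1]
     [0, 1, 2, 3] [0, 3, 2, 1]
     [1, 0, 3, 2] [1, 0, 3, 2]"
  by code_simp

lemma glue_bead_e_unit1:
  "glue_table bead_e_table 2 unit1_table pairing2_moved_table False True [0, 1, 0] []
     [0, 1, 2, 3, 1] [1]
     [1, 0, 3, 2] [1, 2]"
  by code_simp

lemma glue_rotation_mirror_rotation:
  "glue_table rotation_table 0 (mirror_table rotation_table) id2_table True False [0] [0]
     [0, 1, 2, 3] [0, 3, 2, 1]
     [0, 1, 2, 3] [1, 0, 3, 2]"
  by code_simp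

lemma glue_loop_around_unit0:
  "glue_table loop_around_table 0 unit0_table loop_table True False [0] []
     [0] []
     [0, 1] [1]"
  by code_simp

lemma glue_loop_around_loop:
  "glue_table loop_around_table 0 loop_table two_loops_table True False [0] []
     [0] [1]
     [0, 1] [1, 2]"
  by code_simp

lemma glue_mult1_unit1:
  "glue_table mult1_table 0 unit1_table id1_table False False [0, 0] []
     [0, 1, 0] [0]
     [0, 1] [0, 1]"
  by code_simp

lemma glue_mult2_id2:
  "glue_table mult2_table 0 id2_table (mirror_table mult2_table) False False [0, 0] [1]
     [3, 2, 1, 0, 4, 5] [3, 2, 5, 4]
     [0, 3, 2, 1, 0, 5] [0, 3, 2, 5]"
  by code_simp

lemma glue_pairing2_id2:
  "glue_table pairing2_table 0 id2_table pairing2_table False False [0, 0] [1]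
     [3, 2, 1, 0] [3, 2, 1, 0]
     [0, 3, 2, 1] [0, 3, 2, 1]"
  by code_simp

lemma glue_trace1_unit1_2:
  "glue_table trace1_table 0 unit1_table loop_moved_table False True [0] []
     [0] [0]
     [1, 0] [1, 0]"
  by code_simp



section \<open>Spectral theory of box algebras\<close>

text \<open>
  The part of the structure of a box space that the Cauchy--Schwarz inequality needs. It is all that is
  required of the 3-box space; the 2-box spaces are treated as *-algebras below.
\<close>

locale box_hilbert = vector_space "scl A" for A :: "'a::ab_group_add planar_structure" +
  fixes k :: colour
  assumes space: "subspace (box_space A k)"
    and mult_closed: "a \<in> box_space A k \<Longrightarrow> b \<in> box_space A k \<Longrightarrow> box_mult A k a b \<in> box_space A k"
    and mult_add_left: "a \<in> box_space A k \<Longrightarrow> b \<in> box_space A k \<Longrightarrow> c \<in> box_space A k \<Longrightarrow>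
      box_mult A k (a + b) c = box_mult A k a c + box_mult A k b c"
    and mult_add_right: "a \<in> box_space A k \<Longrightarrow> b \<in> box_space A k \<Longrightarrow> c \<in> box_space A k \<Longrightarrow>
      box_mult A k a (b + c) = box_mult A k a b + box_mult A k a c"
    and mult_scale_left: "a \<in> box_space A k \<Longrightarrow> b \<in> box_space A k \<Longrightarrow>
      box_mult A k (scl A z a) b = scl A z (box_mult A k a b)"
    and mult_scale_right: "a \<in> box_space A k \<Longrightarrow> b \<in> box_space A k \<Longrightarrow>
      box_mult A k a (scl A z b) = scl A z (box_mult A k a b)"
    and star_closed: "a \<in> box_space A k \<Longrightarrow> star A k a \<in> box_space A k"
    and star_star: "a \<in> box_space A k \<Longrightarrow> star A k (star A k a) = a"
    and star_add: "a \<in> box_space A k \<Longrightarrow> b \<in> box_space A k \<Longrightarrow>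
      star A k (a + b) = star A k a + star A k b"
    and star_scale: "a \<in> box_space A k \<Longrightarrow> star A k (scl A z a) = scl A (cnj z) (star A k a)"
    and tr_add: "a \<in> box_space A k \<Longrightarrow> b \<in> box_space A k \<Longrightarrow> tr A k (a + b) = tr A k a + tr A k b"
    and tr_scale: "a \<in> box_space A k \<Longrightarrow> tr A k (scl A z a) = z * tr A k a"
    and tr_positive: "a \<in> box_space A k \<Longrightarrow> a \<noteq> 0 \<Longrightarrow>
      tr A k (box_mult A k (star A k a) a) \<in> \<real> \<and> 0 < Re (tr A k (box_mult A k (star A k a) a))"
begin

abbreviation "V \<equiv> box_space A k"

abbreviation scale_box :: "complex \<Rightarrow> 'a \<Rightarrow> 'a" (infixr "\<cdot>" 75) where
  "z \<cdot> a \<equiv> scl A z a"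

abbreviation mult_box :: "'a \<Rightarrow> 'a \<Rightarrow> 'a" (infixl "\<odot>" 70) where
  "a \<odot> b \<equiv> box_mult A k a b"

abbreviation adjoint_box :: "'a \<Rightarrow> 'a" ("_\<^sup>\<dagger>" [1000] 999) where
  "a\<^sup>\<dagger> \<equiv> star A k a"

definition ip :: "'a \<Rightarrow> 'a \<Rightarrow> complex" where
  "ip a b = tr A k (a\<^sup>\<dagger> \<odot> b)"

lemma zero_closed [simp]: "0 \<in> V" using space by (rule subspace_0)
lemma add_closed [simp]: "a \<in> V \<Longrightarrow> b \<in> V \<Longrightarrow> a + b \<in> V" using space by (rule subspace_add)
lemma scale_closed [simp]: "a \<in> V \<Longrightarrow> z \<cdot> a \<in> V" using space by (rule subspace_scale)
lemma diff_closed [simp]: "a \<in> V \<Longrightarrow> b \<in> V \<Longrightarrow> a - b \<in> V" using space by (rule subspace_diff)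
lemma sum_closed [simp]: "(\<And>i. i \<in> I \<Longrightarrow> f i \<in> V) \<Longrightarrow> (\<Sum>i\<in>I. f i) \<in> V" using space by (rule subspace_sum)
declare mult_closed [simp] star_closed [simp] star_star [simp]

lemma box_mult_zero_left [simp]: "a \<in> V \<Longrightarrow> 0 \<odot> a = 0"
  using mult_scale_left[of 0 a 0] by simp
lemma box_mult_zero_right [simp]: "a \<in> V \<Longrightarrow> a \<odot> 0 = 0"
  using mult_scale_right[of a 0 0] by simp
lemma star_zero [simp]: "0\<^sup>\<dagger> = 0"
  using star_scale[of 0 0] by simp
lemma tr_zero [simp]: "tr A k 0 = 0"
  using tr_scale[of 0 0] by simp

lemma mult_diff_left: "a \<in> V \<Longrightarrow> b \<in> V \<Longrightarrow> c \<in> V \<Longrightarrow> (a - b) \<odot> c = a \<odot> c - b \<odot> c"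
  using mult_add_left[of "a - b" b c] by (simp add: algebra_simps)
lemma mult_diff_right: "a \<in> V \<Longrightarrow> b \<in> V \<Longrightarrow> c \<in> V \<Longrightarrow> a \<odot> (b - c) = a \<odot> b - a \<odot> c"
  using mult_add_right[of a "b - c" c] by (simp add: algebra_simps)
lemma star_diff: "a \<in> V \<Longrightarrow> b \<in> V \<Longrightarrow> (a - b)\<^sup>\<dagger> = a\<^sup>\<dagger> - b\<^sup>\<dagger>"
  using star_add[of "a - b" b] by (simp add: algebra_simps)
lemma tr_diff: "a \<in> V \<Longrightarrow> b \<in> V \<Longrightarrow> tr A k (a - b) = tr A k a - tr A k b"
  using tr_add[of "a - b" b] by (simp add: algebra_simps)

lemma mult_sum_left: "(\<And>i. i \<in> I \<Longrightarrow> f i \<in> V) \<Longrightarrow> b \<in> V \<Longrightarrow> (\<Sum>i\<in>I. f i) \<odot> b = (\<Sum>i\<in>I. f i \<odot> b)"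
  by (induction I rule: infinite_finite_induct) (auto simp: mult_add_left)
lemma mult_sum_right: "(\<And>i. i \<in> I \<Longrightarrow> f i \<in> V) \<Longrightarrow> b \<in> V \<Longrightarrow> b \<odot> (\<Sum>i\<in>I. f i) = (\<Sum>i\<in>I. b \<odot> f i)"
  by (induction I rule: infinite_finite_induct) (auto simp: mult_add_right)
lemma star_sum: "(\<And>i. i \<in> I \<Longrightarrow> f i \<in> V) \<Longrightarrow> (\<Sum>i\<in>I. f i)\<^sup>\<dagger> = (\<Sum>i\<in>I. (f i)\<^sup>\<dagger>)"
  by (induction I rule: infinite_finite_induct) (auto simp: star_add)
lemma tr_sum: "(\<And>i. i \<in> I \<Longrightarrow> f i \<in> V) \<Longrightarrow> tr A k (\<Sum>i\<in>I. f i) = (\<Sum>i\<in>I. tr A k (f i))"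
  by (induction I rule: infinite_finite_induct) (auto simp: tr_add)

lemma ip_add_right: "a \<in> V \<Longrightarrow> b \<in> V \<Longrightarrow> c \<in> V \<Longrightarrow> ip a (b + c) = ip a b + ip a c"
  by (simp add: ip_def mult_add_right tr_add)
lemma ip_add_left: "a \<in> V \<Longrightarrow> b \<in> V \<Longrightarrow> c \<in> V \<Longrightarrow> ip (a + b) c = ip a c + ip b c"
  by (simp add: ip_def star_add mult_add_left tr_add)
lemma ip_diff_right: "a \<in> V \<Longrightarrow> b \<in> V \<Longrightarrow> c \<in> V \<Longrightarrow> ip a (b - c) = ip a b - ip a c"
  by (simp add: ip_def mult_diff_right tr_diff)
lemma ip_diff_left: "a \<in> V \<Longrightarrow> b \<in> V \<Longrightarrow> c \<in> V \<Longrightarrow> ip (a - b) c = ip a c - ip b c"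
  by (simp add: ip_def star_diff mult_diff_left tr_diff)
lemma ip_scale_right: "a \<in> V \<Longrightarrow> b \<in> V \<Longrightarrow> ip a (z \<cdot> b) = z * ip a b"
  by (simp add: ip_def mult_scale_right tr_scale)
lemma ip_scale_left: "a \<in> V \<Longrightarrow> b \<in> V \<Longrightarrow> ip (z \<cdot> a) b = cnj z * ip a b"
  by (simp add: ip_def star_scale mult_scale_left tr_scale)
lemma ip_sum_right: "a \<in> V \<Longrightarrow> (\<And>i. i \<in> I \<Longrightarrow> f i \<in> V) \<Longrightarrow> ip a (\<Sum>i\<in>I. f i) = (\<Sum>i\<in>I. ip a (f i))"
  by (simp add: ip_def mult_sum_right tr_sum)
lemma ip_sum_left: "a \<in> V \<Longrightarrow> (\<And>i. i \<in> I \<Longrightarrow> f i \<in> V) \<Longrightarrow> ip (\<Sum>i\<in>I. f i) a = (\<Sum>i\<in>I. ip (f i) a)"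
  by (simp add: ip_def star_sum mult_sum_left tr_sum)
lemma ip_zero [simp]: "a \<in> V \<Longrightarrow> ip a 0 = 0" "a \<in> V \<Longrightarrow> ip 0 a = 0"
  by (simp_all add: ip_def)

lemma ip_self_real: "a \<in> V \<Longrightarrow> ip a a = of_real (Re (ip a a))"
  using tr_positive[of a] by (cases "a = 0") (auto simp: ip_def complex_is_Real_iff complex_eq_iff)

lemma ip_self_pos: "a \<in> V \<Longrightarrow> a \<noteq> 0 \<Longrightarrow> 0 < Re (ip a a)"
  using tr_positive[of a] by (simp add: ip_def)

lemma ip_self_nonneg: "a \<in> V \<Longrightarrow> 0 \<le> Re (ip a a)"
  using ip_self_pos[of a] by (cases "a = 0") auto

lemma norm2_nonneg: "a \<in> V \<Longrightarrow> 0 \<le> norm2 A k a"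
  using ip_self_nonneg[of a] by (simp add: norm2_def ip_def)

lemma norm2_power2: "a \<in> V \<Longrightarrow> (norm2 A k a)\<^sup>2 = Re (ip a a)"
  using ip_self_nonneg[of a] by (simp add: norm2_def ip_def)

lemma norm2_zero [simp]: "norm2 A k 0 = 0"
  by (simp add: norm2_def)

lemma ip_self: "a \<in> V \<Longrightarrow> ip a a = of_real ((norm2 A k a)\<^sup>2)"
  using ip_self_real norm2_power2 by simp

lemma ip_cnj: 
  assumes "a \<in> V" "b \<in> V"
  shows "ip b a = cnj (ip a b)"
proof -
  have "Im (ip a b + ip b a) = 0"
    using ip_self_real[of "a + b"] ip_self_real[of a] ip_self_real[of b] assms
    by (simp add: ip_add_left ip_add_right complex_eq_iff)
  moreover have "Im (\<i> * ip a b - \<i> * ip b a) = 0"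
    using ip_self_real[of "a + \<i> \<cdot> b"] ip_self_real[of a] ip_self_real[of b] assms
    by (simp add: ip_add_left ip_add_right ip_scale_left ip_scale_right complex_eq_iff)
  ultimately show ?thesis by (simp add: complex_eq_iff)
qed

lemma Cauchy_Schwarz:
  assumes a: "a \<in> V" and b: "b \<in> V"
  shows "cmod (ip a b) \<le> norm2 A k a * norm2 A k b"
proof (cases "b = 0")
  case False
  define B where "B = Re (ip b b)"
  have B: "0 < B" "ip b b = of_real B" using ip_self_pos[OF b False] ip_self_real[OF b] by (auto simp: B_def)
  define c where "c = ip b a / of_real B"
  have ba: "ip b a = cnj (ip a b)" by (rule ip_cnj[OF a b])
  have "ip (a - c \<cdot> b) (a - c \<cdot> b) = ip a a - c * ip a b - cnj c * (ip b a - c * ip b b)"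
    using a b by (simp add: ip_diff_left ip_diff_right ip_scale_left ip_scale_right algebra_simps)
  also have "c * ip b b = ip b a" using B by (simp add: c_def)
  also have "c * ip a b = of_real ((cmod (ip a b))\<^sup>2 / B)"
    by (simp add: c_def ba complex_norm_square[symmetric] mult.commute)
  finally have "Re (ip (a - c \<cdot> b) (a - c \<cdot> b)) = Re (ip a a) - (cmod (ip a b))\<^sup>2 / B" by simp
  with ip_self_nonneg[of "a - c \<cdot> b"] a b have "(cmod (ip a b))\<^sup>2 / B \<le> Re (ip a a)" by simp
  with B have "(cmod (ip a b))\<^sup>2 \<le> Re (ip a a) * B" by (simp add: divide_simps)
  also have "\<dots> = (norm2 A k a * norm2 A k b)\<^sup>2"
    using a b by (simp add: power_mult_distrib norm2_power2 B_def)
  finally show ?thesis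
    by (rule power2_le_imp_le) (simp add: norm2_nonneg a b)
qed (use a norm2_nonneg in \<open>simp add: ip_def\<close>)

end

locale box_algebra = box_hilbert A k for A :: "'a::ab_group_add planar_structure" and k +
  assumes assoc: "a \<in> box_space A k \<Longrightarrow> b \<in> box_space A k \<Longrightarrow> c \<in> box_space A k \<Longrightarrow>
      box_mult A k (box_mult A k a b) c = box_mult A k a (box_mult A k b c)"
    and unit_closed: "unit_of A k \<in> box_space A k"
    and unit_left: "a \<in> box_space A k \<Longrightarrow> box_mult A k (unit_of A k) a = a"
    and unit_right: "a \<in> box_space A k \<Longrightarrow> box_mult A k a (unit_of A k) = a"
    and star_mult: "a \<in> box_space A k \<Longrightarrow> b \<in> box_space A k \<Longrightarrow>
      star A k (box_mult A k a b) = box_mult A k (star A k b) (star A k a)"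
    and tr_commute: "a \<in> box_space A k \<Longrightarrow> b \<in> box_space A k \<Longrightarrow>
      tr A k (box_mult A k a b) = tr A k (box_mult A k b a)"
    and finite_dim: "\<exists>B. finite B \<and> module.span (scl A) B = box_space A k"
begin

declare unit_closed [simp] unit_left [simp] unit_right [simp]

abbreviation one :: 'a where "one \<equiv> unit_of A k"

lemma star_one [simp]: "one\<^sup>\<dagger> = one"
  using star_mult[of "one\<^sup>\<dagger>" one] by simp

lemma ip_mult_left: "a \<in> V \<Longrightarrow> b \<in> V \<Longrightarrow> c \<in> V \<Longrightarrow> ip (a \<odot> b) c = ip b (a\<^sup>\<dagger> \<odot> c)"
  by (simp add: ip_def star_mult assoc)

definition power_box :: "'a \<Rightarrow> nat \<Rightarrow> 'a" where
  "power_box a n = ((\<lambda>x. a \<odot> x) ^^ n) one"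

lemma power_box_closed [simp]: "a \<in> V \<Longrightarrow> power_box a n \<in> V"
  by (induction n) (auto simp: power_box_def)

text \<open>
  The polynomial functional calculus.
\<close>

definition poly_box :: "'a \<Rightarrow> complex poly \<Rightarrow> 'a" where
  "poly_box a p = (\<Sum>i\<le>degree p. coeff p i \<cdot> power_box a i)"

lemma poly_box_closed [simp]: "a \<in> V \<Longrightarrow> poly_box a p \<in> V"
  by (simp add: poly_box_def)

lemma poly_box_upto: "degree p \<le> n \<Longrightarrow> poly_box a p = (\<Sum>i\<le>n. coeff p i \<cdot> power_box a i)"
  unfolding poly_box_def by (rule sum.mono_neutral_left) (auto simp: coeff_eq_0)

lemma poly_box_zero [simp]: "poly_box a 0 = 0"
  by (simp add: poly_box_def)

lemma poly_box_add: "poly_box a (p + q) = poly_box a p + poly_box a q"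
proof -
  let ?n = "max (degree p) (degree q)"
  have "poly_box a p + poly_box a q = (\<Sum>i\<le>?n. coeff p i \<cdot> power_box a i) + (\<Sum>i\<le>?n. coeff q i \<cdot> power_box a i)"
    by (simp add: poly_box_upto[of p ?n] poly_box_upto[of q ?n])
  also have "\<dots> = poly_box a (p + q)"
    by (subst poly_box_upto[of "p + q" ?n])
      (auto simp: degree_add_le scale_left_distrib sum.distrib)
  finally show ?thesis ..
qed

lemma poly_box_smult: "poly_box a (smult c p) = c \<cdot> poly_box a p"
  by (subst poly_box_upto[of _ "degree p"]) (auto simp: degree_smult_le poly_box_def scale_sum_right)

lemma poly_box_sum: "poly_box a (\<Sum>i\<in>I. f i) = (\<Sum>i\<in>I. poly_box a (f i))"
  by (induction I rule: infinite_finite_induct) (auto simp: poly_box_add)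

lemma poly_box_pCons:
  assumes "a \<in> V"
  shows "poly_box a (pCons c p) = c \<cdot> one + a \<odot> poly_box a p"
proof -
  have "poly_box a (pCons c p) = (\<Sum>i\<le>Suc (degree p). coeff (pCons c p) i \<cdot> power_box a i)"
    by (rule poly_box_upto) (rule degree_pCons_le)
  also have "\<dots> = c \<cdot> one + (\<Sum>i\<le>degree p. coeff p i \<cdot> (a \<odot> power_box a i))"
    by (subst sum.atMost_Suc_shift) (simp add: power_box_def)
  also have "(\<Sum>i\<le>degree p. coeff p i \<cdot> (a \<odot> power_box a i)) = a \<odot> poly_box a p"
    using assms by (simp add: poly_box_def mult_sum_right mult_scale_right)
  finally show ?thesis .
qed

lemma poly_box_one: "a \<in> V \<Longrightarrow> poly_box a 1 = one"
  using poly_box_pCons[of a 1 0] by (simp add: one_pCons)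

lemma poly_box_X: "a \<in> V \<Longrightarrow> poly_box a [:0, 1:] = a"
  by (simp add: poly_box_pCons)

lemma poly_box_linear: "a \<in> V \<Longrightarrow> poly_box a [:- z, 1:] = a - z \<cdot> one"
  by (simp add: poly_box_pCons)

lemma poly_box_mult:
  assumes "a \<in> V"
  shows "poly_box a (p * q) = poly_box a p \<odot> poly_box a q"
proof (induction p)
  case (pCons c p)
  have "poly_box a (pCons c p * q) = c \<cdot> poly_box a q + (0 \<cdot> one + a \<odot> poly_box a (p * q))"
    by (simp only: mult_pCons_left poly_box_add poly_box_smult poly_box_pCons[OF assms])
  also have "\<dots> = poly_box a (pCons c p) \<odot> poly_box a q"
    using assms pCons.IH by (simp add: poly_box_pCons mult_add_left mult_scale_left assoc)
  finally show ?case .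
qed (use assms in simp)

lemma poly_box_star:
  assumes a: "a \<in> V" and sa: "a\<^sup>\<dagger> = a"
  shows "(poly_box a p)\<^sup>\<dagger> = poly_box a (map_poly cnj p)"
proof (induction p)
  case (pCons c p)
  let ?q = "poly_box a (map_poly cnj p)"
  have "(poly_box a (pCons c p))\<^sup>\<dagger> = cnj c \<cdot> one + ?q \<odot> a"
    using a by (simp add: poly_box_pCons star_add star_scale star_mult pCons.IH sa)
  also have "?q \<odot> a = a \<odot> ?q"
    using poly_box_mult[OF a, of "map_poly cnj p" "[:0, 1:]"] poly_box_mult[OF a, of "[:0, 1:]" "map_poly cnj p"]
    by (simp only: poly_box_X[OF a] mult.commute)
  finally show ?case using a by (simp add: map_poly_pCons poly_box_pCons)
qed simp

lemma poly_box_monom: "poly_box a (monom c n) = c \<cdot> power_box a n"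
  by (subst poly_box_upto[of _ n]) (auto simp: degree_monom_le if_distrib[of "\<lambda>z. z \<cdot> _"] sum.delta cong: if_cong)

text \<open>
  Finitely many powers are linearly dependent in a finite-dimensional algebra.
\<close>

lemma annihilating_poly:
  assumes a: "a \<in> V"
  obtains p where "p \<noteq> 0" "poly_box a p = 0"
proof -
  obtain B where B: "finite B" "span B = V" using finite_dim by auto
  let ?n = "card B"
  show thesis
  proof (cases "inj_on (power_box a) {..?n}")
    case False
    then obtain i j where ij: "i \<noteq> j" "power_box a i = power_box a j" by (auto simp: inj_on_def)
    let ?p = "monom 1 i + smult (- 1) (monom 1 j) :: complex poly"
    have "coeff ?p i = 1" using ij(1) by simp
    then have "?p \<noteq> 0" by (metis coeff_0 zero_neq_one)
    moreover have "poly_box a ?p = 0"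
      unfolding poly_box_add poly_box_smult poly_box_monom using ij by simp
    ultimately show thesis by (rule that)
  next
    case True
    let ?S = "power_box a ` {..?n}"
    have sub: "?S \<subseteq> span B" unfolding B(2) using a by (intro image_subsetI) simp
    have "dependent ?S"
    proof (rule ccontr)
      assume "\<not> dependent ?S"
      from independent_span_bound[OF B(1) this sub] have "card ?S \<le> card B" by (rule conjunct2)
      then show False unfolding card_image[OF True] by simp
    qed
    then have "\<exists>u. (\<exists>v \<in> ?S. u v \<noteq> 0) \<and> (\<Sum>v\<in>?S. u v \<cdot> v) = 0"
      by (subst (asm) dependent_finite) simp_all
    then obtain u where u: "\<exists>v \<in> ?S. u v \<noteq> 0" "(\<Sum>v\<in>?S. u v \<cdot> v) = 0" by blast
    define p where "p = (\<Sum>i\<le>?n. monom (u (power_box a i)) i)"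
    have "poly_box a p = (\<Sum>i\<le>?n. u (power_box a i) \<cdot> power_box a i)"
      by (simp add: p_def poly_box_sum poly_box_monom)
    also have "\<dots> = (\<Sum>v\<in>?S. u v \<cdot> v)" using True by (simp add: sum.reindex)
    finally have "poly_box a p = 0" using u by simp
    moreover from u(1) obtain i where "i \<le> ?n" "u (power_box a i) \<noteq> 0" by auto
    then have "coeff p i \<noteq> 0" by (simp add: p_def coeff_sum sum.delta)
    then have "p \<noteq> 0" by auto
    ultimately show thesis using that by blast
  qed
qed

text \<open>
  The minimal polynomial of a self-adjoint element has real and simple roots, because the trace
  is positive. Hence an element of the polynomial calculus only depends on the values of
  the polynomial at the roots, and the Lagrange polynomials give the spectral projections.
\<close>

lemma spectral_decomposition_exists:
  assumes a: "a \<in> V" and sa: "a\<^sup>\<dagger> = a"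
  obtains L e where "spectral_decomposition A k a L e"
proof -
  obtain p where p: "p \<noteq> 0" "poly_box a p = 0"
    and minimal: "\<And>q. q \<noteq> 0 \<Longrightarrow> degree q < degree p \<Longrightarrow> poly_box a q \<noteq> 0"
  proof -
    obtain p0 where "p0 \<noteq> 0 \<and> poly_box a p0 = 0" using annihilating_poly[OF a] by blast
    from ex_has_least_nat[of "\<lambda>p. p \<noteq> 0 \<and> poly_box a p = 0", OF this, of degree]
    show thesis using that by (metis not_le)
  qed
  define Z where "Z = {z. poly p z = 0}"
  have finZ: "finite Z" using p(1) by (simp add: Z_def poly_roots_finite)
  have sa_ip: "ip (a \<odot> x) y = ip x (a \<odot> y)" if "x \<in> V" "y \<in> V" for x y
    using ip_mult_left[of a x y] that a sa by simp
  have factor: "\<exists>q. p = [:- z, 1:] * q \<and> q \<noteq> 0 \<and> degree p = Suc (degree q)" if "z \<in> Z" for z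
  proof -
    from that obtain q where q: "p = [:- z, 1:] * q" by (auto simp: Z_def poly_eq_0_iff_dvd dvd_def)
    with p(1) have "q \<noteq> 0" by auto
    then have "degree p = Suc (degree q)" unfolding q by (subst degree_mult_eq) auto
    with q \<open>q \<noteq> 0\<close> show ?thesis by blast
  qed
  (* A root z has an eigenvector, namely the value of p / (X - z). *)
  have Z_real: "z \<in> \<real>" if z: "z \<in> Z" for z
  proof -
    obtain q where q: "p = [:- z, 1:] * q" "q \<noteq> 0" "degree p = Suc (degree q)" using factor[OF z] by auto
    let ?x = "poly_box a q"
    have x: "?x \<noteq> 0" "?x \<in> V" using minimal[of q] q a by auto
    have "(a - z \<cdot> one) \<odot> ?x = 0"
      using p(2) a by (simp only: q(1) poly_box_mult poly_box_linear)
    then have ax: "a \<odot> ?x = z \<cdot> ?x" using a x by (simp add: mult_diff_left mult_scale_left)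
    have "cnj z * ip ?x ?x = z * ip ?x ?x"
      using sa_ip[of ?x ?x] x by (simp add: ax ip_scale_left ip_scale_right)
    moreover have "ip ?x ?x \<noteq> 0" using ip_self_pos[OF x(2,1)] by auto
    ultimately show ?thesis by (simp add: Reals_cnj_iff)
  qed
  (* For a double root, a nonzero y = (a - z) w with (a - z) y = 0 would be orthogonal to itself. *)
  have simple: "order z p = 1" if z: "z \<in> Z" for z
  proof (rule ccontr)
    assume "order z p \<noteq> 1"
    moreover have "order z p \<noteq> 0" using z p(1) by (simp add: Z_def order_root)
    ultimately have "2 \<le> order z p" by simp
    then have "[:- z, 1:] ^ 2 dvd p" using order_divides p(1) by blast
    then obtain w where "p = [:- z, 1:] ^ 2 * w" by (elim dvdE)
    then have w: "p = [:- z, 1:] * ([:- z, 1:] * w)" by (simp only: power2_eq_square mult.assoc)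
    define y where "y = poly_box a ([:- z, 1:] * w)"
    have nz: "[:- z, 1:] * w \<noteq> 0" using p(1) w by (metis mult_zero_right)
    have "[:- z, 1:] \<noteq> 0" by simp
    from degree_mult_eq[OF this nz] have "degree p = Suc (degree ([:- z, 1:] * w))"
      by (simp only: w[symmetric]) simp
    then have "degree ([:- z, 1:] * w) < degree p" by simp
    with nz have y: "y \<noteq> 0" "y \<in> V" using minimal a by (auto simp: y_def)
    have "(a - z \<cdot> one) \<odot> y = 0"
      using p(2) a by (simp only: y_def w poly_box_mult poly_box_linear)
    then have ay: "a \<odot> y = z \<cdot> y" using a y by (simp add: mult_diff_left mult_scale_left)
    have y_eq: "y = a \<odot> poly_box a w - z \<cdot> poly_box a w"
      unfolding y_def poly_box_mult[OF a] poly_box_linear[OF a]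
      using a by (simp add: mult_diff_left mult_scale_left)
    have "cnj z = z" using Z_real[OF z] by (simp add: Reals_cnj_iff)
    then have "ip (a \<odot> poly_box a w - z \<cdot> poly_box a w) y = 0"
      using a y by (simp add: ip_diff_left ip_scale_left sa_ip ay ip_scale_right)
    then have "ip y y = 0" by (simp flip: y_eq)
    with ip_self_pos[OF y(2,1)] show False by simp
  qed
  have deg: "degree p = card Z"
  proof -
    have "rsquarefree p"
      unfolding rsquarefree_def using p(1) simple by (auto simp: Z_def order_root)
    then have "p = smult (lead_coeff p) (\<Prod>z\<in>Z. [:- z, 1:])"
      using complex_poly_decompose_rsquarefree[of p] by (simp add: Z_def)
    then have "degree p = degree (\<Prod>z\<in>Z. [:- z, 1:])" using p(1) by (metis degree_smult_eq leading_coeff_0_iff)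
    then show ?thesis by (simp add: degree_prod_sum_eq)
  qed
  have vanish: "poly_box a h = 0" if h: "\<And>z. z \<in> Z \<Longrightarrow> poly h z = 0" for h
  proof -
    let ?m = "h mod p"
    have h_eq: "h = p * (h div p) + ?m" by simp
    have "?m = 0"
    proof (rule ccontr)
      assume m: "?m \<noteq> 0"
      have "poly ?m z = 0" if "z \<in> Z" for z
      proof -
        have "poly h z = poly p z * poly (h div p) z + poly ?m z"
          by (subst h_eq) (simp only: poly_add poly_mult)
        with h[OF that] that show ?thesis by (simp add: Z_def)
      qed
      then have "card Z \<le> card {z. poly ?m z = 0}"
        using m by (intro card_mono) (auto simp: poly_roots_finite)
      also have "\<dots> \<le> degree ?m" using m by (rule card_poly_roots_bound)
      also have "\<dots> < degree p" using m p(1) by (metis degree_mod_less)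
      finally show False by (simp add: deg)
    qed
    then have "h = p * (h div p)" using h_eq by simp
    then have "poly_box a h = poly_box a p \<odot> poly_box a (h div p)" using poly_box_mult[OF a] by metis
    then show ?thesis using p(2) a by simp
  qed
  have agree: "poly_box a f = poly_box a g" if "\<And>z. z \<in> Z \<Longrightarrow> poly f z = poly g z" for f g
  proof -
    have "poly_box a (f + smult (- 1) g) = 0" by (rule vanish) (simp add: that)
    then show ?thesis unfolding poly_box_add poly_box_smult by simp
  qed
  (* The Lagrange interpolation polynomials of the roots. *)
  define l where "l z = (\<Prod>w\<in>Z - {z}. smult (1 / (z - w)) [:- w, 1:])" for z
  have l: "poly (l z) w = (if w = z then 1 else 0)" if "w \<in> Z" for z w
  proof (cases "w = z")
    case True
    then show ?thesis
      using finZ by (auto simp: l_def poly_prod diff_divide_distrib[symmetric] intro!: prod.neutral)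
  next
    case False
    with that finZ show ?thesis by (auto simp: l_def poly_prod intro!: prod_zero bexI[of _ w])
  qed
  define e where "e r = poly_box a (l (complex_of_real r))" for r
  have re: "complex_of_real (Re z) = z" if "z \<in> Z" for z using Z_real[OF that] by (simp add: complex_is_Real_iff complex_eq_iff)
  have inj: "inj_on Re Z" by (metis inj_onI re)
  have "spectral_decomposition A k a (Re ` Z) e"
    unfolding spectral_decomposition_def
  proof (intro conjI ballI impI)
    show "finite (Re ` Z)" using finZ by simp
    show "e r \<in> V" for r using a by (simp add: e_def)
    show "(e r)\<^sup>\<dagger> = e r" if "r \<in> Re ` Z" for r
    proof -
      have "poly (map_poly cnj (l (complex_of_real r))) z = poly (l (complex_of_real r)) z" if "z \<in> Z" for z
      proof -
        have "z = cnj z" using Z_real[OF that] by (simp add: Reals_cnj_iff)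
        then have "poly (map_poly cnj (l (complex_of_real r))) z = cnj (poly (l (complex_of_real r)) z)"
          using poly_cnj[of "l (complex_of_real r)" "cnj z"] by simp
        also have "\<dots> = poly (l (complex_of_real r)) z" using l[OF that] by simp
        finally show ?thesis .
      qed
      then show ?thesis unfolding e_def poly_box_star[OF a sa] by (rule agree)
    qed
    show "e r \<odot> e r = e r" if "r \<in> Re ` Z" for r
      unfolding e_def poly_box_mult[OF a, symmetric] by (rule agree) (simp add: l)
    show "e r \<odot> e r' = 0" if "r \<in> Re ` Z" "r' \<in> Re ` Z" "r \<noteq> r'" for r r'
      unfolding e_def poly_box_mult[OF a, symmetric] using that(3) by (intro vanish) (auto simp: l)
    have "(\<Sum>r\<in>Re ` Z. e r) = poly_box a (\<Sum>z\<in>Z. l z)"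
      using inj by (simp add: sum.reindex e_def poly_box_sum re)
    also have "\<dots> = poly_box a 1"
      by (rule agree) (simp add: poly_sum l finZ)
    finally show "(\<Sum>r\<in>Re ` Z. e r) = one" using a by (simp add: poly_box_one)
    have "(\<Sum>r\<in>Re ` Z. complex_of_real r \<cdot> e r) = poly_box a (\<Sum>z\<in>Z. smult z (l z))"
      using inj by (simp add: sum.reindex e_def poly_box_sum poly_box_smult re)
    also have "\<dots> = poly_box a [:0, 1:]"
      by (rule agree) (simp add: poly_sum l finZ if_distrib[of "\<lambda>x. _ * x"] cong: if_cong)
    finally show "(\<Sum>r\<in>Re ` Z. complex_of_real r \<cdot> e r) = a" using a by (simp add: poly_box_X)
  qed
  then show thesis by (rule that)
qed

text \<open>
  The functional calculus is defined from an arbitrary spectral decomposition. Decompositions may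
  contain zero projections, so two of them are compared through the products of their projections,
  which vanish unless the eigenvalues agree.
\<close>

lemma spectral_sum_unique:
  assumes a: "a \<in> V" and L: "spectral_decomposition A k a L e" and M: "spectral_decomposition A k a M g"
  shows "(\<Sum>l\<in>L. complex_of_real (f l) \<cdot> e l) = (\<Sum>m\<in>M. complex_of_real (f m) \<cdot> g m)"
proof -
  note L' = L[unfolded spectral_decomposition_def] and M' = M[unfolded spectral_decomposition_def]
  have eV [simp]: "\<And>l. l \<in> L \<Longrightarrow> e l \<in> V" and gV [simp]: "\<And>m. m \<in> M \<Longrightarrow> g m \<in> V" using L' M' by auto
  have ea: "e l \<odot> a = complex_of_real l \<cdot> e l" if "l \<in> L" for l
  proof -
    have "e l \<odot> a = e l \<odot> (\<Sum>i\<in>L. complex_of_real i \<cdot> e i)" using L' by simp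
    also have "\<dots> = (\<Sum>i\<in>L. complex_of_real i \<cdot> (e l \<odot> e i))"
      using that by (simp add: mult_sum_right mult_scale_right)
    also have "\<dots> = (\<Sum>i\<in>L. if i = l then complex_of_real l \<cdot> e l else 0)"
      using L' that by (intro sum.cong) auto
    finally show ?thesis using L' that by (simp add: sum.delta)
  qed
  have ag: "a \<odot> g m = complex_of_real m \<cdot> g m" if "m \<in> M" for m
  proof -
    have "a \<odot> g m = (\<Sum>i\<in>M. complex_of_real i \<cdot> g i) \<odot> g m" using M' by simp
    also have "\<dots> = (\<Sum>i\<in>M. complex_of_real i \<cdot> (g i \<odot> g m))"
      using that by (simp add: mult_sum_left mult_scale_left)
    also have "\<dots> = (\<Sum>i\<in>M. if i = m then complex_of_real m \<cdot> g m else 0)"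
      using M' that by (intro sum.cong) auto
    finally show ?thesis using M' that by (simp add: sum.delta)
  qed
  have zero: "e l \<odot> g m = 0" if "l \<in> L" "m \<in> M" "l \<noteq> m" for l m
  proof -
    have "complex_of_real l \<cdot> (e l \<odot> g m) = (e l \<odot> a) \<odot> g m"
      using that by (simp add: ea mult_scale_left)
    also have "\<dots> = e l \<odot> (a \<odot> g m)" using that a by (simp add: assoc)
    also have "\<dots> = complex_of_real m \<cdot> (e l \<odot> g m)" using that by (simp add: ag mult_scale_right)
    finally have "complex_of_real (l - m) \<cdot> (e l \<odot> g m) = 0" by (simp add: scale_left_diff_distrib)
    then show ?thesis using that(3) by simp
  qed
  have "(\<Sum>l\<in>L. complex_of_real (f l) \<cdot> e l) = (\<Sum>l\<in>L. complex_of_real (f l) \<cdot> (e l \<odot> (\<Sum>m\<in>M. g m)))"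
    using M' by simp
  also have "\<dots> = (\<Sum>l\<in>L. \<Sum>m\<in>M. complex_of_real (f l) \<cdot> (e l \<odot> g m))"
    by (simp add: mult_sum_right scale_sum_right)
  also have "\<dots> = (\<Sum>l\<in>L. \<Sum>m\<in>M. complex_of_real (f m) \<cdot> (e l \<odot> g m))"
    by (intro sum.cong refl) (metis zero scale_zero_right)
  also have "\<dots> = (\<Sum>m\<in>M. \<Sum>l\<in>L. complex_of_real (f m) \<cdot> (e l \<odot> g m))"
    by (rule sum.swap)
  also have "\<dots> = (\<Sum>m\<in>M. complex_of_real (f m) \<cdot> ((\<Sum>l\<in>L. e l) \<odot> g m))"
    by (simp add: mult_sum_left scale_sum_right)
  finally show ?thesis using L' by simp
qed

lemma fun_calc_eq:
  assumes "a \<in> V" and L: "spectral_decomposition A k a L e"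
  shows "fun_calc A k f a = (\<Sum>l\<in>L. complex_of_real (f l) \<cdot> e l)"
  unfolding fun_calc_def
proof (rule the_equality)
  show "\<exists>L' e'. spectral_decomposition A k a L' e'
     \<and> (\<Sum>l\<in>L. complex_of_real (f l) \<cdot> e l) = (\<Sum>l\<in>L'. complex_of_real (f l) \<cdot> e' l)"
    using L by blast
qed (use spectral_sum_unique assms in blast)

text \<open>
  The projections \<open>P i\<close> need not sum up to the unit; the remaining projection belongs to the
  eigenvalue \<open>0\<close>, and contributes nothing if \<open>f 0 = 0\<close>.
\<close>

lemma fun_calc_orthogonal:
  assumes I: "finite I" and P: "\<And>i. i \<in> I \<Longrightarrow> P i \<in> V \<and> (P i)\<^sup>\<dagger> = P i \<and> P i \<odot> P i = P i"
    and orth: "\<And>i j. i \<in> I \<Longrightarrow> j \<in> I \<Longrightarrow> i \<noteq> j \<Longrightarrow> P i \<odot> P j = 0"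
    and g: "inj_on g I" "0 \<notin> g ` I" and f0: "f 0 = 0"
  shows "fun_calc A k f (\<Sum>i\<in>I. complex_of_real (g i) \<cdot> P i) = (\<Sum>i\<in>I. complex_of_real (f (g i)) \<cdot> P i)"
proof -
  define Q where "Q = (\<Sum>i\<in>I. P i)"
  define e where "e l = (if l = 0 then one - Q else P (inv_into I g l))" for l
  have PV [simp]: "\<And>i. i \<in> I \<Longrightarrow> P i \<in> V" using P by simp
  have QV [simp]: "Q \<in> V" by (simp add: Q_def)
  have PQ: "P i \<odot> Q = P i" if "i \<in> I" for i
  proof -
    have "P i \<odot> Q = (\<Sum>j\<in>I. P i \<odot> P j)" using that by (simp add: Q_def mult_sum_right)
    also have "\<dots> = (\<Sum>j\<in>I. if j = i then P i else 0)"
      using P orth that by (intro sum.cong) auto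
    finally show ?thesis using I that by (simp add: sum.delta)
  qed
  have QP: "Q \<odot> P i = P i" if "i \<in> I" for i
  proof -
    have "Q \<odot> P i = (\<Sum>j\<in>I. P j \<odot> P i)" using that by (simp add: Q_def mult_sum_left)
    also have "\<dots> = (\<Sum>j\<in>I. if j = i then P i else 0)"
      using P orth that by (intro sum.cong) auto
    finally show ?thesis using I that by (simp add: sum.delta)
  qed
  have QQ: "Q \<odot> Q = Q"
  proof -
    have "Q \<odot> Q = (\<Sum>i\<in>I. P i) \<odot> Q" by (simp only: Q_def)
    also have "\<dots> = (\<Sum>i\<in>I. P i \<odot> Q)" by (simp add: mult_sum_left)
    also have "\<dots> = (\<Sum>i\<in>I. P i)" by (intro sum.cong refl PQ)
    finally show ?thesis by (simp only: Q_def)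
  qed
  have Qs: "Q\<^sup>\<dagger> = Q" using P by (simp add: Q_def star_sum)
  have eg: "e (g i) = P i" if "i \<in> I" for i
    using that g by (auto simp: e_def inv_into_f_f)
  have e0: "e 0 = one - Q" by (simp add: e_def)
  have gI: "l \<in> g ` I \<Longrightarrow> l \<noteq> 0" for l using g(2) by auto
  have sum_e: "(\<Sum>l\<in>insert 0 (g ` I). complex_of_real (h l) \<cdot> e l)
      = complex_of_real (h 0) \<cdot> (one - Q) + (\<Sum>i\<in>I. complex_of_real (h (g i)) \<cdot> P i)" for h
    using I g by (simp add: e0 sum.reindex eg)
  have "spectral_decomposition A k (\<Sum>i\<in>I. complex_of_real (g i) \<cdot> P i) (insert 0 (g ` I)) e"
    unfolding spectral_decomposition_def
  proof (intro conjI ballI impI)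
    show "finite (insert 0 (g ` I))" using I by simp
    fix l assume l: "l \<in> insert 0 (g ` I)"
    show "e l \<in> V" using l by (auto simp: eg e0)
    show "(e l)\<^sup>\<dagger> = e l" using l P by (auto simp: eg e0 star_diff Qs)
    show "e l \<odot> e l = e l" using l P by (auto simp: eg e0 mult_diff_left mult_diff_right QQ)
    fix m assume m: "m \<in> insert 0 (g ` I)" "l \<noteq> m"
    show "e l \<odot> e m = 0"
      using l m by (auto simp: eg e0 mult_diff_left mult_diff_right PQ QP intro!: orth)
  next
    show "(\<Sum>l\<in>insert 0 (g ` I). e l) = one"
      using sum_e[of "\<lambda>_. 1"] by (simp add: Q_def)
    show "(\<Sum>l\<in>insert 0 (g ` I). complex_of_real l \<cdot> e l) = (\<Sum>i\<in>I. complex_of_real (g i) \<cdot> P i)"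
      using sum_e[of "\<lambda>l. l"] by simp
  qed
  then have "fun_calc A k f (\<Sum>i\<in>I. complex_of_real (g i) \<cdot> P i) = (\<Sum>l\<in>insert 0 (g ` I). complex_of_real (f l) \<cdot> e l)"
    by (intro fun_calc_eq) simp_all
  then show ?thesis using sum_e[of f] f0 by simp
qed

text \<open>
  The singular value decomposition, indexed by the singular values themselves: the partial
  isometries \<open>u i\<close> have mutually orthogonal initial and final projections.
\<close>

definition svd :: "'a \<Rightarrow> real set \<Rightarrow> (real \<Rightarrow> 'a) \<Rightarrow> bool" where
  "svd x I u \<longleftrightarrow> finite I
     \<and> (\<forall>i \<in> I. 0 < i \<and> u i \<in> V \<and> u i \<noteq> 0 \<and> u i \<odot> (u i)\<^sup>\<dagger> \<odot> u i = u i)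
     \<and> (\<forall>i \<in> I. \<forall>j \<in> I. i \<noteq> j \<longrightarrow> (u i)\<^sup>\<dagger> \<odot> u j = 0 \<and> u i \<odot> (u j)\<^sup>\<dagger> = 0)
     \<and> x = (\<Sum>i\<in>I. complex_of_real i \<cdot> u i)"

lemma svd_star:
  assumes "svd x I u"
  shows "svd (x\<^sup>\<dagger>) I (\<lambda>i. (u i)\<^sup>\<dagger>)"
proof -
  have V: "u i \<in> V" if "i \<in> I" for i using assms that by (simp add: svd_def)
  have "(u i)\<^sup>\<dagger> \<odot> ((u i)\<^sup>\<dagger>)\<^sup>\<dagger> \<odot> (u i)\<^sup>\<dagger> = (u i)\<^sup>\<dagger>" if "i \<in> I" for i
  proof -
    have "(u i \<odot> (u i)\<^sup>\<dagger> \<odot> u i)\<^sup>\<dagger> = (u i)\<^sup>\<dagger>" using assms that by (simp add: svd_def)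
    then show ?thesis using V[OF that] by (simp add: star_mult assoc)
  qed
  moreover have "(u i)\<^sup>\<dagger> \<noteq> 0" if "i \<in> I" for i
    using assms that star_star[OF V[OF that]] by (metis star_zero svd_def)
  moreover have "x\<^sup>\<dagger> = (\<Sum>i\<in>I. complex_of_real i \<cdot> (u i)\<^sup>\<dagger>)"
    using assms by (simp add: svd_def star_sum star_scale)
  ultimately show ?thesis using assms V by (simp add: svd_def)
qed

text \<open>
  Each eigenvalue \<open>i\<^sup>2 > 0\<close> of \<open>x\<^sup>* x\<close>, with spectral projection \<open>e\<close>, contributes the partial isometry
  \<open>x e / i\<close>. On the kernel of \<open>x\<^sup>* x\<close> the element \<open>x\<close> vanishes.
\<close>

lemma svd_exists:
  assumes x: "x \<in> V"
  obtains I u where "svd x I u"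
proof -
  define a where "a = x\<^sup>\<dagger> \<odot> x"
  have a: "a \<in> V" "a\<^sup>\<dagger> = a" using x by (simp_all add: a_def star_mult)
  obtain L e where "spectral_decomposition A k a L e"
    using spectral_decomposition_exists[OF a] .
  note L = this[unfolded spectral_decomposition_def]
  have eV [simp]: "\<And>l. l \<in> L \<Longrightarrow> e l \<in> V" using L by simp
  have ae: "a \<odot> e l = complex_of_real l \<cdot> e l" if "l \<in> L" for l
  proof -
    have "a \<odot> e l = (\<Sum>i\<in>L. complex_of_real i \<cdot> e i) \<odot> e l" using L by simp
    also have "\<dots> = (\<Sum>i\<in>L. complex_of_real i \<cdot> (e i \<odot> e l))"
      using that by (simp add: mult_sum_left mult_scale_left)
    also have "\<dots> = (\<Sum>i\<in>L. if i = l then complex_of_real l \<cdot> e l else 0)"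
      using L that by (intro sum.cong) auto
    finally show ?thesis using L that by (simp add: sum.delta)
  qed
  have xe: "ip (x \<odot> e l) (x \<odot> e l) = of_real l * ip (e l) (e l)" if "l \<in> L" for l
  proof -
    have "ip (x \<odot> e l) (x \<odot> e l) = ip (e l) (a \<odot> e l)"
      using that x by (simp add: ip_mult_left a_def assoc)
    then show ?thesis using that by (simp add: ae ip_scale_right)
  qed
  have nonneg: "0 \<le> l" if "l \<in> L" "e l \<noteq> 0" for l
  proof -
    have "0 \<le> l * Re (ip (e l) (e l))" using ip_self_nonneg[of "x \<odot> e l"] that x by (simp add: xe)
    with ip_self_pos[of "e l"] that show ?thesis by (simp add: zero_le_mult_iff)
  qed
  define M where "M = {l \<in> L. e l \<noteq> 0 \<and> 0 < l}"
  have fin: "finite M" using L by (simp add: M_def)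
  define I where "I = sqrt ` M"
  define u where "u i = complex_of_real (1 / i) \<cdot> (x \<odot> e (i\<^sup>2))" for i
  have I: "0 < i" "i\<^sup>2 \<in> L" "e (i\<^sup>2) \<noteq> 0" if "i \<in> I" for i
    using that by (auto simp: I_def M_def)
  have uV [simp]: "u i \<in> V" if "i \<in> I" for i using I[OF that] x by (simp add: u_def)
  have uu: "(u i)\<^sup>\<dagger> \<odot> u j = (if i = j then e (i\<^sup>2) else 0)" if "i \<in> I" "j \<in> I" for i j
  proof -
    note ij = I[OF that(1)] I[OF that(2)]
    have "(u i)\<^sup>\<dagger> \<odot> u j = complex_of_real (1 / i * (1 / j)) \<cdot> ((e (i\<^sup>2))\<^sup>\<dagger> \<odot> (x\<^sup>\<dagger> \<odot> x \<odot> e (j\<^sup>2)))"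
      using ij x by (simp add: u_def star_scale star_mult mult_scale_left mult_scale_right assoc)
    also have "x\<^sup>\<dagger> \<odot> x \<odot> e (j\<^sup>2) = complex_of_real (j\<^sup>2) \<cdot> e (j\<^sup>2)"
      using ae[OF ij(5)] by (simp add: a_def)
    also have "(e (i\<^sup>2))\<^sup>\<dagger> \<odot> (complex_of_real (j\<^sup>2) \<cdot> e (j\<^sup>2)) = complex_of_real (j\<^sup>2) \<cdot> (e (i\<^sup>2) \<odot> e (j\<^sup>2))"
      using ij L by (simp add: mult_scale_right)
    finally have *: "(u i)\<^sup>\<dagger> \<odot> u j = complex_of_real (1 / i * (1 / j) * j\<^sup>2) \<cdot> (e (i\<^sup>2) \<odot> e (j\<^sup>2))"
      by simp
    show ?thesis
    proof (cases "i = j")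
      case True
      with * ij L show ?thesis by (simp add: power2_eq_square)
    next
      case False
      then have "i\<^sup>2 \<noteq> j\<^sup>2" using ij by (simp add: power2_eq_iff_nonneg)
      with * ij L False show ?thesis by simp
    qed
  qed
  have ue: "u i \<odot> e (i\<^sup>2) = u i" if "i \<in> I" for i
    using I[OF that] L x by (simp add: u_def mult_scale_left assoc)
  have uu': "u i \<odot> (u j)\<^sup>\<dagger> = 0" if "i \<in> I" "j \<in> I" "i \<noteq> j" for i j
  proof -
    note ij = I[OF that(1)] I[OF that(2)]
    have "i\<^sup>2 \<noteq> j\<^sup>2" using ij that by (simp add: power2_eq_iff_nonneg)
    have "u i \<odot> (u j)\<^sup>\<dagger> = (u i \<odot> e (i\<^sup>2)) \<odot> (u j \<odot> e (j\<^sup>2))\<^sup>\<dagger>" using that by (simp add: ue)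
    also have "\<dots> = u i \<odot> ((e (i\<^sup>2) \<odot> (e (j\<^sup>2))\<^sup>\<dagger>) \<odot> (u j)\<^sup>\<dagger>)"
      using that ij by (simp add: star_mult assoc)
    also have "e (i\<^sup>2) \<odot> (e (j\<^sup>2))\<^sup>\<dagger> = 0" using ij L \<open>i\<^sup>2 \<noteq> j\<^sup>2\<close> by simp
    finally show ?thesis using that by simp
  qed
  have "svd x I u"
    unfolding svd_def
  proof (intro conjI ballI impI)
    show "finite I" using fin by (simp add: I_def)
    fix i assume i: "i \<in> I"
    show "0 < i" "u i \<in> V" using i I by auto
    show "u i \<noteq> 0"
    proof
      assume "u i = 0"
      then have "(u i)\<^sup>\<dagger> \<odot> u i = 0" by simp
      with uu[OF i i] I[OF i] show False by simp
    qed
    show "u i \<odot> (u i)\<^sup>\<dagger> \<odot> u i = u i" using i uu[OF i i] by (simp add: assoc ue)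
    fix j assume j: "j \<in> I" "i \<noteq> j"
    show "(u i)\<^sup>\<dagger> \<odot> u j = 0" "u i \<odot> (u j)\<^sup>\<dagger> = 0" using uu uu' i j by auto
  next
    have "x = x \<odot> (\<Sum>l\<in>L. e l)" using L x by simp
    also have "\<dots> = (\<Sum>l\<in>L. x \<odot> e l)" using x by (simp add: mult_sum_right)
    also have "\<dots> = (\<Sum>l\<in>M. x \<odot> e l)"
    proof (rule sum.mono_neutral_right)
      show "\<forall>l\<in>L - M. x \<odot> e l = 0"
      proof
        fix l assume l: "l \<in> L - M"
        show "x \<odot> e l = 0"
        proof (cases "e l = 0")
          case False
          with l nonneg[of l] have "l = 0" by (auto simp: M_def)
          then have "ip (x \<odot> e l) (x \<odot> e l) = 0" using xe[of l] l by simp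
          then show ?thesis using ip_self_pos[of "x \<odot> e l"] l x by force
        qed (use x in simp)
      qed
    qed (use L in \<open>auto simp: M_def\<close>)
    also have "\<dots> = (\<Sum>i\<in>I. x \<odot> e (i\<^sup>2))"
      unfolding I_def by (subst sum.reindex) (auto simp: inj_on_def M_def)
    also have "\<dots> = (\<Sum>i\<in>I. complex_of_real i \<cdot> u i)"
      using I by (intro sum.cong refl) (simp add: u_def less_imp_neq[symmetric])
    finally show "x = (\<Sum>i\<in>I. complex_of_real i \<cdot> u i)" .
  qed
  then show thesis by (rule that)
qed

text \<open>
  The trace of the initial projection, if \<open>u\<close> is a partial isometry.
\<close>

definition weight :: "'a \<Rightarrow> real" where
  "weight u = Re (ip u u)"

context
  fixes x I u assumes svd: "svd x I u"
begin

lemma svd_closed [simp]: "i \<in> I \<Longrightarrow> u i \<in> V" and svd_pos: "i \<in> I \<Longrightarrow> 0 < i" and svd_finite: "finite I"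
  and svd_nonzero: "i \<in> I \<Longrightarrow> u i \<noteq> 0"
  using svd by (simp_all add: svd_def)

lemma svd_in_V [simp]: "x \<in> V"
  using svd by (auto simp: svd_def)

lemma svd_sum: "x = (\<Sum>i\<in>I. complex_of_real i \<cdot> u i)"
  using svd by (simp add: svd_def)

lemma svd_partial: "i \<in> I \<Longrightarrow> u i \<odot> ((u i)\<^sup>\<dagger> \<odot> u i) = u i"
  using svd by (simp add: svd_def flip: assoc)

lemma svd_orth: "i \<in> I \<Longrightarrow> j \<in> I \<Longrightarrow> i \<noteq> j \<Longrightarrow> (u i)\<^sup>\<dagger> \<odot> u j = 0"
  "i \<in> I \<Longrightarrow> j \<in> I \<Longrightarrow> i \<noteq> j \<Longrightarrow> u i \<odot> (u j)\<^sup>\<dagger> = 0"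
  using svd by (simp_all add: svd_def)

lemma weight_pos: "i \<in> I \<Longrightarrow> 0 < weight (u i)"
  using ip_self_pos svd_nonzero by (simp add: weight_def)

lemma ip_svd: "i \<in> I \<Longrightarrow> j \<in> I \<Longrightarrow> ip (u i) (u j) = (if i = j then of_real (weight (u i)) else 0)"
  using ip_self_real svd_orth by (auto simp: weight_def ip_def)

lemma norm2_svd: "(norm2 A k (\<Sum>i\<in>I. c i \<cdot> u i))\<^sup>2 = (\<Sum>i\<in>I. weight (u i) * (cmod (c i))\<^sup>2)"
proof -
  have "ip (\<Sum>i\<in>I. c i \<cdot> u i) (\<Sum>i\<in>I. c i \<cdot> u i) = (\<Sum>i\<in>I. \<Sum>j\<in>I. cnj (c i) * c j * ip (u i) (u j))"
    by (simp add: ip_sum_left ip_sum_right ip_scale_left ip_scale_right mult.assoc sum_distrib_left)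
      (rule trans[OF sum.swap], simp add: mult_ac)
  also have "\<dots> = (\<Sum>i\<in>I. \<Sum>j\<in>I. if j = i then of_real (weight (u i) * (cmod (c i))\<^sup>2) else 0)"
    by (intro sum.cong refl) (auto simp: ip_svd complex_norm_square mult_ac simp del: of_real_power)
  also have "\<dots> = of_real (\<Sum>i\<in>I. weight (u i) * (cmod (c i))\<^sup>2)"
    by (simp add: svd_finite sum.delta)
  finally show ?thesis by (subst norm2_power2) simp_all
qed

lemma support_projection:
  assumes "i \<in> I"
  shows "(u i)\<^sup>\<dagger> \<odot> u i \<in> V" "((u i)\<^sup>\<dagger> \<odot> u i)\<^sup>\<dagger> = (u i)\<^sup>\<dagger> \<odot> u i"
    "(u i)\<^sup>\<dagger> \<odot> u i \<odot> ((u i)\<^sup>\<dagger> \<odot> u i) = (u i)\<^sup>\<dagger> \<odot> u i"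
  using assms by (simp_all add: star_mult assoc svd_partial)

lemma support_orth:
  assumes "i \<in> I" "j \<in> I" "i \<noteq> j"
  shows "(u i)\<^sup>\<dagger> \<odot> u i \<odot> ((u j)\<^sup>\<dagger> \<odot> u j) = 0"
proof -
  have "(u i)\<^sup>\<dagger> \<odot> u i \<odot> ((u j)\<^sup>\<dagger> \<odot> u j) = (u i)\<^sup>\<dagger> \<odot> ((u i \<odot> (u j)\<^sup>\<dagger>) \<odot> u j)"
    using assms by (simp add: assoc)
  then show ?thesis using svd_orth(2)[OF assms] assms by simp
qed

lemma square_svd: "x\<^sup>\<dagger> \<odot> x = (\<Sum>i\<in>I. complex_of_real (i\<^sup>2) \<cdot> ((u i)\<^sup>\<dagger> \<odot> u i))"
proof -
  have "x\<^sup>\<dagger> \<odot> x = (\<Sum>i\<in>I. \<Sum>j\<in>I. complex_of_real (i * j) \<cdot> ((u i)\<^sup>\<dagger> \<odot> u j))"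
    by (simp add: svd_sum star_sum star_scale mult_sum_left mult_sum_right mult_scale_left mult_scale_right scale_sum_right)
      (rule trans[OF sum.swap], simp add: mult.commute)
  also have "\<dots> = (\<Sum>i\<in>I. \<Sum>j\<in>I. if j = i then complex_of_real (i\<^sup>2) \<cdot> ((u i)\<^sup>\<dagger> \<odot> u i) else 0)"
    by (intro sum.cong refl) (auto simp: svd_orth power2_eq_square)
  finally show ?thesis by (simp add: svd_finite sum.delta)
qed

lemma abs_svd: "abs_elt A k x = (\<Sum>i\<in>I. complex_of_real i \<cdot> ((u i)\<^sup>\<dagger> \<odot> u i))"
proof -
  have "abs_elt A k x = fun_calc A k sqrt (\<Sum>i\<in>I. complex_of_real (i\<^sup>2) \<cdot> ((u i)\<^sup>\<dagger> \<odot> u i))"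
    by (simp add: abs_elt_def square_svd)
  also have "\<dots> = (\<Sum>i\<in>I. complex_of_real (sqrt (i\<^sup>2)) \<cdot> ((u i)\<^sup>\<dagger> \<odot> u i))"
  proof (rule fun_calc_orthogonal)
    show "inj_on power2 I" by (intro inj_onI) (simp add: power2_eq_iff_nonneg svd_pos less_imp_le)
    show "0 \<notin> power2 ` I" using svd_pos by force
  qed (use svd_finite support_projection support_orth in auto)
  also have "\<dots> = (\<Sum>i\<in>I. complex_of_real i \<cdot> ((u i)\<^sup>\<dagger> \<odot> u i))"
    by (intro sum.cong refl) (simp add: svd_pos less_imp_le)
  finally show ?thesis .
qed

text \<open>
  Because \<open>|x|\<close> is the sum of the initial projections with the singular values as coefficients.
\<close>

lemma p_norm_svd_finite:
  assumes "0 < p"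
  shows "p_norm A k (ereal p) x = (\<Sum>i\<in>I. weight (u i) * i powr p) powr (1 / p)"
proof -
  have "fun_calc A k (\<lambda>l. l powr p) (abs_elt A k x) = (\<Sum>i\<in>I. complex_of_real (i powr p) \<cdot> ((u i)\<^sup>\<dagger> \<odot> u i))"
    unfolding abs_svd
    by (rule fun_calc_orthogonal[where g = "\<lambda>i. i"])
      (use svd_finite support_projection support_orth in \<open>auto dest: svd_pos\<close>)
  moreover have "tr A k (\<Sum>i\<in>I. complex_of_real (i powr p) \<cdot> ((u i)\<^sup>\<dagger> \<odot> u i))
      = (\<Sum>i\<in>I. complex_of_real (i powr p) * ip (u i) (u i))"
    by (simp add: tr_sum tr_scale ip_def)
  ultimately show ?thesis
    by (simp add: p_norm_def weight_def mult.commute)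
qed

lemma total_support:
  shows "(\<Sum>i\<in>I. (u i)\<^sup>\<dagger> \<odot> u i) \<in> V"
    and "(\<Sum>i\<in>I. (u i)\<^sup>\<dagger> \<odot> u i)\<^sup>\<dagger> = (\<Sum>i\<in>I. (u i)\<^sup>\<dagger> \<odot> u i)"
    and "(\<Sum>i\<in>I. (u i)\<^sup>\<dagger> \<odot> u i) \<odot> (\<Sum>i\<in>I. (u i)\<^sup>\<dagger> \<odot> u i) = (\<Sum>i\<in>I. (u i)\<^sup>\<dagger> \<odot> u i)"
proof -
  let ?Q = "\<Sum>i\<in>I. (u i)\<^sup>\<dagger> \<odot> u i"
  show "?Q \<in> V" "?Q\<^sup>\<dagger> = ?Q" by (simp_all add: star_sum support_projection)
  have "?Q \<odot> ?Q = (\<Sum>i\<in>I. \<Sum>j\<in>I. (u i)\<^sup>\<dagger> \<odot> u i \<odot> ((u j)\<^sup>\<dagger> \<odot> u j))"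
    by (simp add: mult_sum_left mult_sum_right) (rule sum.swap)
  also have "\<dots> = (\<Sum>i\<in>I. \<Sum>j\<in>I. if j = i then (u i)\<^sup>\<dagger> \<odot> u i else 0)"
    by (intro sum.cong refl) (auto simp: support_orth support_projection)
  finally show "?Q \<odot> ?Q = ?Q" by (simp add: svd_finite sum.delta)
qed

text \<open>
  The initial projections are orthogonal, so their sum is a projection and at most the unit.
\<close>

lemma sum_weight_le: "(\<Sum>i\<in>I. weight (u i)) \<le> Re (tr A k one)"
proof -
  define Q where "Q = (\<Sum>i\<in>I. (u i)\<^sup>\<dagger> \<odot> u i)"
  have Q: "Q \<in> V" "Q\<^sup>\<dagger> = Q" and QQ: "Q \<odot> Q = Q" by (simp_all only: Q_def total_support)
  have "0 \<le> Re (ip (one - Q) (one - Q))" using Q by (intro ip_self_nonneg) simp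
  also have "ip (one - Q) (one - Q) = tr A k (one - Q)"
    using Q QQ by (simp add: ip_def star_diff mult_diff_left mult_diff_right)
  also have "\<dots> = tr A k one - (\<Sum>i\<in>I. ip (u i) (u i))"
    using Q by (simp add: tr_diff) (simp add: Q_def tr_sum ip_def)
  finally show ?thesis by (simp add: weight_def)
qed

lemma norm2_mult_svd_le:
  assumes y: "y \<in> V" and M: "\<And>i. i \<in> I \<Longrightarrow> i \<le> M" "0 \<le> M"
  shows "norm2 A k (x \<odot> y) \<le> M * norm2 A k y"
proof -
  define Q where "Q = (\<Sum>i\<in>I. (u i)\<^sup>\<dagger> \<odot> u i)"
  have Q: "Q \<in> V" "Q\<^sup>\<dagger> = Q" and QQ: "Q \<odot> Q = Q" by (simp_all only: Q_def total_support)
  have part: "ip y (((u i)\<^sup>\<dagger> \<odot> u i) \<odot> y) = ip (u i \<odot> y) (u i \<odot> y)" if "i \<in> I" for i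
    using that y by (simp add: ip_mult_left assoc)
  have "0 \<le> Re (ip ((one - Q) \<odot> y) ((one - Q) \<odot> y))" using Q y by (intro ip_self_nonneg) simp
  also have "ip ((one - Q) \<odot> y) ((one - Q) \<odot> y) = ip y (((one - Q) \<odot> (one - Q)) \<odot> y)"
    using Q y by (simp add: ip_mult_left star_diff assoc)
  also have "(one - Q) \<odot> (one - Q) = one - Q"
    using Q QQ by (simp add: mult_diff_left mult_diff_right)
  also have "ip y ((one - Q) \<odot> y) = ip y y - (\<Sum>i\<in>I. ip (u i \<odot> y) (u i \<odot> y))"
    using Q y by (simp add: mult_diff_left ip_diff_right) (simp add: Q_def mult_sum_left ip_sum_right part)
  finally have bound: "(\<Sum>i\<in>I. Re (ip (u i \<odot> y) (u i \<odot> y))) \<le> Re (ip y y)" by simp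
  have "ip (x \<odot> y) (x \<odot> y) = ip y ((x\<^sup>\<dagger> \<odot> x) \<odot> y)" using y by (simp add: ip_mult_left assoc)
  also have "\<dots> = (\<Sum>i\<in>I. of_real (i\<^sup>2) * ip (u i \<odot> y) (u i \<odot> y))"
    unfolding square_svd using y by (simp add: mult_sum_left mult_scale_left ip_sum_right ip_scale_right part)
  finally have "Re (ip (x \<odot> y) (x \<odot> y)) = (\<Sum>i\<in>I. i\<^sup>2 * Re (ip (u i \<odot> y) (u i \<odot> y)))" by simp
  also have "\<dots> \<le> (\<Sum>i\<in>I. M\<^sup>2 * Re (ip (u i \<odot> y) (u i \<odot> y)))"
    using M svd_pos y ip_self_nonneg by (intro sum_mono mult_right_mono power_mono) (auto intro: less_imp_le)
  also have "\<dots> \<le> M\<^sup>2 * Re (ip y y)"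
    unfolding sum_distrib_left[symmetric] using bound by (intro mult_left_mono) auto
  finally have "(norm2 A k (x \<odot> y))\<^sup>2 \<le> (M * norm2 A k y)\<^sup>2"
    using y by (simp add: norm2_power2 power_mult_distrib)
  then show ?thesis by (rule power2_le_imp_le) (simp add: M(2) norm2_nonneg y)
qed

text \<open>
  The bound from below is witnessed by the normalised initial projection of \<open>u i\<close>.
\<close>

lemma op_norm_bounds:
  shows "i \<in> I \<Longrightarrow> i \<le> op_norm A k x"
    and "(\<And>i. i \<in> I \<Longrightarrow> i \<le> M) \<Longrightarrow> 0 \<le> M \<Longrightarrow> op_norm A k x \<le> M"
proof -
  let ?Y = "{y \<in> V. norm2 A k y \<le> 1}"
  have le: "norm2 A k (x \<odot> y) \<le> M" if "y \<in> ?Y" "\<And>i. i \<in> I \<Longrightarrow> i \<le> M" "0 \<le> M" for y M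
  proof -
    have "norm2 A k (x \<odot> y) \<le> M * norm2 A k y" using norm2_mult_svd_le that by simp
    also have "\<dots> \<le> M" using that by (simp add: mult_left_le)
    finally show ?thesis .
  qed
  show "op_norm A k x \<le> M" if "\<And>i. i \<in> I \<Longrightarrow> i \<le> M" "0 \<le> M"
    unfolding op_norm_def
  proof (rule cSUP_least)
    have "0 \<in> ?Y" by simp
    then show "?Y \<noteq> {}" by blast
  qed (use le that in blast)
  show "i \<le> op_norm A k x" if i: "i \<in> I"
  proof -
    define e where "e = (u i)\<^sup>\<dagger> \<odot> u i"
    define c where "c = complex_of_real (1 / sqrt (weight (u i)))"
    have w: "0 < weight (u i)" by (rule weight_pos[OF i])
    have e: "e \<in> V" "e\<^sup>\<dagger> = e" "e \<odot> e = e" using support_projection[OF i] by (simp_all add: e_def)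
    have "ip e e = of_real (weight (u i))"
      using e ip_svd[OF i i] by (simp add: ip_def) (simp add: e_def)
    then have "(norm2 A k (c \<cdot> e))\<^sup>2 = 1"
      using e w by (simp add: norm2_power2 ip_scale_left ip_scale_right c_def real_sqrt_mult_self[symmetric] del: real_sqrt_mult_self)
         (simp add: divide_simps)
    then have cY: "c \<cdot> e \<in> ?Y" using norm2_nonneg[of "c \<cdot> e"] e by (simp add: power2_eq_1_iff)
    have "x \<odot> e = (\<Sum>j\<in>I. complex_of_real j \<cdot> (u j \<odot> (u i)\<^sup>\<dagger> \<odot> u i))"
      using i unfolding e_def by (subst svd_sum) (simp add: mult_sum_left mult_scale_left assoc)
    also have "\<dots> = (\<Sum>j\<in>I. if j = i then complex_of_real i \<cdot> u i else 0)"
    proof (intro sum.cong refl)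
      fix j assume j: "j \<in> I"
      have "u i \<odot> (u i)\<^sup>\<dagger> \<odot> u i = u i" using i by (simp add: assoc svd_partial)
      then show "complex_of_real j \<cdot> (u j \<odot> (u i)\<^sup>\<dagger> \<odot> u i) = (if j = i then complex_of_real i \<cdot> u i else 0)"
        using svd_orth(2)[OF j i] i by auto
    qed
    finally have xe: "x \<odot> e = complex_of_real i \<cdot> u i" using i by (simp add: svd_finite sum.delta)
    have "(norm2 A k (x \<odot> (c \<cdot> e)))\<^sup>2 = i\<^sup>2"
      using e w i ip_svd[OF i i]
      by (simp add: norm2_power2 mult_scale_right xe ip_scale_left ip_scale_right c_def)
         (simp add: divide_simps power2_eq_square)
    then have "norm2 A k (x \<odot> (c \<cdot> e)) = i"
      using norm2_nonneg[of "x \<odot> (c \<cdot> e)"] e svd_pos[OF i] by (simp add: power2_eq_iff_nonneg)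
    moreover have "bdd_above ((\<lambda>y. norm2 A k (x \<odot> y)) ` ?Y)"
    proof (rule bdd_aboveI2)
      fix y assume y: "y \<in> ?Y"
      have nonneg: "j \<in> I \<Longrightarrow> 0 \<le> j" for j using svd_pos less_imp_le by blast
      show "norm2 A k (x \<odot> y) \<le> (\<Sum>j\<in>I. j)"
      proof (rule le[OF y])
        show "0 \<le> (\<Sum>j\<in>I. j)" by (rule sum_nonneg) (rule nonneg)
        show "j \<le> (\<Sum>j\<in>I. j)" if "j \<in> I" for j
          by (rule member_le_sum[OF that]) (simp_all add: nonneg svd_finite)
      qed
    qed
    from cSUP_upper[OF cY this] have "norm2 A k (x \<odot> (c \<cdot> e)) \<le> op_norm A k x"
      unfolding op_norm_def .
    ultimately show ?thesis by simp
  qed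
qed

end

end



section \<open>Interpolation\<close>

text \<open>
  The maximum principle is applied on a rectangle to \<open>f\<close> multiplied by \<open>exp (\<epsilon> (z\<^sup>2 - 1))\<close>. That factor has
  modulus at most \<open>1\<close> on the strip and decays for large imaginary part, so a sufficiently high
  rectangle has no larger values on its short sides; then \<open>\<epsilon>\<close> tends to \<open>0\<close>.
\<close>

lemma three_lines:
  fixes f :: "complex \<Rightarrow> complex"
  assumes hol: "f holomorphic_on UNIV"
    and bound: "\<And>z. 0 \<le> Re z \<Longrightarrow> Re z \<le> 1 \<Longrightarrow> cmod (f z) \<le> B"
    and left: "\<And>z. Re z = 0 \<Longrightarrow> cmod (f z) \<le> 1"
    and right: "\<And>z. Re z = 1 \<Longrightarrow> cmod (f z) \<le> 1"
    and z: "0 \<le> Re z" "Re z \<le> 1"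
  shows "cmod (f z) \<le> 1"
proof -
  have damped: "cmod (f z) * exp (\<epsilon> * ((Re z)\<^sup>2 - (Im z)\<^sup>2 - 1)) \<le> 1" if \<epsilon>: "0 < \<epsilon>" for \<epsilon> :: real
  proof -
    define g where "g w = f w * exp (of_real \<epsilon> * (w\<^sup>2 - 1))" for w
    have norm_g: "cmod (g w) = cmod (f w) * exp (\<epsilon> * ((Re w)\<^sup>2 - (Im w)\<^sup>2 - 1))" for w
      by (simp add: g_def norm_mult norm_exp_eq_Re power2_eq_square)
    (* At this height the damping factor is at most exp (- |B|), which beats the bound B. *)
    define R where "R = max (\<bar>Im z\<bar> + 1) (sqrt (\<bar>B\<bar> / \<epsilon>))"
    have R: "\<bar>Im z\<bar> < R" "\<bar>B\<bar> / \<epsilon> \<le> R\<^sup>2"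
    proof -
      show "\<bar>Im z\<bar> < R" by (simp add: R_def less_max_iff_disj)
      have "sqrt (\<bar>B\<bar> / \<epsilon>) \<le> R" by (simp add: R_def)
      then have "(sqrt (\<bar>B\<bar> / \<epsilon>))\<^sup>2 \<le> R\<^sup>2" using \<epsilon> by (intro power_mono) auto
      then show "\<bar>B\<bar> / \<epsilon> \<le> R\<^sup>2" using \<epsilon> by simp
    qed
    define S where "S = cbox (Complex 0 (- R)) (Complex 1 R)"
    have S_iff: "w \<in> S \<longleftrightarrow> 0 \<le> Re w \<and> Re w \<le> 1 \<and> - R \<le> Im w \<and> Im w \<le> R" for w
      by (auto simp: S_def in_cbox_complex_iff)
    have front: "cmod (g w) \<le> 1" if w: "w \<in> frontier S" for w
    proof -
      have "w \<in> S" using w by (simp add: S_def frontier_cbox)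
      then have wS: "0 \<le> Re w" "Re w \<le> 1" by (auto simp: S_iff)
      have "w \<notin> box (Complex 0 (- R)) (Complex 1 R)" using w by (simp add: S_def frontier_cbox)
      with \<open>w \<in> S\<close> have "Re w = 0 \<or> Re w = 1 \<or> Im w = - R \<or> Im w = R"
        by (auto simp: S_iff in_box_complex_iff)
      then consider "Re w = 0" | "Re w = 1" | "(Im w)\<^sup>2 = R\<^sup>2" by auto
      then show ?thesis
      proof cases
        case 1
        then have "cmod (f w) \<le> 1" by (rule left)
        moreover have "exp (\<epsilon> * ((Re w)\<^sup>2 - (Im w)\<^sup>2 - 1)) \<le> 1" using 1 \<epsilon> order_trans[of "- 1" 0 "(Im w)\<^sup>2"] by (simp add: mult_le_0_iff)
        ultimately show ?thesis unfolding norm_g by (intro mult_le_one) auto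
      next
        case 2
        then have "cmod (f w) \<le> 1" by (rule right)
        moreover have "exp (\<epsilon> * ((Re w)\<^sup>2 - (Im w)\<^sup>2 - 1)) \<le> 1" using 2 \<epsilon> by (simp add: mult_le_0_iff)
        ultimately show ?thesis unfolding norm_g by (intro mult_le_one) auto
      next
        case 3
        have "(Re w)\<^sup>2 \<le> 1" using wS by (simp add: power_le_one)
        then have "\<epsilon> * ((Re w)\<^sup>2 - (Im w)\<^sup>2 - 1) \<le> \<epsilon> * (- R\<^sup>2)"
          using 3 \<epsilon> by (intro mult_left_mono) auto
        also have "\<dots> \<le> - \<bar>B\<bar>" using R(2) \<epsilon> by (simp add: divide_simps mult.commute)
        finally have "exp (\<epsilon> * ((Re w)\<^sup>2 - (Im w)\<^sup>2 - 1)) \<le> exp (- \<bar>B\<bar>)" by simp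
        moreover have "cmod (f w) \<le> \<bar>B\<bar>" using bound[OF wS] by simp
        ultimately have "cmod (g w) \<le> \<bar>B\<bar> * exp (- \<bar>B\<bar>)" unfolding norm_g by (intro mult_mono) auto
        also have "\<bar>B\<bar> \<le> exp \<bar>B\<bar>" using exp_ge_add_one_self[of "\<bar>B\<bar>"] by linarith
        then have "\<bar>B\<bar> * exp (- \<bar>B\<bar>) \<le> 1" by (simp add: exp_minus divide_simps)
        finally show ?thesis .
      qed
    qed
    have "cmod (g z) \<le> 1"
    proof (rule maximum_modulus_frontier[where f = g and S = S])
      have g_hol: "g holomorphic_on UNIV" unfolding g_def using hol by (intro holomorphic_intros)
      then show "g holomorphic_on interior S" by (rule holomorphic_on_subset) simp
      show "continuous_on (closure S) g"
        using holomorphic_on_imp_continuous_on[OF g_hol] by (rule continuous_on_subset) simp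
      show "bounded S" by (simp add: S_def bounded_cbox)
      show "z \<in> S" using z R(1) by (auto simp: S_iff)
    qed (rule front)
    then show ?thesis by (simp add: norm_g)
  qed
  define c where "c = (Re z)\<^sup>2 - (Im z)\<^sup>2 - 1"
  have "((\<lambda>\<epsilon>. cmod (f z) * exp (\<epsilon> * c)) \<longlongrightarrow> cmod (f z) * exp (0 * c)) (at_right 0)"
    by (intro tendsto_intros)
  moreover have "\<forall>\<^sub>F \<epsilon> in at_right 0. cmod (f z) * exp (\<epsilon> * c) \<le> 1"
    using damped unfolding c_def by (auto simp: eventually_at_filter)
  ultimately have "cmod (f z) * exp (0 * c) \<le> 1"
    by (rule tendsto_upperbound) simp
  then show ?thesis by simp
qed

text \<open>
  Interpolation between an \<open>l\<^sup>1\<close> bound and an \<open>l\<^sup>2\<close> bound of a bilinear form, at a pair of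
  positive vectors that are normalised in weighted \<open>l\<^sup>p\<close>. Replacing \<open>a i\<close> by the powers
  \<open>a i powr (p (1 - z / 2))\<close>, and likewise \<open>b j\<close>, gives an entire function of \<open>z\<close>. At
  \<open>Re z = 0\<close> the powers are normalised in \<open>l\<^sup>1\<close>, at \<open>Re z = 1\<close> in \<open>l\<^sup>2\<close>, and at \<open>z = 2 - 2 / p\<close>
  the exponent is \<open>1\<close>.
\<close>

lemma Riesz_Thorin_bilinear:
  fixes M :: "'i \<Rightarrow> 'j \<Rightarrow> complex" and w a :: "'i \<Rightarrow> real" and v b :: "'j \<Rightarrow> real"
  assumes fin: "finite I" "finite J" and D: "0 < D" and p: "1 < p" "p < 2"
    and a: "\<And>i. i \<in> I \<Longrightarrow> 0 < a i" and b: "\<And>j. j \<in> J \<Longrightarrow> 0 < b j"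
    and w: "\<And>i. i \<in> I \<Longrightarrow> 0 \<le> w i" and v: "\<And>j. j \<in> J \<Longrightarrow> 0 \<le> v j"
    and norm_a: "(\<Sum>i\<in>I. w i * a i powr p) = 1" and norm_b: "(\<Sum>j\<in>J. v j * b j powr p) = 1"
    and L1: "\<And>i j. i \<in> I \<Longrightarrow> j \<in> J \<Longrightarrow> cmod (M i j) \<le> D * w i * v j"
    and L2: "\<And>c d. cmod (\<Sum>i\<in>I. \<Sum>j\<in>J. c i * d j * M i j)
        \<le> sqrt (\<Sum>i\<in>I. w i * (cmod (c i))\<^sup>2) * sqrt (\<Sum>j\<in>J. v j * (cmod (d j))\<^sup>2)"
  shows "cmod (\<Sum>i\<in>I. \<Sum>j\<in>J. of_real (a i) * of_real (b j) * M i j) \<le> D powr (2 / p - 1)"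
proof -
  (* The complex power x powr (p (1 - z / 2)), and the form divided by D powr (1 - z). *)
  define \<phi> where "\<phi> x z = exp (of_real (p * ln x) * (1 - z / 2))" for x :: real and z :: complex
  define f where "f z = exp (of_real (ln D) * (z - 1)) * (\<Sum>i\<in>I. \<Sum>j\<in>J. \<phi> (a i) z * \<phi> (b j) z * M i j)" for z
  have norm_\<phi>: "cmod (\<phi> x z) = x powr (p * (1 - Re z / 2))" if "0 < x" for x z
    using that by (simp add: \<phi>_def norm_exp_eq_Re powr_def mult_ac)
  have norm_D: "cmod (exp (of_real (ln D) * (z - 1))) = D powr (Re z - 1)" for z
    using D by (simp add: norm_exp_eq_Re powr_def mult_ac)
  have hol: "f holomorphic_on UNIV"
    unfolding f_def \<phi>_def by (intro holomorphic_intros) auto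
  have bound: "cmod (f z) \<le> (max 1 (1 / D)) * (\<Sum>i\<in>I. \<Sum>j\<in>J. max 1 (a i) powr p * max 1 (b j) powr p * cmod (M i j))"
    if z: "0 \<le> Re z" "Re z \<le> 1" for z
  proof -
    have \<phi>_le: "cmod (\<phi> x z) \<le> max 1 x powr p" if "0 < x" for x
    proof -
      have "x powr (p * (1 - Re z / 2)) \<le> max 1 x powr (p * (1 - Re z / 2))"
        using that p z by (intro powr_mono2) auto
      also have "\<dots> \<le> max 1 x powr p" using p z by (intro powr_mono) (auto simp: mult_le_cancel_left1)
      finally show ?thesis using that by (simp add: norm_\<phi>)
    qed
    have "D powr (Re z - 1) \<le> max 1 (1 / D)"
    proof (cases "1 \<le> D")
      case True
      then have "D powr (Re z - 1) \<le> D powr 0" using z by (intro powr_mono) auto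
      then show ?thesis using True by simp
    next
      case False
      then have "D powr (Re z - 1) \<le> D powr (- 1)" using z D by (intro powr_mono') auto
      then show ?thesis using D by (simp add: powr_minus_divide)
    qed
    moreover have "cmod (\<Sum>i\<in>I. \<Sum>j\<in>J. \<phi> (a i) z * \<phi> (b j) z * M i j)
        \<le> (\<Sum>i\<in>I. \<Sum>j\<in>J. max 1 (a i) powr p * max 1 (b j) powr p * cmod (M i j))"
      using \<phi>_le a b
      by (intro order_trans[OF norm_sum] sum_mono) (auto simp: norm_mult intro!: mult_mono order_trans[OF norm_sum] sum_mono)
    ultimately show ?thesis
      unfolding f_def norm_mult norm_D by (intro mult_mono) auto
  qed
  have left: "cmod (f z) \<le> 1" if z: "Re z = 0" for z
  proof -
    have "cmod (\<Sum>i\<in>I. \<Sum>j\<in>J. \<phi> (a i) z * \<phi> (b j) z * M i j)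
        \<le> (\<Sum>i\<in>I. \<Sum>j\<in>J. D * ((w i * a i powr p) * (v j * b j powr p)))"
    proof (intro order_trans[OF norm_sum] sum_mono)
      fix i j assume i: "i \<in> I" and j: "j \<in> J"
      have "cmod (\<phi> (a i) z * \<phi> (b j) z * M i j) = a i powr p * b j powr p * cmod (M i j)"
        using a[OF i] b[OF j] z by (simp add: norm_mult norm_\<phi>)
      also have "\<dots> \<le> a i powr p * b j powr p * (D * w i * v j)"
        using L1[OF i j] by (intro mult_left_mono) auto
      finally show "cmod (\<phi> (a i) z * \<phi> (b j) z * M i j) \<le> D * ((w i * a i powr p) * (v j * b j powr p))"
        by (simp add: mult_ac)
    qed
    also have "\<dots> = D * ((\<Sum>i\<in>I. w i * a i powr p) * (\<Sum>j\<in>J. v j * b j powr p))"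
      unfolding sum_product by (simp only: sum_distrib_left)
    finally have "cmod (\<Sum>i\<in>I. \<Sum>j\<in>J. \<phi> (a i) z * \<phi> (b j) z * M i j) \<le> D"
      by (simp add: norm_a norm_b)
    moreover have Dm: "D powr (Re z - 1) = 1 / D" using z D by (simp add: powr_minus_divide)
    ultimately show ?thesis unfolding f_def norm_mult norm_D Dm using D by (simp add: divide_simps)
  qed
  have right: "cmod (f z) \<le> 1" if z: "Re z = 1" for z
  proof -
    have sq: "(x powr (p / 2))\<^sup>2 = x powr p" for x :: real
      by (simp add: power2_eq_square powr_add[symmetric])
    have "(\<Sum>i\<in>I. w i * (cmod (\<phi> (a i) z))\<^sup>2) = (\<Sum>i\<in>I. w i * a i powr p)"
      using a z by (intro sum.cong refl) (simp add: norm_\<phi> sq)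
    moreover have "(\<Sum>j\<in>J. v j * (cmod (\<phi> (b j) z))\<^sup>2) = (\<Sum>j\<in>J. v j * b j powr p)"
      using b z by (intro sum.cong refl) (simp add: norm_\<phi> sq)
    ultimately show ?thesis
      unfolding f_def norm_mult norm_D
      using L2[of "\<lambda>i. \<phi> (a i) z" "\<lambda>j. \<phi> (b j) z"] z D norm_a norm_b by simp
  qed
  (* The point of the strip where the complex powers of a and b are a and b themselves. *)
  define \<theta> where "\<theta> = 2 - 2 / p"
  have \<theta>: "0 \<le> \<theta>" "\<theta> \<le> 1" "p * (1 - \<theta> / 2) = 1" using p by (auto simp: \<theta>_def field_simps)
  have "cmod (f (of_real \<theta>)) \<le> 1"
    by (rule three_lines[OF hol bound left right]) (use \<theta> in auto)
  moreover have "\<phi> x (of_real \<theta>) = of_real x" if "0 < x" for x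
  proof -
    have "\<phi> x (of_real \<theta>) = exp (of_real (ln x * (p * (1 - \<theta> / 2))))"
      by (simp add: \<phi>_def mult_ac)
    then show ?thesis using that \<theta>(3) by (simp add: exp_of_real)
  qed
  then have "(\<Sum>i\<in>I. \<Sum>j\<in>J. \<phi> (a i) (of_real \<theta>) * \<phi> (b j) (of_real \<theta>) * M i j)
      = (\<Sum>i\<in>I. \<Sum>j\<in>J. of_real (a i) * of_real (b j) * M i j)"
    using a b by (intro sum.cong refl) auto
  ultimately have small: "D powr (\<theta> - 1) * cmod (\<Sum>i\<in>I. \<Sum>j\<in>J. of_real (a i) * of_real (b j) * M i j) \<le> 1"
    (is "_ * ?N \<le> 1") unfolding f_def norm_mult norm_D by simp
  have "D powr (2 / p - 1) * D powr (\<theta> - 1) = 1"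
    using D by (simp add: \<theta>_def flip: powr_add)
  then have "?N = D powr (2 / p - 1) * (D powr (\<theta> - 1) * ?N)" by (simp flip: mult.assoc)
  also have "\<dots> \<le> D powr (2 / p - 1) * 1" using small by (intro mult_left_mono) auto
  finally show ?thesis by simp
qed



section \<open>Evaluating tables in an irreducible planar algebra\<close>

text \<open>
  Input discs are numbered from \<open>0\<close>, so the inputs of a tangle with a table can be given as a list.
\<close>

definition ev :: "'a planar_structure \<Rightarrow> tangle \<Rightarrow> 'a list \<Rightarrow> 'a" where
  "ev A T xs = act A T (nth xs)"

definition input_colours :: "bool \<Rightarrow> table \<Rightarrow> colour list" where
  "input_colours s = (\<lambda>(P, R, S).
     map2 (\<lambda>ps rs. (length ps div 2, odd (rs ! 0) \<noteq> s)) (tl P) (tl R))"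

definition output_colour :: "bool \<Rightarrow> table \<Rightarrow> colour" where
  "output_colour s = (\<lambda>(P, R, S). (length (P ! 0) div 2, odd (R ! 0 ! 0) \<noteq> s))"

definition fits :: "'a planar_structure \<Rightarrow> bool \<Rightarrow> table \<Rightarrow> 'a list \<Rightarrow> bool" where
  "fits A s t xs \<longleftrightarrow> list_all2 (\<lambda>x k. x \<in> box_space A k) xs (input_colours s t)"

lemma drawn_discs:
  assumes "drawn T s t"
  shows "discs T = {..<length (fst t) - 1}" and "discs T = {..<length (input_colours s t)}"
    and "d \<in> discs T \<Longrightarrow> colour_of T (Some d) = input_colours s t ! d"
    and "colour_of T None = output_colour s t"
proof -
  obtain P R S where t: "t = (P, R, S)" by (cases t)
  have wf: "P \<noteq> []" "length R = length P"
    using assms planar_table_well_formed by (auto simp: drawn_def t well_formed_def)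
  show d: "discs T = {..<length (fst t) - 1}" "discs T = {..<length (input_colours s t)}"
    using assms wf by (auto simp: drawn_def presented_def t input_colours_def)
  have col: "colour_of T d = (length (P ! disc_index d) div 2, odd (R ! disc_index d ! 0) \<noteq> s)" 
    if "d \<in> all_discs T" for d
    using assms that by (auto simp: drawn_def presented_def t)
  show "colour_of T None = output_colour s t"
    using col[of None] by (simp add: all_discs_def output_colour_def t disc_index_def)
  show "colour_of T (Some d) = input_colours s t ! d" if "d \<in> discs T"
    using col[of "Some d"] that d(1) wf
    by (simp add: all_discs_def input_colours_def t disc_index_def nth_tl)
qed

lemma fits_length: "fits A s t xs \<Longrightarrow> length xs = length (input_colours s t)"
  by (auto simp: fits_def dest: list_all2_lengthD)

lemma fits_inputs: "drawn T s t \<Longrightarrow> fits A s t xs \<Longrightarrow> nth xs \<in> inputs A T"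
  using drawn_discs(2)[of T s t] drawn_discs(3)[of T s t]
  by (auto simp: inputs_def fits_def list_all2_conv_all_nth)

locale irreducible_pa =
  fixes A :: "'a::ab_group_add planar_structure"
  assumes subfactor: "subfactor_planar_algebra A" and irreducible: "irreducible_planar_algebra A"
begin

lemma star_algebra: "planar_star_algebra A" and pa: "planar_algebra A" and spherical: "spherical A"
  using subfactor by (auto simp: subfactor_planar_algebra_def planar_star_algebra_def)

sublocale vector_space "scl A"
  using pa by (simp add: planar_algebra_def)

lemmas pa_axioms = pa[unfolded planar_algebra_def, THEN conjunct2]

lemma space: "subspace (box_space A k)"
  using pa_axioms[THEN conjunct1] by (rule spec)

lemma act_in: "planar_tangle T \<Longrightarrow> x \<in> inputs A T \<Longrightarrow> act A T x \<in> box_space A (colour_of T None)"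
  using pa_axioms[THEN conjunct2, THEN conjunct1, rule_format, of T x] by simp

lemma act_cong:
  assumes "planar_tangle T" "x \<in> inputs A T" "\<And>d. d \<in> discs T \<Longrightarrow> x d = y d"
  shows "act A T x = act A T y"
  using pa_axioms[THEN conjunct2, THEN conjunct2, THEN conjunct1, rule_format, of T x y] assms by simp

lemma act_linear:
  assumes "planar_tangle T" "x \<in> inputs A T" "d \<in> discs T"
    "a \<in> box_space A (colour_of T (Some d))" "b \<in> box_space A (colour_of T (Some d))"
  shows "act A T (x(d := a + b)) = act A T (x(d := a)) + act A T (x(d := b))"
    and "act A T (x(d := scl A c a)) = scl A c (act A T (x(d := a)))"
  using pa_axioms[THEN conjunct2, THEN conjunct2, THEN conjunct2, THEN conjunct1, rule_format, of T x d a b c]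
    assms by simp_all

lemma act_glueing:
  assumes "planar_tangle T" "planar_tangle T1" "planar_tangle T2" "glueing T i T1 T2 f g" "x \<in> inputs A T2"
  shows "act A T2 x = act A T ((x \<circ> f)(i := act A T1 (x \<circ> g)))"
  using pa_axioms[THEN conjunct2, THEN conjunct2, THEN conjunct2, THEN conjunct2, THEN conjunct2, THEN conjunct1,
      rule_format, of T T1 T2 i f g x] assms by simp

lemma act_identity: "x 0 \<in> box_space A k \<Longrightarrow> act A (identity_tangle k) x = x 0"
  using pa_axioms[THEN conjunct2, THEN conjunct2, THEN conjunct2, THEN conjunct2, THEN conjunct2, THEN conjunct2]
  by blast

lemma star_act:
  "planar_tangle T \<Longrightarrow> x \<in> inputs A T \<Longrightarrow> star A (colour_of T None) (act A T x)
     = act A (mirror T) (\<lambda>d. star A (colour_of T (Some d)) (x d))"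
  using star_algebra[unfolded planar_star_algebra_def, THEN conjunct2, THEN conjunct2] by blast

lemma star_box:
  assumes "a \<in> box_space A k"
  shows "star A k a \<in> box_space A k" "star A k (star A k a) = a"
    "b \<in> box_space A k \<Longrightarrow> star A k (a + b) = star A k a + star A k b"
    "star A k (scl A c a) = scl A (cnj c) (star A k a)"
  using star_algebra[unfolded planar_star_algebra_def, THEN conjunct2, THEN conjunct1] assms by blast+

lemma ev_eq:
  assumes "drawn T s t" "fits A s t xs" "\<And>d. d < length xs \<Longrightarrow> h d = xs ! d"
  shows "act A T h = ev A T xs"
  unfolding ev_def
  by (rule act_cong[symmetric, OF drawn_planar[OF assms(1)] fits_inputs[OF assms(1,2)]])
    (use assms(3) fits_length[OF assms(2)] drawn_discs(2)[OF assms(1)] in auto)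

lemma ev_in: "drawn T s t \<Longrightarrow> fits A s t xs \<Longrightarrow> ev A T xs \<in> box_space A (output_colour s t)"
  using act_in[OF drawn_planar fits_inputs] drawn_discs(4) unfolding ev_def by metis

lemma fits_update:
  "fits A s t xs \<Longrightarrow> a \<in> box_space A (input_colours s t ! i) \<Longrightarrow> fits A s t (xs[i := a])"
proof -
  assume fit: "fits A s t xs" and a: "a \<in> box_space A (input_colours s t ! i)"
  have "xs[i := a] ! j \<in> box_space A (input_colours s t ! j)" if "j < length xs" for j
    using fit a that by (cases "j = i") (auto simp: fits_def list_all2_conv_all_nth)
  with fit show "fits A s t (xs[i := a])" by (simp add: fits_def list_all2_conv_all_nth)
qed

lemma ev_linear:
  assumes T: "drawn T s t" "fits A s t xs" and i: "i < length xs"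
    and a: "a \<in> box_space A (input_colours s t ! i)"
  shows "b \<in> box_space A (input_colours s t ! i) \<Longrightarrow>
      ev A T (xs[i := a + b]) = ev A T (xs[i := a]) + ev A T (xs[i := b])"
    and "ev A T (xs[i := scl A c a]) = scl A c (ev A T (xs[i := a]))"
proof -
  have id: "i \<in> discs T" using i fits_length[OF T(2)] drawn_discs(2)[OF T(1)] by auto
  note sp = space[of "input_colours s t ! i"]
  have upd: "act A T ((nth xs)(i := z)) = ev A T (xs[i := z])" if "z \<in> box_space A (input_colours s t ! i)" for z
    by (rule ev_eq[OF T(1) fits_update[OF T(2) that]]) (simp add: nth_list_update)
  note lin = act_linear[OF drawn_planar[OF T(1)] fits_inputs[OF T] id, unfolded drawn_discs(3)[OF T(1) id], OF a]
  show "ev A T (xs[i := a + b]) = ev A T (xs[i := a]) + ev A T (xs[i := b])"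
    if "b \<in> box_space A (input_colours s t ! i)"
    using lin(1)[OF that] a that by (simp add: upd subspace_add[OF sp])
  show "ev A T (xs[i := scl A c a]) = scl A c (ev A T (xs[i := a]))"
    using lin(2)[OF a] a by (simp add: upd subspace_scale[OF sp])
qed

text \<open>
  The step of all diagrammatic computations: a tangle that is a glueing is evaluated by evaluating
  the inner tangle first.
\<close>

lemma ev_glue:
  assumes T: "drawn T s t" and T1: "drawn T1 s1 t1" and T2: "drawn T2 s2 t2"
    and s: "s1 = (s \<noteq> b)" "s2 = (s \<noteq> c)" and gl: "glue_table t i t1 t2 b c f g fe ge fr gr"
    and fit: "fits A s2 t2 xs"
  shows "ev A T2 xs = ev A T ((map (nth xs) f)[i := ev A T1 (map (nth xs) g)])"
proof -
  have glu: "glueing T i T1 T2 (nth f) (nth g)" by (rule drawn_glueing[OF T T1 T2 s gl])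
  have len: "length f = length (fst t) - 1" "length g = length (fst t1) - 1"
    using gl by (auto simp: glue_table_def Let_def split: prod.splits)
  note pl = drawn_planar[OF T] drawn_planar[OF T1] drawn_planar[OF T2]
  note inp = fits_inputs[OF T2 fit]
  from glu obtain fe' ge' fr' gr' where bij: "bij_betw (case_sum (nth f) (nth g)) ((discs T - {i}) <+> discs T1) (discs T2)"
    and i: "i \<in> discs T" "colour_of T (Some i) = colour_of T1 None"
    and car: "carried T T2 (all_discs T - {Some i}) (map_option (nth f)) fe' fr'"
      "carried T1 T2 (Some ` discs T1) (map_option (nth g)) ge' gr'"
    unfolding glueing_def by blast
  have c1: "colour_of T2 (Some (f ! d)) = colour_of T (Some d)" if "d \<in> discs T - {i}" for d
    using car(1)[unfolded carried_def, THEN conjunct1, rule_format, of "Some d"] that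
    by (simp add: all_discs_def)
  have c2: "colour_of T2 (Some (g ! d)) = colour_of T1 (Some d)" if "d \<in> discs T1" for d
    using car(2)[unfolded carried_def, THEN conjunct1, rule_format, of "Some d"] that by simp
  have f: "f ! d \<in> discs T2" if "d \<in> discs T - {i}" for d
    using bij_betwE[OF bij, rule_format, OF InlI[OF that]] by simp
  have g: "g ! d \<in> discs T2" if "d \<in> discs T1" for d
    using bij_betwE[OF bij, rule_format, OF InrI[OF that]] by simp
  have in1: "(nth xs \<circ> nth g) \<in> inputs A T1"
    unfolding inputs_def
  proof (clarify, simp)
    fix d assume d: "d \<in> discs T1"
    have "xs ! (g ! d) \<in> box_space A (colour_of T2 (Some (g ! d)))"
      using inp g[OF d] by (simp add: inputs_def)
    then show "xs ! (g ! d) \<in> box_space A (colour_of T1 (Some d))" by (simp only: c2[OF d])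
  qed
  have e1: "act A T1 (nth xs \<circ> nth g) = ev A T1 (map (nth xs) g)"
    unfolding ev_def
    by (rule act_cong[OF pl(2) in1]) (simp add: len drawn_discs(1)[OF T1])
  have mem: "ev A T1 (map (nth xs) g) \<in> box_space A (colour_of T (Some i))"
    using act_in[OF pl(2) in1] by (simp only: e1 i(2))
  have in2: "(nth xs \<circ> nth f)(i := ev A T1 (map (nth xs) g)) \<in> inputs A T"
    unfolding inputs_def
  proof (clarify, simp add: mem, clarify)
    fix d assume d: "d \<in> discs T" "d \<noteq> i"
    have "xs ! (f ! d) \<in> box_space A (colour_of T2 (Some (f ! d)))"
      using inp f[of d] d by (simp add: inputs_def)
    then show "xs ! (f ! d) \<in> box_space A (colour_of T (Some d))" using c1[of d] d by simp
  qed
  have "ev A T2 xs = act A T ((nth xs \<circ> nth f)(i := act A T1 (nth xs \<circ> nth g)))"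
    unfolding ev_def by (rule act_glueing[OF pl glu inp])
  also have "\<dots> = ev A T ((map (nth xs) f)[i := ev A T1 (map (nth xs) g)])"
    unfolding e1 ev_def[of A T]
    by (rule act_cong[OF pl(1) in2]) (simp add: len drawn_discs(1)[OF T] nth_list_update)
  finally show ?thesis .
qed

text \<open>
  The adjoint of a diagram is the mirror image with adjoint inputs.
\<close>

lemma ev_star:
  assumes "drawn T s t" "drawn (mirror T) s t'" "fits A s t xs" "input_colours s t' = input_colours s t"
  shows "star A (output_colour s t) (ev A T xs) = ev A (mirror T) (map2 (star A) (input_colours s t) xs)"
proof -
  have fit: "fits A s t' (map2 (star A) (input_colours s t) xs)"
    using assms(3,4) star_box(1) by (auto simp: fits_def list_all2_conv_all_nth)
  have "star A (output_colour s t) (ev A T xs) = act A (mirror T) (\<lambda>d. star A (colour_of T (Some d)) (xs ! d))"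
    unfolding ev_def using star_act[OF drawn_planar[OF assms(1)] fits_inputs[OF assms(1,3)]]
    by (simp add: drawn_discs(4)[OF assms(1)])
  also have "\<dots> = ev A (mirror T) (map2 (star A) (input_colours s t) xs)"
    by (rule ev_eq[OF assms(2) fit])
      (use fits_length[OF assms(3)] drawn_discs[OF assms(1)] in auto)
  finally show ?thesis .
qed

end

lemma table_colours [simp]:
  "input_colours s mult0_table = [(0, s), (0, s)]" "input_colours s mult1_table = [(1, s), (1, s)]"
  "input_colours s mult2_table = [(2, s), (2, s)]" "input_colours s mult3_table = [(3, s), (3, s)]"
  "input_colours s trace1_table = [(1, s)]" "input_colours s trace2_table = [(2, s)]" "input_colours s trace3_table = [(3, s)]"
  "input_colours s unit0_table = []" "input_colours s unit1_table = []" "input_colours s unit2_table = []"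
  "input_colours s id0_table = [(0, s)]" "input_colours s id1_table = [(1, s)]" "input_colours s id2_table = [(2, s)]"
  "input_colours s loop_table = []" "input_colours s loop_moved_table = []" "input_colours s two_loops_table = []"
  "input_colours s loop_around_table = [(0, \<not> s)]"
  "input_colours s rotation_table = [(2, \<not> s)]" "input_colours s (mirror_table rotation_table) = [(2, \<not> s)]"
  "input_colours s (mirror_table mult2_table) = [(2, s), (2, s)]"
  "input_colours s mult_three_table = [(2, s), (2, s), (2, s)]"
  "input_colours s pairing2_table = [(2, s), (2, s)]" "input_colours s pairing3_table = [(3, s), (3, s)]"
  "input_colours s pairing2_moved_table = [(2, s), (2, s)]"
  "input_colours s leg_c_table = [(2, \<not> s), (2, s)]" "input_colours s (mirror_table leg_c_table) = [(2, \<not> s), (2, s)]"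
  "input_colours s leg_y_table = [(2, \<not> s), (2, s)]" "input_colours s (mirror_table leg_y_table) = [(2, \<not> s), (2, s)]"
  "input_colours s half_trace_table = [(2, s), (2, s)]"
  "input_colours s bead_c_table = [(2, s), (2, s), (1, \<not> s)]" "input_colours s bead_e_table = [(2, \<not> s), (2, \<not> s), (1, s)]"
  "input_colours s triple_table = [(2, s), (2, s), (2, s)]"
  "input_colours s fourier_mult_table = [(2, \<not> s), (2, \<not> s)]"
  "input_colours s pair_leg_c_table = [(2, \<not> s), (2, s), (3, s)]" "input_colours s pair_leg_y_table = [(2, \<not> s), (2, s), (3, s)]"
  "input_colours s norm_leg_c_table = [(2, \<not> s), (2, s), (2, \<not> s), (2, s)]"
  "input_colours s norm_leg_y_table = [(2, \<not> s), (2, s), (2, \<not> s), (2, s)]"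
  "input_colours s cross_table = [(2, \<not> s), (2, s), (2, \<not> s), (2, s)]"
  "input_colours s pair_fourier_table = [(2, \<not> s), (2, s)]"
  "output_colour s mult0_table = (0, s)" "output_colour s mult1_table = (1, s)" "output_colour s mult2_table = (2, s)"
  "output_colour s mult3_table = (3, s)" "output_colour s trace1_table = (0, s)" "output_colour s trace2_table = (0, s)"
  "output_colour s trace3_table = (0, s)" "output_colour s unit0_table = (0, s)" "output_colour s unit1_table = (1, s)"
  "output_colour s unit2_table = (2, s)" "output_colour s loop_table = (0, s)" "output_colour s rotation_table = (2, s)"
  "output_colour s pairing2_table = (0, s)" "output_colour s pairing3_table = (0, s)"
  "output_colour s leg_c_table = (3, s)" "output_colour s leg_y_table = (3, s)" "output_colour s half_trace_table = (1, s)"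
  "output_colour s bead_c_table = (0, s)" "output_colour s bead_e_table = (0, s)" "output_colour s loop_around_table = (0, s)"
  by (induct s; code_simp)+

context irreducible_pa
begin

lemma fits_simps [simp]:
  "fits A s t [] \<longleftrightarrow> input_colours s t = []"
  "fits A s t [x] \<longleftrightarrow> (\<exists>k. input_colours s t = [k] \<and> x \<in> box_space A k)"
  "fits A s t [x, y] \<longleftrightarrow> (\<exists>k l. input_colours s t = [k, l] \<and> x \<in> box_space A k \<and> y \<in> box_space A l)"
  "fits A s t [x, y, z] \<longleftrightarrow> (\<exists>k l m. input_colours s t = [k, l, m]
     \<and> x \<in> box_space A k \<and> y \<in> box_space A l \<and> z \<in> box_space A m)"
  "fits A s t [x, y, z, w] \<longleftrightarrow> (\<exists>k l m n. input_colours s t = [k, l, m, n]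
     \<and> x \<in> box_space A k \<and> y \<in> box_space A l \<and> z \<in> box_space A m \<and> w \<in> box_space A n)"
  by (auto simp: fits_def list_all2_Cons1)

lemma unit_ev: "drawn (unit_tangle k) s t \<Longrightarrow> input_colours s t = [] \<Longrightarrow> unit_of A k = ev A (unit_tangle k) []"
  unfolding unit_of_def by (rule ev_eq) simp_all

lemma mult_ev: "drawn (mult_tangle k) s t \<Longrightarrow> input_colours s t = [k, k] \<Longrightarrow>
    a \<in> box_space A k \<Longrightarrow> b \<in> box_space A k \<Longrightarrow> box_mult A k a b = ev A (mult_tangle k) [a, b]"
  unfolding box_mult_def by (rule ev_eq) (cases k; auto simp: less_Suc_eq)+

lemma trace_ev: "drawn (trace_tangle k) s t \<Longrightarrow> input_colours s t = [k] \<Longrightarrow>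
    a \<in> box_space A k \<Longrightarrow> tr A k a = scalar A (snd k) (ev A (trace_tangle k) [a])"
  unfolding tr_def by (subst ev_eq[of _ s t "[a]"]) (cases k; auto)+

lemma identity_ev: "drawn (identity_tangle k) s t \<Longrightarrow> input_colours s t = [k] \<Longrightarrow>
    a \<in> box_space A k \<Longrightarrow> ev A (identity_tangle k) [a] = a"
  unfolding ev_def by (subst act_identity) simp_all

lemmas unit_evs = unit_ev[OF drawn_unit0, simplified] unit_ev[OF drawn_unit1, simplified] unit_ev[OF drawn_unit2, simplified]
lemmas mult_evs = mult_ev[OF drawn_mult0, simplified] mult_ev[OF drawn_mult1, simplified]
  mult_ev[OF drawn_mult2, simplified] mult_ev[OF drawn_mult3, simplified]
lemmas trace_evs = trace_ev[OF drawn_trace1, simplified] trace_ev[OF drawn_trace2, simplified] trace_ev[OF drawn_trace3, simplified]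
lemmas identity_evs = identity_ev[OF drawn_id0, simplified] identity_ev[OF drawn_id1, simplified] identity_ev[OF drawn_id2, simplified]

lemma unit_in: "unit_of A (0, s) \<in> box_space A (0, s)" "unit_of A (Suc 0, s) \<in> box_space A (Suc 0, s)" "unit_of A (2, s) \<in> box_space A (2, s)"
  using ev_in[OF drawn_unit0, of s "[]"] ev_in[OF drawn_unit1, of s "[]"] ev_in[OF drawn_unit2, of s "[]"]
  by (simp_all add: unit_evs)

lemma one_dimensional:
  assumes "dim (box_space A k) = 1" "u \<in> box_space A k" "u \<noteq> 0" "x \<in> box_space A k"
  obtains c where "x = scl A c u"
proof -
  obtain B where B: "B \<subseteq> box_space A k" "independent B" "box_space A k \<subseteq> span B" "card B = dim (box_space A k)"
    using basis_exists by blast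
  then obtain b where b: "B = {b}" using assms(1) by (auto simp: card_1_singleton_iff)
  obtain l where l: "u = scl A l b" using assms(2) B(3) by (auto simp: b span_singleton)
  obtain m where m: "x = scl A m b" using assms(4) B(3) by (auto simp: b span_singleton)
  have "l \<noteq> 0" using l assms(3) by auto
  then have "x = scl A (m / l) u" by (simp add: l m)
  then show thesis by (rule that)
qed

lemma nonzero_if_dim_1: "dim (box_space A k) = 1 \<Longrightarrow> \<exists>x \<in> box_space A k. x \<noteq> 0"
proof (rule ccontr)
  assume "dim (box_space A k) = 1" "\<not> (\<exists>x \<in> box_space A k. x \<noteq> 0)"
  then have "box_space A k \<subseteq> {0}" by auto
  then have "dim (box_space A k) \<le> dim {0 :: 'a}"
    using dim_le_card[of "box_space A k" "{}"] by (simp add: span_empty)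
  then show False using \<open>dim (box_space A k) = 1\<close> \<open>box_space A k \<subseteq> {0}\<close> dim_le_card[of "box_space A k" "{}"]
    by (simp add: span_empty)
qed

lemma dims: "dim (box_space A (0, s)) = 1" "dim (box_space A (Suc 0, s)) = 1"
  using subfactor irreducible by (auto simp: subfactor_planar_algebra_def irreducible_planar_algebra_def)

lemma unit_mult:
  "a \<in> box_space A (0, s) \<Longrightarrow> box_mult A (0, s) (unit_of A (0, s)) a = a"
  "a \<in> box_space A (Suc 0, s) \<Longrightarrow> box_mult A (Suc 0, s) (unit_of A (Suc 0, s)) a = a"
  "a \<in> box_space A (2, s) \<Longrightarrow> box_mult A (2, s) (unit_of A (2, s)) a = a"
  "a \<in> box_space A (2, s) \<Longrightarrow> box_mult A (2, s) a (unit_of A (2, s)) = a"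
  using ev_glue[OF drawn_mult0[of s] drawn_unit0[of s] drawn_id0[of s] _ _ glue_mult0_unit0, of "[a]"]
    ev_glue[OF drawn_mult1[of s] drawn_unit1[of s] drawn_id1[of s] _ _ glue_mult1_unit1, of "[a]"]
    ev_glue[OF drawn_mult2[of s] drawn_unit2[of s] drawn_id2[of s] _ _ glue_mult2_unit2_0, of "[a]"]
    ev_glue[OF drawn_mult2[of s] drawn_unit2[of s] drawn_id2[of s] _ _ glue_mult2_unit2_1, of "[a]"]
    unit_in[of s]
  by (simp_all add: mult_evs identity_evs flip: unit_evs)

lemma ev_scale_single: "drawn T s t \<Longrightarrow> input_colours s t = [k] \<Longrightarrow> a \<in> box_space A k \<Longrightarrow>
    ev A T [scl A c a] = scl A c (ev A T [a])"
  using ev_linear(2)[of T s t "[a]" 0 a c] by simp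

lemma ev_add_single: "drawn T s t \<Longrightarrow> input_colours s t = [k] \<Longrightarrow> a \<in> box_space A k \<Longrightarrow>
    b \<in> box_space A k \<Longrightarrow> ev A T [a + b] = ev A T [a] + ev A T [b]"
  using ev_linear(1)[of T s t "[a]" 0 a b] by simp

lemma ev_bilinear:
  assumes "drawn T s t" "input_colours s t = [k, l]" "a \<in> box_space A k" "b \<in> box_space A l"
  shows "a' \<in> box_space A k \<Longrightarrow> ev A T [a + a', b] = ev A T [a, b] + ev A T [a', b]"
    and "b' \<in> box_space A l \<Longrightarrow> ev A T [a, b + b'] = ev A T [a, b] + ev A T [a, b']"
    and "ev A T [scl A c a, b] = scl A c (ev A T [a, b])"
    and "ev A T [a, scl A c b] = scl A c (ev A T [a, b])"
  using ev_linear(1)[of T s t "[a, b]" 0 a a'] ev_linear(1)[of T s t "[a, b]" 1 b b']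
    ev_linear(2)[of T s t "[a, b]" 0 a c] ev_linear(2)[of T s t "[a, b]" 1 b c] assms by simp_all

lemma unit0_nonzero: "unit_of A (0, s) \<noteq> 0"
proof
  assume u: "unit_of A (0, s) = 0"
  obtain x where x: "x \<in> box_space A (0, s)" "x \<noteq> 0" using nonzero_if_dim_1[OF dims(1)] by auto
  have "x = ev A (mult_tangle (0, s)) [scl A 0 x, x]"
    using unit_mult(1)[OF x(1)] x subspace_0[OF space] by (simp add: u mult_evs)
  also have "\<dots> = 0" using ev_bilinear(3)[OF drawn_mult0[of s] _ x(1) x(1), where c = 0] by simp
  finally show False using x by simp
qed

lemma scalar_scale [simp]: "scalar A s (scl A c (unit_of A (0, s))) = c"
  unfolding scalar_def using unit0_nonzero by (intro the_equality) auto

lemma scalar_eq: "x \<in> box_space A (0, s) \<Longrightarrow> scl A (scalar A s x) (unit_of A (0, s)) = x"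
  by (metis one_dimensional[OF dims(1) unit_in(1) unit0_nonzero] scalar_scale)

lemma scalar_add: "x \<in> box_space A (0, s) \<Longrightarrow> y \<in> box_space A (0, s) \<Longrightarrow> scalar A s (x + y) = scalar A s x + scalar A s y"
  using scalar_scale[of s "scalar A s x + scalar A s y"] by (simp add: scale_left_distrib scalar_eq)

lemma scalar_scl: "x \<in> box_space A (0, s) \<Longrightarrow> scalar A s (scl A c x) = c * scalar A s x"
  using scalar_scale[of s "c * scalar A s x"] scalar_eq[of x s] by (simp flip: scale_scale)

lemma tr_pos: "a \<in> box_space A k \<Longrightarrow> a \<noteq> 0 \<Longrightarrow>
    tr A k (box_mult A k (star A k a) a) \<in> \<real> \<and> 0 < Re (tr A k (box_mult A k (star A k a) a))"
  using subfactor by (cases k) (auto simp: subfactor_planar_algebra_def)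

lemma box_hilbert:
  assumes m: "drawn (mult_tangle k) s t" "input_colours s t = [k, k]" "output_colour s t = k"
    and r: "drawn (trace_tangle k) s t'" "input_colours s t' = [k]" "output_colour s t' = (0, s)" "snd k = s"
  shows "box_hilbert A k"
proof
  note mev = mult_ev[OF m(1,2)] and tev = trace_ev[OF r(1,2), unfolded r(4)]
  note cl = subspace_add[OF space] subspace_scale[OF space]
  note mlin = ev_bilinear[OF m(1,2)]
  have tin: "a \<in> box_space A k \<Longrightarrow> ev A (trace_tangle k) [a] \<in> box_space A (0, s)" for a
    using ev_in[OF r(1), of "[a]"] r by simp
  show "subspace (box_space A k)" by (rule space)
  show "box_mult A k a b \<in> box_space A k" if "a \<in> box_space A k" "b \<in> box_space A k" for a b
    using ev_in[OF m(1), of "[a, b]"] that m by (simp add: mev)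
  show "box_mult A k (a + b) c = box_mult A k a c + box_mult A k b c"
    if "a \<in> box_space A k" "b \<in> box_space A k" "c \<in> box_space A k" for a b c
    using that mlin(1)[of a c b] by (simp add: mev cl)
  show "box_mult A k a (b + c) = box_mult A k a b + box_mult A k a c"
    if "a \<in> box_space A k" "b \<in> box_space A k" "c \<in> box_space A k" for a b c
    using that mlin(2)[of a b c] by (simp add: mev cl)
  show "box_mult A k (scl A z a) b = scl A z (box_mult A k a b)"
    if "a \<in> box_space A k" "b \<in> box_space A k" for a b z
    using that mlin(3)[of a b z] by (simp add: mev cl)
  show "box_mult A k a (scl A z b) = scl A z (box_mult A k a b)"
    if "a \<in> box_space A k" "b \<in> box_space A k" for a b z
    using that mlin(4)[of a b z] by (simp add: mev cl)
  show "tr A k (a + b) = tr A k a + tr A k b" if "a \<in> box_space A k" "b \<in> box_space A k" for a b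
    using that ev_add_single[OF r(1,2), of a b] by (simp add: tev cl tin scalar_add)
  show "tr A k (scl A z a) = z * tr A k a" if "a \<in> box_space A k" for a z
    using that ev_scale_single[OF r(1,2), of a z] by (simp add: tev cl tin scalar_scl)
  show "tr A k (box_mult A k (star A k a) a) \<in> \<real> \<and> 0 < Re (tr A k (box_mult A k (star A k a) a))"
    if "a \<in> box_space A k" "a \<noteq> 0" for a
    using that by (rule tr_pos)
qed (simp_all add: star_box)

lemma box_hilbert_3: "box_hilbert A (3, s)"
  by (rule box_hilbert[OF drawn_mult3[of s] _ _ drawn_trace3[of s]]) simp_all

lemma box_hilbert_2: "box_hilbert A (2, s)"
  by (rule box_hilbert[OF drawn_mult2[of s] _ _ drawn_trace2[of s]]) simp_all

lemmas mult_in = box_hilbert.mult_closed[OF box_hilbert_2]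

lemma tr_pairing2:
  "a \<in> box_space A (2, s) \<Longrightarrow> b \<in> box_space A (2, s) \<Longrightarrow>
     tr A (2, s) (box_mult A (2, s) a b) = scalar A s (ev A (web s pairing2_table) [a, b])"
  using ev_glue[OF drawn_trace2[of s] drawn_mult2[of s] drawn_pairing2[of s] _ _ glue_trace2_mult2, of "[a, b]"]
    mult_in[of a s b] by (simp add: mult_evs trace_evs)

lemma tr_pairing3:
  "a \<in> box_space A (3, s) \<Longrightarrow> b \<in> box_space A (3, s) \<Longrightarrow>
     tr A (3, s) (box_mult A (3, s) a b) = scalar A s (ev A (web s pairing3_table) [a, b])"
  using ev_glue[OF drawn_trace3[of s] drawn_mult3[of s] drawn_pairing3[of s] _ _ glue_trace3_mult3, of "[a, b]"]
    box_hilbert.mult_closed[OF box_hilbert_3, of a s b] by (simp add: mult_evs trace_evs)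

lemma box_algebra_2: "box_algebra A (2, s)"
proof -
  interpret box_hilbert A "(2, s)" by (rule box_hilbert_2)
  show ?thesis
  proof
    fix a b c assume a: "a \<in> box_space A (2, s)" and b: "b \<in> box_space A (2, s)"
    show "star A (2, s) (box_mult A (2, s) a b) = box_mult A (2, s) (star A (2, s) b) (star A (2, s) a)"
      using ev_star[OF drawn_mult2[of s] drawn_mirror_mult2[of s], of "[a, b]"] a b
        ev_glue[OF drawn_mult2[of s] drawn_id2[of s] drawn_mirror_mult2[of s] _ _ glue_mult2_id2,
          of "[star A (2, s) a, star A (2, s) b]"]
      by (simp add: mult_evs identity_evs)
    show "tr A (2, s) (box_mult A (2, s) a b) = tr A (2, s) (box_mult A (2, s) b a)"
      using ev_glue[OF drawn_pairing2[of s] drawn_id2[of s] drawn_pairing2[of s] _ _ glue_pairing2_id2, of "[a, b]"] a b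
      by (simp add: tr_pairing2 identity_evs)
    assume c: "c \<in> box_space A (2, s)"
    show "box_mult A (2, s) (box_mult A (2, s) a b) c = box_mult A (2, s) a (box_mult A (2, s) b c)"
      using ev_glue[OF drawn_mult2[of s] drawn_mult2[of s] drawn_mult_three[of s] _ _ glue_mult2_mult2_0, of "[a, b, c]"]
        ev_glue[OF drawn_mult2[of s] drawn_mult2[of s] drawn_mult_three[of s] _ _ glue_mult2_mult2_1, of "[a, b, c]"] a b c
      by (simp add: mult_evs(3)[symmetric] mult_in)
  next
    show "\<exists>B. finite B \<and> span B = box_space A (2, s)"
      using subfactor by (auto simp: subfactor_planar_algebra_def)
  qed (simp_all add: unit_in unit_mult)
qed

text \<open>
  The loop as a complex number; that it is real and positive is proved below.
\<close>

definition loop_scalar :: "bool \<Rightarrow> complex" where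
  "loop_scalar s = scalar A s (ev A (loop_tangle s) [])"

lemma loop_in: "ev A (loop_tangle s) [] \<in> box_space A (0, s)"
  using ev_in[OF drawn_loop, of s "[]"] by simp

lemma trace_unit1: "ev A (trace_tangle (Suc 0, s)) [unit_of A (Suc 0, s)] = ev A (loop_tangle s) []"
  using ev_glue[OF drawn_trace1[of s] drawn_unit1[of s] drawn_loop[of s] _ _ glue_trace1_unit1, of "[]"]
  by (simp flip: unit_evs)

text \<open>
  Sphericality, with scalars instead of elements of the 0-box spaces: a closed diagram does not
  depend on the region that is drawn at infinity.
\<close>

lemma sphere_move:
  assumes "drawn T s t" "output_colour s t = (0, s)" "r \<in> regions T" "shaded T r = s'" "fits A s t xs"
  shows "scalar A s (ev A T xs) = scalar A s' (ev A (move_infinity r T) xs)"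
  using spherical[unfolded spherical_def, rule_format, of T s r "nth xs"] drawn_planar[OF assms(1)]
    fits_inputs[OF assms(1,5)] assms drawn_discs(4)[OF assms(1)] by (simp add: ev_def)

lemma loop_scalar_shade: "loop_scalar (\<not> s) = loop_scalar s"
proof -
  have "1 \<in> regions (loop_tangle s)" "shaded (loop_tangle s) 1 = (\<not> s)" by (auto simp: loop_tangle_def)
  from sphere_move[OF drawn_loop[of s] _ this, of "[]"]
  have "loop_scalar s = scalar A (\<not> s) (ev A (move_infinity 1 (loop_tangle s)) [])"
    by (simp add: loop_scalar_def)
  also have "ev A (move_infinity 1 (loop_tangle s)) [] = ev A (loop_tangle (\<not> s)) []"
    using ev_glue[OF drawn_trace1[of "\<not> s"] drawn_unit1[of "\<not> s"] drawn_loop_moved[of s] _ _ glue_trace1_unit1_2, of "[]"]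
    by (simp add: trace_unit1 flip: unit_evs)
  finally show ?thesis by (simp add: loop_scalar_def)
qed

lemma tr_one: "tr A (2, s) (unit_of A (2, s)) = loop_scalar s * loop_scalar s"
proof -
  have "tr A (2, s) (unit_of A (2, s)) = scalar A s (ev A (web s two_loops_table) [])"
    using ev_glue[OF drawn_trace2[of s] drawn_unit2[of s] drawn_two_loops[of s] _ _ glue_trace2_unit2, of "[]"]
    by (simp add: trace_evs unit_in flip: unit_evs)
  also have "ev A (web s two_loops_table) [] = ev A (web s loop_around_table) [ev A (loop_tangle (\<not> s)) []]"
    using ev_glue[OF drawn_loop_around[of s] drawn_loop[of "\<not> s"] drawn_two_loops[of s] _ _ glue_loop_around_loop, of "[]"]
    by simp
  also have "\<dots> = ev A (web s loop_around_table) [scl A (loop_scalar (\<not> s)) (unit_of A (0, \<not> s))]"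
    unfolding loop_scalar_def by (subst scalar_eq) (simp_all add: loop_in)
  also have "\<dots> = scl A (loop_scalar (\<not> s)) (ev A (web s loop_around_table) [unit_of A (0, \<not> s)])"
    by (rule ev_scale_single[OF drawn_loop_around], simp) (simp add: unit_in)
  also have "ev A (web s loop_around_table) [unit_of A (0, \<not> s)] = ev A (loop_tangle s) []"
    using ev_glue[OF drawn_loop_around[of s] drawn_unit0[of "\<not> s"] drawn_loop[of s] _ _ glue_loop_around_unit0, of "[]"]
    by (simp flip: unit_evs)
  finally show ?thesis by (simp add: scalar_scl loop_in loop_scalar_shade) (simp add: loop_scalar_def)
qed

lemma unit1_nonzero: "unit_of A (Suc 0, s) \<noteq> 0"
proof
  assume u: "unit_of A (Suc 0, s) = 0"
  obtain x where x: "x \<in> box_space A (Suc 0, s)" "x \<noteq> 0" using nonzero_if_dim_1[OF dims(2)] by auto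
  have "x = ev A (mult_tangle (Suc 0, s)) [scl A 0 x, x]"
    using unit_mult(2)[OF x(1)] x subspace_0[OF space] by (simp add: u mult_evs)
  also have "\<dots> = 0" using ev_bilinear(3)[OF drawn_mult1[of s] _ x(1) x(1), where c = 0] by simp
  finally show False using x by simp
qed

text \<open>
  If the loop had the value \<open>0\<close>, the unit of the 1-box space would have trace \<open>0\<close>, although the
  trace is positive.
\<close>

lemma loop_nonzero: "loop_scalar s \<noteq> 0"
proof
  let ?u = "unit_of A (Suc 0, s)"
  assume l: "loop_scalar s = 0"
  obtain c where c: "star A (Suc 0, s) ?u = scl A c ?u"
    using one_dimensional[OF dims(2) unit_in(2) unit1_nonzero star_box(1)[OF unit_in(2)]] .
  have "tr A (Suc 0, s) (box_mult A (Suc 0, s) (star A (Suc 0, s) ?u) ?u) = tr A (Suc 0, s) (scl A c ?u)"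
    using ev_bilinear(3)[OF drawn_mult1[of s] _ unit_in(2) unit_in(2), where c = c] unit_mult(2)[OF unit_in(2), of s]
      unit_in(2)[of s] by (simp add: c mult_evs subspace_scale[OF space])
  also have "\<dots> = c * scalar A s (ev A (loop_tangle s) [])"
    using ev_scale_single[OF drawn_trace1[of s] _ unit_in(2), where c = c] unit_in(2)[of s] loop_in[of s]
    by (simp add: trace_evs subspace_scale[OF space] trace_unit1 scalar_scl)
  finally have "tr A (Suc 0, s) (box_mult A (Suc 0, s) (star A (Suc 0, s) ?u) ?u) = 0" using l by (simp add: loop_scalar_def)
  with tr_pos[OF unit_in(2)[of s] unit1_nonzero] show False by simp
qed

text \<open>
  By irreducibility a half-closed product is a multiple of the string, and closing it completely
  determines the factor.
\<close>

lemma half_trace: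
  assumes "a \<in> box_space A (2, s)" "b \<in> box_space A (2, s)"
  obtains c where "ev A (web s half_trace_table) [a, b] = scl A c (unit_of A (Suc 0, s))"
    and "c * loop_scalar s = tr A (2, s) (box_mult A (2, s) a b)"
proof -
  have "ev A (web s half_trace_table) [a, b] \<in> box_space A (Suc 0, s)"
    using ev_in[OF drawn_half_trace, of s "[a, b]"] assms by simp
  then obtain c where c: "ev A (web s half_trace_table) [a, b] = scl A c (unit_of A (Suc 0, s))"
    using one_dimensional[OF dims(2) unit_in(2) unit1_nonzero] by blast
  have "ev A (web s pairing2_table) [a, b] = scl A c (ev A (loop_tangle s) [])"
    using ev_glue[OF drawn_trace1[of s] drawn_half_trace[of s] drawn_pairing2[of s] _ _ glue_trace1_half_trace, of "[a, b]"]
      assms ev_scale_single[OF drawn_trace1[of s] _ unit_in(2), where c = c] by (simp add: c trace_unit1)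
  then have "tr A (2, s) (box_mult A (2, s) a b) = c * loop_scalar s"
    using assms by (simp add: tr_pairing2 scalar_scl loop_in loop_scalar_def)
  then show thesis by (intro that[OF c]) simp
qed

end



section \<open>Cutting the diagram of the Fourier transform\<close>

context irreducible_pa
begin

lemma ev_scale_third:
  assumes "drawn T s t" "input_colours s t = [k, l, m]" "a \<in> box_space A k" "b \<in> box_space A l" "d \<in> box_space A m"
  shows "ev A T [a, b, scl A c d] = scl A c (ev A T [a, b, d])"
  using ev_linear(2)[of T s t "[a, b, d]" 2 d c] assms by simp

lemma leg_c_in: "v \<in> box_space A (2, \<not> s) \<Longrightarrow> c \<in> box_space A (2, s) \<Longrightarrow> ev A (web s leg_c_table) [v, c] \<in> box_space A (3, s)"
  using ev_in[OF drawn_leg_c, of s "[v, c]"] by simp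

lemma leg_y_in: "v \<in> box_space A (2, \<not> s) \<Longrightarrow> c \<in> box_space A (2, s) \<Longrightarrow> ev A (web s leg_y_table) [v, c] \<in> box_space A (3, s)"
  using ev_in[OF drawn_leg_y, of s "[v, c]"] by simp

lemma pairing_leg_c:
  assumes v: "v \<in> box_space A (2, \<not> s)" and c: "c \<in> box_space A (2, s)" and Y: "Y \<in> box_space A (3, s)"
  shows "tr A (3, s) (box_mult A (3, s) (star A (3, s) (ev A (web s leg_c_table) [v, c])) Y)
    = scalar A s (ev A (web s pair_leg_c_table) [star A (2, \<not> s) v, star A (2, s) c, Y])"
  using ev_star[OF drawn_leg_c[of s] drawn_mirror_leg_c[of s], of "[v, c]"]
    ev_glue[OF drawn_pairing3[of s] drawn_mirror_leg_c[of s] drawn_pair_leg_c[of s] _ _ glue_pairing3_mirror_leg_c,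
      of "[star A (2, \<not> s) v, star A (2, s) c, Y]"]
    assms star_box(1)[OF v] star_box(1)[OF c] star_box(1)[OF leg_c_in[OF v c]] by (simp add: tr_pairing3)

lemma pairing_leg_y:
  assumes v: "v \<in> box_space A (2, \<not> s)" and c: "c \<in> box_space A (2, s)" and Y: "Y \<in> box_space A (3, s)"
  shows "tr A (3, s) (box_mult A (3, s) (star A (3, s) (ev A (web s leg_y_table) [v, c])) Y)
    = scalar A s (ev A (web s pair_leg_y_table) [star A (2, \<not> s) v, star A (2, s) c, Y])"
  using ev_star[OF drawn_leg_y[of s] drawn_mirror_leg_y[of s], of "[v, c]"]
    ev_glue[OF drawn_pairing3[of s] drawn_mirror_leg_y[of s] drawn_pair_leg_y[of s] _ _ glue_pairing3_mirror_leg_y,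
      of "[star A (2, \<not> s) v, star A (2, s) c, Y]"]
    assms star_box(1)[OF v] star_box(1)[OF c] star_box(1)[OF leg_y_in[OF v c]] by (simp add: tr_pairing3)

text \<open>
  In the closed diagram of \<open>X\<^sup>* X\<close> the two copies of \<open>v\<close> form a half-closed product \<open>v\<^sup>* v\<close>, a bead on one
  string of the pairing of \<open>c\<^sup>*\<close> and \<open>c\<close>. The bead is a scalar, and what remains is the
  trace of \<open>c\<^sup>* c\<close>.
\<close>

lemma norm_leg_c:
  assumes v: "v \<in> box_space A (2, \<not> s)" and c: "c \<in> box_space A (2, s)"
  defines "X \<equiv> ev A (web s leg_c_table) [v, c]"
  shows "loop_scalar s * tr A (3, s) (box_mult A (3, s) (star A (3, s) X) X)
    = tr A (2, \<not> s) (box_mult A (2, \<not> s) (star A (2, \<not> s) v) v) * tr A (2, s) (box_mult A (2, s) (star A (2, s) c) c)"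
proof -
  let ?v = "star A (2, \<not> s) v" and ?c = "star A (2, s) c"
  note vc = star_box(1)[OF v] star_box(1)[OF c]
  obtain z where z: "ev A (web (\<not> s) half_trace_table) [?v, v] = scl A z (unit_of A (Suc 0, \<not> s))"
    "z * loop_scalar (\<not> s) = tr A (2, \<not> s) (box_mult A (2, \<not> s) ?v v)"
    using half_trace[OF vc(1) v] .
  have "tr A (3, s) (box_mult A (3, s) (star A (3, s) X) X) = scalar A s (ev A (web s pair_leg_c_table) [?v, ?c, X])"
    unfolding X_def by (rule pairing_leg_c[OF v c leg_c_in[OF v c]])
  also have "ev A (web s pair_leg_c_table) [?v, ?c, X] = ev A (web s norm_leg_c_table) [?v, ?c, v, c]"
    using ev_glue[OF drawn_pair_leg_c[of s] drawn_leg_c[of s] drawn_norm_leg_c[of s] _ _ glue_pair_leg_c_leg_c,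
      of "[?v, ?c, v, c]"] v c vc by (simp add: X_def)
  also have "\<dots> = ev A (web s bead_c_table) [?c, c, ev A (web (\<not> s) half_trace_table) [?v, v]]"
    using ev_glue[OF drawn_bead_c[of s] drawn_half_trace[of "\<not> s"] drawn_norm_leg_c[of s] _ _ glue_bead_c_half_trace,
      of "[?v, ?c, v, c]"] v c vc by simp
  also have "\<dots> = scl A z (ev A (web s bead_c_table) [?c, c, unit_of A (Suc 0, \<not> s)])"
    unfolding z(1) by (rule ev_scale_third[OF drawn_bead_c], simp) (simp_all add: c vc unit_in)
  also have "ev A (web s bead_c_table) [?c, c, unit_of A (Suc 0, \<not> s)] = ev A (web s pairing2_table) [?c, c]"
    using ev_glue[OF drawn_bead_c[of s] drawn_unit1[of "\<not> s"] drawn_pairing2[of s] _ _ glue_bead_c_unit1,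
      of "[?c, c]"] c vc by (simp flip: unit_evs)
  also have "scalar A s (scl A z (ev A (web s pairing2_table) [?c, c])) = z * tr A (2, s) (box_mult A (2, s) ?c c)"
    using ev_in[OF drawn_pairing2[of s], of "[?c, c]"] c vc by (simp add: scalar_scl tr_pairing2)
  finally show ?thesis using z(2) by (simp add: loop_scalar_shade mult_ac)
qed

text \<open>
  The pairing of two boxes of the opposite colour, read on the sphere.
\<close>

lemma moved_pairing:
  assumes "a \<in> box_space A (2, \<not> s)" "b \<in> box_space A (2, \<not> s)"
  shows "scalar A s (ev A (move_infinity 1 (web (\<not> s) pairing2_table)) [a, b]) = tr A (2, \<not> s) (box_mult A (2, \<not> s) a b)"
proof -
  have "1 \<in> regions (web (\<not> s) pairing2_table)" "shaded (web (\<not> s) pairing2_table) 1 = s"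
    by (auto simp: web_def pairing2_table_def table_regions_def)
  from sphere_move[OF drawn_pairing2[of "\<not> s"] _ this, of "[a, b]"] assms show ?thesis by (simp add: tr_pairing2)
qed

lemma bead_e_unit:
  assumes a: "a \<in> box_space A (2, \<not> s)" and b: "b \<in> box_space A (2, \<not> s)"
  shows "ev A (web s bead_e_table) [a, b, unit_of A (Suc 0, s)]
    = ev A (move_infinity 1 (web (\<not> s) pairing2_table)) [a, b]"
proof -
  have fit: "fits A (\<not> s) pairing2_moved_table [a, b]" using a b by simp
  have shades: "s = (s \<noteq> False)" "(\<not> s) = (s \<noteq> True)" by simp_all
  have "ev A (move_infinity 1 (web (\<not> s) pairing2_table)) [a, b] = ev A (web s bead_e_table)
      ((map ((!) [a, b]) [0, 1, 0])[2 := ev A (unit_tangle (1, s)) (map ((!) [a, b]) [])])"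
    by (rule ev_glue[OF drawn_bead_e drawn_unit1 drawn_pairing2_moved shades glue_bead_e_unit1 fit])
  also have "(map ((!) [a, b]) [0, 1, 0])[2 := ev A (unit_tangle (1, s)) (map ((!) [a, b]) [])]
      = [a, b, unit_of A (Suc 0, s)]" by (simp add: unit_evs)
  finally show ?thesis by (rule sym)
qed

text \<open>
  Here \<open>y\<close> and \<open>y\<^sup>*\<close> form the bead, and the pairing of \<open>e\<^sup>*\<close> and \<open>e\<close> remains. That pairing has the
  opposite shade at infinity, so sphericality is used.
\<close>

lemma norm_leg_y:
  assumes e: "e \<in> box_space A (2, \<not> s)" and y: "y \<in> box_space A (2, s)"
  defines "Y \<equiv> ev A (web s leg_y_table) [e, y]"
  shows "loop_scalar s * tr A (3, s) (box_mult A (3, s) (star A (3, s) Y) Y)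
    = tr A (2, \<not> s) (box_mult A (2, \<not> s) (star A (2, \<not> s) e) e) * tr A (2, s) (box_mult A (2, s) y (star A (2, s) y))"
proof -
  let ?e = "star A (2, \<not> s) e" and ?y = "star A (2, s) y"
  note ey = star_box(1)[OF e] star_box(1)[OF y]
  obtain z where z: "ev A (web s half_trace_table) [y, ?y] = scl A z (unit_of A (Suc 0, s))"
    "z * loop_scalar s = tr A (2, s) (box_mult A (2, s) y ?y)"
    using half_trace[OF y ey(2)] .
  have "tr A (3, s) (box_mult A (3, s) (star A (3, s) Y) Y) = scalar A s (ev A (web s pair_leg_y_table) [?e, ?y, Y])"
    unfolding Y_def by (rule pairing_leg_y[OF e y leg_y_in[OF e y]])
  also have "ev A (web s pair_leg_y_table) [?e, ?y, Y] = ev A (web s norm_leg_y_table) [?e, ?y, e, y]"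
    using ev_glue[OF drawn_pair_leg_y[of s] drawn_leg_y[of s] drawn_norm_leg_y[of s] _ _ glue_pair_leg_y_leg_y,
      of "[?e, ?y, e, y]"] e y ey by (simp add: Y_def)
  also have "\<dots> = ev A (web s bead_e_table) [?e, e, ev A (web s half_trace_table) [y, ?y]]"
    using ev_glue[OF drawn_bead_e[of s] drawn_half_trace[of s] drawn_norm_leg_y[of s] _ _ glue_bead_e_half_trace,
      of "[?e, ?y, e, y]"] e y ey by simp
  also have "\<dots> = scl A z (ev A (web s bead_e_table) [?e, e, unit_of A (Suc 0, s)])"
    unfolding z(1) by (rule ev_scale_third[OF drawn_bead_e], simp) (simp_all add: e ey unit_in)
  also have "ev A (web s bead_e_table) [?e, e, unit_of A (Suc 0, s)]
      = ev A (move_infinity 1 (web (\<not> s) pairing2_table)) [?e, e]"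
    by (rule bead_e_unit[OF ey(1) e])
  also have "scalar A s (scl A z (ev A (move_infinity 1 (web (\<not> s) pairing2_table)) [?e, e]))
      = z * tr A (2, \<not> s) (box_mult A (2, \<not> s) ?e e)"
  proof -
    have "output_colour (\<not> s) pairing2_moved_table = (0, s)"
      by (simp add: output_colour_def pairing2_moved_table_def)
    with ev_in[OF drawn_pairing2_moved[of "\<not> s"], of "[?e, e]"] e ey
    have "ev A (move_infinity 1 (web (\<not> s) pairing2_table)) [?e, e] \<in> box_space A (0, s)" by simp
    then show ?thesis unfolding moved_pairing[OF ey(1) e, symmetric] by (rule scalar_scl)
  qed
  finally show ?thesis using z(2) by (simp add: mult_ac)
qed

lemma fourier_ev: "x \<in> box_space A (2, \<not> s) \<Longrightarrow> fourier A (\<not> s) x = ev A (fourier_tangle (\<not> s)) [x]"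
  unfolding fourier_def by (rule ev_eq[OF drawn_rotation]) simp_all

lemma fourier_in: "x \<in> box_space A (2, s) \<Longrightarrow> fourier A s x \<in> box_space A (2, \<not> s)"
  using ev_in[OF drawn_rotation[of "\<not> s"], of "[x]"] fourier_ev[of x "\<not> s"] by simp

lemma fourier_linear:
  assumes "x \<in> box_space A (2, s)"
  shows "fourier A s (scl A c x) = scl A c (fourier A s x)"
    and "y \<in> box_space A (2, s) \<Longrightarrow> fourier A s (x + y) = fourier A s x + fourier A s y"
  using ev_scale_single[OF drawn_rotation[of "\<not> s"] _ assms, where c = c] 
    ev_add_single[OF drawn_rotation[of "\<not> s"] _ assms, where b = y]
    fourier_ev[of x "\<not> s"] fourier_ev[of y "\<not> s"] fourier_ev[of "x + y" "\<not> s"] fourier_ev[of "scl A c x" "\<not> s"] assms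
    subspace_scale[OF space] subspace_add[OF space]
  by simp_all

text \<open>
  The two legs glued together contain \<open>v\<^sup>*\<close> and \<open>e\<close> as a product seen after a quarter turn, that is, the
  Fourier transform of \<open>v\<^sup>* e\<close>, between \<open>c\<^sup>*\<close> and \<open>y\<close>.
\<close>

lemma cross_pairing:
  assumes v: "v \<in> box_space A (2, \<not> s)" and c: "c \<in> box_space A (2, s)"
    and e: "e \<in> box_space A (2, \<not> s)" and y: "y \<in> box_space A (2, s)"
  shows "tr A (3, s) (box_mult A (3, s) (star A (3, s) (ev A (web s leg_c_table) [v, c])) (ev A (web s leg_y_table) [e, y]))
    = tr A (2, s) (box_mult A (2, s) (star A (2, s) c)
        (box_mult A (2, s) (fourier A (\<not> s) (box_mult A (2, \<not> s) (star A (2, \<not> s) v) e)) y))"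
proof -
  let ?v = "star A (2, \<not> s) v" and ?c = "star A (2, s) c" and ?Y = "ev A (web s leg_y_table) [e, y]"
  note vc = star_box(1)[OF v] star_box(1)[OF c]
  let ?m = "box_mult A (2, \<not> s) ?v e"
  have m: "?m \<in> box_space A (2, \<not> s)" by (rule mult_in[OF vc(1) e])
  have g: "fourier A (\<not> s) ?m \<in> box_space A (2, s)" using fourier_in[OF m] by simp
  have "tr A (3, s) (box_mult A (3, s) (star A (3, s) (ev A (web s leg_c_table) [v, c])) ?Y)
      = scalar A s (ev A (web s pair_leg_c_table) [?v, ?c, ?Y])"
    by (rule pairing_leg_c[OF v c leg_y_in[OF e y]])
  also have "ev A (web s pair_leg_c_table) [?v, ?c, ?Y] = ev A (web s cross_table) [?v, ?c, e, y]"
    using ev_glue[OF drawn_pair_leg_c[of s] drawn_leg_y[of s] drawn_cross[of s] _ _ glue_pair_leg_c_leg_y,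
      of "[?v, ?c, e, y]"] e y vc by simp
  also have "\<dots> = ev A (web s triple_table) [?c, ev A (web s fourier_mult_table) [?v, e], y]"
    using ev_glue[OF drawn_triple[of s] drawn_fourier_mult[of s] drawn_cross[of s] _ _ glue_triple_fourier_mult,
      of "[?v, ?c, e, y]"] e y vc by simp
  also have "ev A (web s fourier_mult_table) [?v, e] = fourier A (\<not> s) ?m"
    using ev_glue[OF drawn_rotation[of s] drawn_mult2[of "\<not> s"] drawn_fourier_mult[of s] _ _ glue_rotation_mult2,
      of "[?v, e]"] e vc m by (simp add: fourier_ev mult_evs)
  also have "ev A (web s triple_table) [?c, fourier A (\<not> s) ?m, y]
      = ev A (web s pairing2_table) [?c, box_mult A (2, s) (fourier A (\<not> s) ?m) y]"
    using ev_glue[OF drawn_pairing2[of s] drawn_mult2[of s] drawn_triple[of s] _ _ glue_pairing2_mult2,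
      of "[?c, fourier A (\<not> s) ?m, y]"] vc g y by (simp add: mult_evs)
  finally show ?thesis using vc g y by (simp add: tr_pairing2 mult_in)
qed

text \<open>
  Turning both boxes of a pairing does not change the diagram on the sphere, only the region at
  infinity.
\<close>

lemma Plancherel_neg:
  assumes x: "x \<in> box_space A (2, \<not> s)"
  shows "tr A (2, s) (box_mult A (2, s) (star A (2, s) (fourier A (\<not> s) x)) (fourier A (\<not> s) x))
    = tr A (2, \<not> s) (box_mult A (2, \<not> s) (star A (2, \<not> s) x) x)"
proof -
  let ?x = "star A (2, \<not> s) x" and ?F = "fourier A (\<not> s) x"
  have F: "?F \<in> box_space A (2, s)" using fourier_in[OF x] by simp
  note xs = star_box(1)[OF x]
  have Fs: "star A (2, s) ?F = ev A (mirror (fourier_tangle (\<not> s))) [?x]"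
    using ev_star[OF drawn_rotation[of s] drawn_mirror_rotation[of s], of "[x]"] x by (simp add: fourier_ev)
  have "tr A (2, s) (box_mult A (2, s) (star A (2, s) ?F) ?F) = scalar A s (ev A (web s pairing2_table) [star A (2, s) ?F, ?F])"
    by (rule tr_pairing2[OF star_box(1)[OF F] F])
  also have "ev A (web s pairing2_table) [star A (2, s) ?F, ?F] = ev A (web s pair_fourier_table) [?x, ?F]"
    using ev_glue[OF drawn_pairing2[of s] drawn_mirror_rotation[of s] drawn_pair_fourier[of s] _ _ glue_pairing2_mirror_rotation,
      of "[?x, ?F]"] F xs by (simp add: Fs)
  also have "\<dots> = ev A (move_infinity 1 (web (\<not> s) pairing2_table)) [?x, x]"
  proof -
    have fit: "fits A (\<not> s) pairing2_moved_table [?x, x]" using x xs by simp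
    have shades: "s = (s \<noteq> False)" "(\<not> s) = (s \<noteq> True)" by simp_all
    have "ev A (move_infinity 1 (web (\<not> s) pairing2_table)) [?x, x] = ev A (web s pair_fourier_table)
        ((map ((!) [?x, x]) [0, 0])[1 := ev A (fourier_tangle (\<not> s)) (map ((!) [?x, x]) [1])])"
      by (rule ev_glue[OF drawn_pair_fourier drawn_rotation drawn_pairing2_moved shades glue_pair_fourier_rotation fit])
    then show ?thesis by (simp add: fourier_ev[OF x])
  qed
  finally show ?thesis by (simp only: moved_pairing[OF xs x])
qed

lemma Plancherel:
  assumes x: "x \<in> box_space A (2, s)"
  shows "norm2 A (2, \<not> s) (fourier A s x) = norm2 A (2, s) x"
  using Plancherel_neg[of x "\<not> s"] x by (simp add: norm2_def)

text \<open>
  The mirror image of a clockwise turn is the anticlockwise turn, the inverse of the Fourier transform.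
\<close>

lemma fourier_star_fourier:
  assumes x: "x \<in> box_space A (2, s)"
  shows "fourier A (\<not> s) (star A (2, \<not> s) (fourier A s x)) = star A (2, s) x"
proof -
  note xs = star_box(1)[OF x] and F = fourier_in[OF x]
  have "star A (2, \<not> s) (fourier A s x) = ev A (mirror (fourier_tangle s)) [star A (2, s) x]"
    using ev_star[OF drawn_rotation[of "\<not> s"] drawn_mirror_rotation[of "\<not> s"], of "[x]"] x fourier_ev[of x "\<not> s"]
    by simp
  then show ?thesis
    using ev_glue[OF drawn_rotation[of s] drawn_mirror_rotation[of "\<not> s"] drawn_id2[of s] _ _ glue_rotation_mirror_rotation,
      of "[star A (2, s) x]"] xs fourier_ev[OF star_box(1)[OF F]]
    by (simp add: identity_evs)
qed

end



section \<open>Schatten norms\<close>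

text \<open>
  The weighted inequality of arithmetic and geometric means of \<open>x\<close> and \<open>1\<close>.
\<close>

lemma powr_le_affine:
  fixes x l :: real
  assumes "0 \<le> x" "0 < l" "l \<le> 1"
  shows "x powr l \<le> l * x + (1 - l)"
proof (cases "x = 0")
  case False
  with assms have "0 < x" by simp
  have "convex_on UNIV exp" by (rule exp_convex)
  then have "exp ((1 - l) *\<^sub>R 0 + l *\<^sub>R ln x) \<le> (1 - l) * exp 0 + l * exp (ln x)"
    using assms by (intro convex_onD) auto
  then show ?thesis using \<open>0 < x\<close> by (simp add: powr_def algebra_simps)
qed (use assms in simp)

text \<open>
  The power mean inequality, with \<open>t = 1/p\<close> as parameter; the total weight may be smaller than \<open>W\<close>.
\<close>

lemma power_mean_sum:
  fixes w x :: "'i \<Rightarrow> real"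
  assumes fin: "finite I" and w: "\<And>i. i \<in> I \<Longrightarrow> 0 < w i" and x: "\<And>i. i \<in> I \<Longrightarrow> 0 < x i"
    and W: "(\<Sum>i\<in>I. w i) \<le> W" and t: "0 < t'" "t' \<le> t"
  shows "(\<Sum>i\<in>I. w i * x i powr (1 / t)) powr t \<le> W powr (t - t') * (\<Sum>i\<in>I. w i * x i powr (1 / t')) powr t'"
proof (cases "I = {}")
  case False
  define W0 where "W0 = (\<Sum>i\<in>I. w i)"
  define S where "S = (\<Sum>i\<in>I. w i * x i powr (1 / t'))"
  define l where "l = t' / t"
  have pos: "0 < W0" "0 < S" unfolding W0_def S_def using fin False w x by (auto intro!: sum_pos simp: less_imp_neq[symmetric])
  have l: "0 < l" "l \<le> 1" "1 / t' * l = 1 / t" using t by (auto simp: l_def)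
  have "(\<Sum>i\<in>I. w i * x i powr (1 / t)) * (W0 / S) powr l = (\<Sum>i\<in>I. w i * (x i powr (1 / t') * (W0 / S)) powr l)"
    unfolding sum_distrib_right
  proof (intro sum.cong refl)
    fix i assume i: "i \<in> I"
    have "(x i powr (1 / t') * (W0 / S)) powr l = x i powr (1 / t) * (W0 / S) powr l"
      by (subst powr_mult) (use pos l in \<open>auto simp: powr_powr\<close>)
    then show "w i * x i powr (1 / t) * (W0 / S) powr l = w i * (x i powr (1 / t') * (W0 / S)) powr l" by simp
  qed
  also have "\<dots> \<le> (\<Sum>i\<in>I. w i * (l * (x i powr (1 / t') * (W0 / S)) + (1 - l)))"
    using w l pos by (intro sum_mono mult_left_mono powr_le_affine) (auto intro: less_imp_le)
  also have "\<dots> = (\<Sum>i\<in>I. (l * (W0 / S)) * (w i * x i powr (1 / t')) + (1 - l) * w i)"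
    by (intro sum.cong refl) (simp add: algebra_simps)
  also have "\<dots> = l * (W0 / S) * S + (1 - l) * W0"
    unfolding sum.distrib sum_distrib_left[symmetric] S_def[symmetric] W0_def[symmetric] ..
  also have "\<dots> = W0" using pos by (simp add: algebra_simps)
  finally have "(\<Sum>i\<in>I. w i * x i powr (1 / t)) \<le> W0 / (W0 / S) powr l"
    using pos by (simp add: pos_le_divide_eq)
  also have "\<dots> = W0 powr (1 - l) * S powr l"
    using pos by (simp add: powr_divide powr_diff)
  finally have "(\<Sum>i\<in>I. w i * x i powr (1 / t)) powr t \<le> (W0 powr (1 - l) * S powr l) powr t"
    using w t by (intro powr_mono2) (auto intro!: sum_nonneg mult_nonneg_nonneg simp: less_imp_le)
  also have "\<dots> = W0 powr (t - t') * S powr t'"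
  proof -
    have "(1 - l) * t = t - t'" "l * t = t'" using t by (auto simp: l_def field_simps)
    then show ?thesis by (simp add: powr_mult powr_powr)
  qed
  also have "\<dots> \<le> W powr (t - t') * S powr t'"
    using W pos t by (intro mult_right_mono powr_mono2) (auto simp: W0_def)
  finally show ?thesis by (simp add: S_def)
qed (use t in simp)

lemma single_le_power_sum:
  fixes w x :: "'i \<Rightarrow> real"
  assumes fin: "finite I" and w: "\<And>i. i \<in> I \<Longrightarrow> 1 \<le> w i" and x: "\<And>i. i \<in> I \<Longrightarrow> 0 < x i"
    and t: "0 < t" and i: "i \<in> I"
  shows "x i \<le> (\<Sum>i\<in>I. w i * x i powr (1 / t)) powr t"
proof -
  have "x i powr (1 / t) \<le> w i * x i powr (1 / t)" using w[OF i] by (simp add: mult_le_cancel_right1)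
  also have "\<dots> \<le> (\<Sum>i\<in>I. w i * x i powr (1 / t))"
  proof (rule member_le_sum[OF i _ fin])
    fix j assume "j \<in> I - {i}"
    then have "0 \<le> w j" using w[of j] by simp
    then show "0 \<le> w j * x j powr (1 / t)" by simp
  qed
  finally have "(x i powr (1 / t)) powr t \<le> (\<Sum>i\<in>I. w i * x i powr (1 / t)) powr t"
    using t by (intro powr_mono2) auto
  then show ?thesis using t x[OF i] by (simp add: powr_powr)
qed

text \<open>
  If all weights are at least \<open>1\<close>, each entry is bounded by the norm, as for \<open>l\<^sup>p\<close> norms of counting measures.
\<close>

lemma power_sum_antimono:
  fixes w x :: "'i \<Rightarrow> real"
  assumes fin: "finite I" and w: "\<And>i. i \<in> I \<Longrightarrow> 1 \<le> w i" and x: "\<And>i. i \<in> I \<Longrightarrow> 0 < x i"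
    and t: "0 < t'" "t' \<le> t"
  shows "(\<Sum>i\<in>I. w i * x i powr (1 / t')) powr t' \<le> (\<Sum>i\<in>I. w i * x i powr (1 / t)) powr t"
proof (cases "I = {}")
  case False
  define S where "S = (\<Sum>i\<in>I. w i * x i powr (1 / t))"
  have wp: "0 < w i" if "i \<in> I" for i using w[OF that] by simp
  have S: "0 < S" unfolding S_def using fin False wp x by (auto intro!: sum_pos simp: less_imp_neq[symmetric])
  define N where "N = S powr t"
  have N: "0 < N" using S by (simp add: N_def)
  have le: "x i \<le> N" if "i \<in> I" for i
    unfolding N_def S_def using fin w x t that by (intro single_le_power_sum) auto
  have d: "0 \<le> 1 / t' - 1 / t" using t by (simp add: frac_le)
  have "(\<Sum>i\<in>I. w i * x i powr (1 / t')) \<le> (\<Sum>i\<in>I. w i * x i powr (1 / t) * N powr (1 / t' - 1 / t))"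
  proof (rule sum_mono)
    fix i assume i: "i \<in> I"
    have "x i powr (1 / t') = x i powr (1 / t) * x i powr (1 / t' - 1 / t)"
      by (simp flip: powr_add)
    also have "\<dots> \<le> x i powr (1 / t) * N powr (1 / t' - 1 / t)"
      using le[OF i] x[OF i] d by (intro mult_left_mono powr_mono2) auto
    finally show "w i * x i powr (1 / t') \<le> w i * x i powr (1 / t) * N powr (1 / t' - 1 / t)"
      using wp[OF i] by (simp add: mult.assoc)
  qed
  also have "\<dots> = S * N powr (1 / t' - 1 / t)" by (simp add: S_def sum_distrib_right)
  also have "S = N powr (1 / t)" using S t by (simp add: N_def powr_powr)
  also have "N powr (1 / t) * N powr (1 / t' - 1 / t) = N powr (1 / t')" by (simp flip: powr_add)
  finally have "(\<Sum>i\<in>I. w i * x i powr (1 / t')) powr t' \<le> (N powr (1 / t')) powr t'"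
    using wp t by (intro powr_mono2) (auto intro!: sum_nonneg mult_nonneg_nonneg simp: less_imp_le)
  also have "\<dots> = N" using N t by (simp add: powr_powr)
  finally show ?thesis by (simp add: N_def S_def)
qed (use t in simp)

text \<open>
  The norm with exponent \<open>p = 1/t\<close>. The inequalities are linear in \<open>t\<close>, and \<open>t = 0\<close> stands for the
  operator norm.
\<close>

definition schatten :: "'a::ab_group_add planar_structure \<Rightarrow> colour \<Rightarrow> real \<Rightarrow> 'a \<Rightarrow> real" where
  "schatten A k t x = p_norm A k (if t = 0 then \<infinity> else ereal (1 / t)) x"

lemma p_norm_schatten: "0 < p \<Longrightarrow> p_norm A k p x = schatten A k (recip p) x"
  by (cases p) (auto simp: schatten_def recip_def one_ereal_def)

lemma recip_nonneg: "0 < p \<Longrightarrow> 0 \<le> recip p"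
  by (cases p) (auto simp: recip_def one_ereal_def)

context box_algebra
begin

lemma svd_isometry: "svd x I u \<Longrightarrow> i \<in> I \<Longrightarrow> u i \<odot> (u i)\<^sup>\<dagger> \<odot> u i = u i"
  unfolding svd_def by blast

lemma schatten_0: "schatten A k 0 x = op_norm A k x"
  by (simp add: schatten_def p_norm_def)

lemma schatten_svd: "svd x I u \<Longrightarrow> 0 < t \<Longrightarrow> schatten A k t x = (\<Sum>i\<in>I. weight (u i) * i powr (1 / t)) powr t"
  using p_norm_svd_finite[of x I u "1 / t"] by (simp add: schatten_def)

lemma weight_star: "u \<in> V \<Longrightarrow> weight (u\<^sup>\<dagger>) = weight u"
  by (simp add: weight_def ip_def tr_commute)

lemma op_norm_nonneg:
  assumes s: "svd x I u"
  shows "0 \<le> op_norm A k x"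
proof (cases "I = {}")
  case True
  let ?Y = "{y \<in> V. norm2 A k y \<le> 1}"
  have Y: "0 \<in> ?Y" by simp
  have x0: "x = 0" using svd_sum[OF s] True by simp
  have "(\<lambda>y. norm2 A k (x \<odot> y)) ` ?Y = (\<lambda>y. 0) ` ?Y" by (intro image_cong refl) (simp add: x0)
  also have "\<dots> = {0}" by (rule image_constant[OF Y])
  finally show ?thesis by (simp add: op_norm_def)
next
  case False
  then obtain j where j: "j \<in> I" by auto
  from svd_pos[OF s j] op_norm_bounds(1)[OF s j] show ?thesis by simp
qed

text \<open>
  The singular values of \<open>x\<^sup>*\<close> and their weights are those of \<open>x\<close>.
\<close>

lemma schatten_star:
  assumes x: "x \<in> V" and t: "0 \<le> t"
  shows "schatten A k t (x\<^sup>\<dagger>) = schatten A k t x"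
proof -
  obtain I u where s: "svd x I u" using svd_exists[OF x] .
  note s' = svd_star[OF s]
  show ?thesis
  proof (cases "t = 0")
    case True
    have "op_norm A k (x\<^sup>\<dagger>) = op_norm A k x"
    proof (rule antisym)
      show "op_norm A k (x\<^sup>\<dagger>) \<le> op_norm A k x"
        by (rule op_norm_bounds(2)[OF s' op_norm_bounds(1)[OF s] op_norm_nonneg[OF s]])
      show "op_norm A k x \<le> op_norm A k (x\<^sup>\<dagger>)"
        by (rule op_norm_bounds(2)[OF s op_norm_bounds(1)[OF s'] op_norm_nonneg[OF s']])
    qed
    with True show ?thesis by (simp add: schatten_0)
  next
    case False
    with t have t0: "0 < t" by simp
    show ?thesis unfolding schatten_svd[OF s t0] schatten_svd[OF s' t0]
      using svd_closed[OF s] by (simp add: weight_star)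
  qed
qed

lemma schatten_nonneg:
  assumes x: "x \<in> V" and t: "0 \<le> t"
  shows "0 \<le> schatten A k t x"
proof -
  obtain I u where s: "svd x I u" using svd_exists[OF x] .
  show ?thesis
  proof (cases "t = 0")
    case True
    then show ?thesis using op_norm_nonneg[OF s] by (simp add: schatten_0)
  next
    case False
    with t have "0 < t" by simp
    from schatten_svd[OF s this] show ?thesis by simp
  qed
qed

lemma schatten_half: "x \<in> V \<Longrightarrow> schatten A k (1 / 2) x = norm2 A k x"
proof -
  assume x: "x \<in> V"
  obtain I u where s: "svd x I u" using svd_exists[OF x] .
  have "(norm2 A k x)\<^sup>2 = (\<Sum>i\<in>I. weight (u i) * (cmod (complex_of_real i))\<^sup>2)"
    using norm2_svd[OF s, of complex_of_real] svd_sum[OF s] by simp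
  also have "\<dots> = (\<Sum>i\<in>I. weight (u i) * i powr 2)"
    by (intro sum.cong refl) (simp add: powr_numeral svd_pos[OF s] less_imp_le)
  finally have "schatten A k (1 / 2) x = ((norm2 A k x)\<^sup>2) powr (1 / 2)"
    using schatten_svd[OF s, of "1 / 2"] by simp
  then show ?thesis using norm2_nonneg[OF x] by (simp add: powr_half_sqrt)
qed

lemma schatten_mean:
  assumes x: "x \<in> V" and t: "0 \<le> t'" "t' \<le> t"
  shows "schatten A k t x \<le> Re (tr A k one) powr (t - t') * schatten A k t' x"
proof (cases "t = t'")
  case True
  have "0 < Re (tr A k one) \<or> x = 0"
  proof (cases "one = 0")
    case True
    then show ?thesis using unit_left[OF x] x by simp
  next
    case False
    then show ?thesis using tr_positive[of one] by simp
  qed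
  moreover have "schatten A k t x = 0" if "x = 0" "0 \<le> t"
  proof -
    have s: "svd x {} (\<lambda>_. 0)" using that by (simp add: svd_def)
    show ?thesis
    proof (cases "t = 0")
      case True
      have "op_norm A k x \<le> 0" by (rule op_norm_bounds(2)[OF s]) auto
      with schatten_nonneg[OF x, of 0] True show ?thesis by (simp add: schatten_0)
    qed (use that schatten_svd[OF s] in simp)
  qed
  ultimately show ?thesis using True t by auto
next
  case False
  with t have t0: "0 < t" "t' < t" by auto
  obtain I u where s: "svd x I u" using svd_exists[OF x] .
  show ?thesis
  proof (cases "t' = 0")
    case True
    let ?M = "op_norm A k x"
    have M: "0 \<le> ?M" using schatten_nonneg[OF x, of 0] by (simp add: schatten_0)
    have "(\<Sum>i\<in>I. weight (u i) * i powr (1 / t)) \<le> (\<Sum>i\<in>I. weight (u i)) * ?M powr (1 / t)"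
      unfolding sum_distrib_right
      using op_norm_bounds(1)[OF s] svd_pos[OF s] weight_pos[OF s] t0
      by (intro sum_mono mult_left_mono powr_mono2) (auto intro: less_imp_le)
    also have "\<dots> \<le> Re (tr A k one) * ?M powr (1 / t)"
      by (intro mult_right_mono sum_weight_le[OF s]) simp
    finally have "schatten A k t x \<le> (Re (tr A k one) * ?M powr (1 / t)) powr t"
      unfolding schatten_svd[OF s t0(1)] using weight_pos[OF s] t0
      by (intro powr_mono2) (auto intro!: sum_nonneg mult_nonneg_nonneg simp: less_imp_le)
    also have "\<dots> = Re (tr A k one) powr t * ?M"
      using M t0 by (simp add: powr_mult powr_powr)
    finally show ?thesis using True by (simp add: schatten_0)
  next
    case False
    with t have "0 < t'" by simp
    then show ?thesis
      unfolding schatten_svd[OF s t0(1)] schatten_svd[OF s \<open>0 < t'\<close>]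
      using svd_finite[OF s] weight_pos[OF s] svd_pos[OF s] sum_weight_le[OF s] t by (intro power_mean_sum) auto
  qed
qed

lemma schatten_antimono:
  assumes x: "x \<in> V" and t: "0 \<le> t'" "t' \<le> t"
    and w: "\<And>u. u \<in> V \<Longrightarrow> u \<noteq> 0 \<Longrightarrow> u \<odot> u\<^sup>\<dagger> \<odot> u = u \<Longrightarrow> 1 \<le> weight u"
  shows "schatten A k t' x \<le> schatten A k t x"
proof (cases "t = t'")
  case False
  with t have t0: "0 < t" by auto
  obtain I u where s: "svd x I u" using svd_exists[OF x] .
  have ws: "1 \<le> weight (u i)" if "i \<in> I" for i
    by (rule w[OF svd_closed[OF s that] svd_nonzero[OF s that] svd_isometry[OF s that]])
  show ?thesis
  proof (cases "t' = 0")
    case True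
    show ?thesis unfolding True schatten_0 schatten_svd[OF s t0]
    proof (rule op_norm_bounds(2)[OF s])
      fix i assume i: "i \<in> I"
      show "i \<le> (\<Sum>i\<in>I. weight (u i) * i powr (1 / t)) powr t"
        by (rule single_le_power_sum[where x = "\<lambda>i. i", OF svd_finite[OF s] _ _ t0 i])
          (simp_all add: ws svd_pos[OF s])
    qed simp
  next
    case False
    with t have "0 < t'" by simp
    then show ?thesis
      unfolding schatten_svd[OF s t0(1)] schatten_svd[OF s \<open>0 < t'\<close>]
      by (intro power_sum_antimono[where x = "\<lambda>i. i", OF svd_finite[OF s]])
        (simp_all add: ws svd_pos[OF s] t)
  qed
qed simp

end



section \<open>Norm inequalities for the Fourier transform\<close>

context box_algebra
begin

lemma svd_single: "u \<in> V \<Longrightarrow> u \<noteq> 0 \<Longrightarrow> u \<odot> u\<^sup>\<dagger> \<odot> u = u \<Longrightarrow> svd u {1} (\<lambda>_. u)"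
  unfolding svd_def by auto

lemma ip_svd_self:
  assumes s: "svd x I u" and j: "j \<in> I"
  shows "ip (u j) x = complex_of_real (j * weight (u j))"
proof -
  have "ip (u j) x = ip (u j) (\<Sum>i\<in>I. scl A (complex_of_real i) (u i))"
    using svd_sum[OF s] by (rule arg_cong)
  also have "\<dots> = (\<Sum>i\<in>I. complex_of_real i * ip (u j) (u i))"
    using svd_closed[OF s] j by (simp add: ip_sum_right ip_scale_right)
  also have "\<dots> = (\<Sum>i\<in>I. if i = j then complex_of_real (j * weight (u j)) else 0)"
    using j by (intro sum.cong refl) (auto simp: ip_svd[OF s])
  also have "\<dots> = complex_of_real (j * weight (u j))"
    using j svd_finite[OF s] by (simp add: sum.delta)
  finally show ?thesis .
qed

end

context irreducible_pa
begin

abbreviation "\<delta> \<equiv> loop_value A"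

text \<open>
  That the loop is a positive number follows from positivity of the traces on the 2-box and on the 3-box
  space: \<open>\<tau>(1)\<close> is the square of the loop, and a leg with unit inputs has the cube of the loop as its
  squared norm.
\<close>

lemma loop_scalar_real: "loop_scalar s = of_real \<delta>" and loop_value_pos: "0 < \<delta>"
proof -
  interpret B: box_algebra A "(2, False)" by (rule box_algebra_2)
  interpret C: box_algebra A "(2, True)" by (rule box_algebra_2)
  define L where "L = loop_scalar False"
  have L: "loop_scalar s = L" for s using loop_scalar_shade[of False] by (cases s) (auto simp: L_def)
  have L0: "L \<noteq> 0" using loop_nonzero[of False] by (simp add: L_def)
  have one: "tr A (2, s) (unit_of A (2, s)) = L\<^sup>2" for s by (simp add: tr_one L power2_eq_square)
  have unit: "B.one \<noteq> 0"
  proof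
    assume "B.one = 0"
    then have "tr A (2, False) B.one = 0" using B.tr_zero by simp
    with one[of False] L0 show False by simp
  qed
  then have sq: "L\<^sup>2 \<in> \<real>" "0 < Re (L\<^sup>2)"
    using B.tr_positive[of B.one] one[of False] by simp_all
  define X where "X = ev A (web False leg_c_table) [C.one, B.one]"
  have "X \<in> box_space A (3, False)" unfolding X_def by (rule leg_c_in) simp_all
  have LX: "L * tr A (3, False) (box_mult A (3, False) (star A (3, False) X) X) = L\<^sup>2 * L\<^sup>2"
    using norm_leg_c[of C.one False B.one] one[of False] one[of True] by (simp add: X_def L)
  then have X3: "tr A (3, False) (box_mult A (3, False) (star A (3, False) X) X) = L\<^sup>2 * L"
    using L0 by (simp add: power2_eq_square)
  interpret H: box_hilbert A "(3, False)" by (rule box_hilbert_3)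
  have "X \<noteq> 0"
  proof
    assume "X = 0"
    then have "L\<^sup>2 * L = 0" using X3 by simp
    with L0 show False by simp
  qed
  with H.tr_positive[of X] \<open>X \<in> _\<close> X3 have cube: "L\<^sup>2 * L \<in> \<real>" "0 < Re (L\<^sup>2 * L)" by simp_all
  have "L = (L\<^sup>2 * L) / L\<^sup>2" using L0 by simp
  with cube(1) sq(1) have Lr: "L \<in> \<real>" by (metis Reals_divide)
  then obtain r where r: "L = of_real r" by (auto elim: Reals_cases)
  have "0 < r"
  proof -
    have "0 < r\<^sup>2 * r" using cube(2) by (simp add: r flip: of_real_power of_real_mult)
    then show ?thesis by (simp add: zero_less_mult_iff)
  qed
  moreover have "\<delta> = r"
  proof -
    have "act A (loop_tangle False) (\<lambda>_. undefined) = ev A (loop_tangle False) []"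
      by (rule ev_eq[OF drawn_loop]) simp_all
    then have "\<delta> = Re L" by (simp add: loop_value_def L_def loop_scalar_def)
    then show ?thesis by (simp add: r)
  qed
  ultimately show "loop_scalar s = of_real \<delta>" "0 < \<delta>" by (simp_all add: L r)
qed

lemma tr_one_real: "Re (tr A (2, s) (unit_of A (2, s))) = \<delta>\<^sup>2"
  by (simp add: tr_one loop_scalar_real power2_eq_square)

text \<open>
  The cut of the diagram: the first leg contains \<open>u\<^sup>*\<close> and \<open>c\<close>, the second the initial projection of \<open>u\<close>
  and \<open>y\<close>.
\<close>

lemma partial_isometry_bound_neg:
  assumes u: "u \<in> box_space A (2, \<not> s)"
    and iso: "box_mult A (2, \<not> s) (box_mult A (2, \<not> s) u (star A (2, \<not> s) u)) u = u"
    and c: "c \<in> box_space A (2, s)" and y: "y \<in> box_space A (2, s)"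
  shows "cmod (box_hilbert.ip A (2, s) c (box_mult A (2, s) (fourier A (\<not> s) u) y))
    \<le> box_algebra.weight A (2, \<not> s) u / \<delta> * norm2 A (2, s) c * norm2 A (2, s) y"
proof -
  interpret B: box_algebra A "(2, s)" by (rule box_algebra_2)
  interpret C: box_algebra A "(2, \<not> s)" by (rule box_algebra_2)
  interpret H: box_hilbert A "(3, s)" by (rule box_hilbert_3)
  let ?v = "star A (2, \<not> s) u" and ?e = "box_mult A (2, \<not> s) (star A (2, \<not> s) u) u"
  have v: "?v \<in> box_space A (2, \<not> s)" and e: "?e \<in> box_space A (2, \<not> s)" using u by simp_all
  define X where "X = ev A (web s leg_c_table) [?v, c]"
  define Y where "Y = ev A (web s leg_y_table) [?e, y]"
  have X: "X \<in> box_space A (3, s)" and Y: "Y \<in> box_space A (3, s)"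
    unfolding X_def Y_def using leg_c_in[OF v c] leg_y_in[OF e y] by simp_all
  have ue: "box_mult A (2, \<not> s) u ?e = u" using iso u by (simp add: C.assoc)
  have XY: "H.ip X Y = B.ip c (box_mult A (2, s) (fourier A (\<not> s) u) y)"
    unfolding H.ip_def B.ip_def X_def Y_def cross_pairing[OF v c e y] using u by (simp add: ue)
  have w: "C.ip u u = of_real (C.weight u)" using C.ip_self_real[OF u] by (simp add: C.weight_def)
  have uu: "tr A (2, \<not> s) (box_mult A (2, \<not> s) u ?v) = of_real (C.weight u)"
    using w u C.tr_commute[of u ?v] by (simp add: C.ip_def)
  have ee: "tr A (2, \<not> s) (box_mult A (2, \<not> s) (star A (2, \<not> s) ?e) ?e) = of_real (C.weight u)"
  proof -
    have "box_mult A (2, \<not> s) (star A (2, \<not> s) ?e) ?e = ?e"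
      using u ue by (simp add: C.star_mult C.assoc)
    then show ?thesis using w by (simp add: C.ip_def)
  qed
  have "of_real \<delta> * H.ip X X = of_real (C.weight u) * B.ip c c"
    using norm_leg_c[OF v c] u uu by (simp add: H.ip_def B.ip_def X_def loop_scalar_real)
  then have "of_real (\<delta> * (norm2 A (3, s) X)\<^sup>2) = (of_real (C.weight u * (norm2 A (2, s) c)\<^sup>2) :: complex)"
    by (simp add: H.ip_self[OF X] B.ip_self[OF c])
  then have X2: "(norm2 A (3, s) X)\<^sup>2 = C.weight u / \<delta> * (norm2 A (2, s) c)\<^sup>2"
    using loop_value_pos by (simp only: of_real_eq_iff) (simp add: field_simps)
  have "of_real \<delta> * H.ip Y Y = of_real (C.weight u) * B.ip y y"
    using norm_leg_y[OF e y] ee B.tr_commute[of y "star A (2, s) y"] y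
    by (simp add: H.ip_def B.ip_def Y_def loop_scalar_real)
  then have "of_real (\<delta> * (norm2 A (3, s) Y)\<^sup>2) = (of_real (C.weight u * (norm2 A (2, s) y)\<^sup>2) :: complex)"
    by (simp add: H.ip_self[OF Y] B.ip_self[OF y])
  then have Y2: "(norm2 A (3, s) Y)\<^sup>2 = C.weight u / \<delta> * (norm2 A (2, s) y)\<^sup>2"
    using loop_value_pos by (simp only: of_real_eq_iff) (simp add: field_simps)
  have w0: "0 \<le> C.weight u" using C.ip_self_nonneg[OF u] by (simp add: C.weight_def)
  have "(norm2 A (3, s) X * norm2 A (3, s) Y)\<^sup>2 = (C.weight u / \<delta> * norm2 A (2, s) c * norm2 A (2, s) y)\<^sup>2"
    by (simp add: power_mult_distrib X2 Y2) (simp add: power2_eq_square mult_ac)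
  then have "norm2 A (3, s) X * norm2 A (3, s) Y = C.weight u / \<delta> * norm2 A (2, s) c * norm2 A (2, s) y"
    using w0 loop_value_pos H.norm2_nonneg[OF X] H.norm2_nonneg[OF Y] B.norm2_nonneg[OF c] B.norm2_nonneg[OF y]
    by (simp add: power2_eq_iff_nonneg)
  with H.Cauchy_Schwarz[OF X Y] show ?thesis by (simp add: XY)
qed

lemma partial_isometry_pairing:
  assumes u: "u \<in> box_space A (2, s)"
    and iso: "box_mult A (2, s) (box_mult A (2, s) u (star A (2, s) u)) u = u"
    and g: "g \<in> box_space A (2, \<not> s)"
    and iso': "box_mult A (2, \<not> s) (box_mult A (2, \<not> s) g (star A (2, \<not> s) g)) g = g"
  shows "cmod (box_hilbert.ip A (2, \<not> s) g (fourier A s u))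
    \<le> box_algebra.weight A (2, s) u * box_algebra.weight A (2, \<not> s) g / \<delta>"
proof -
  interpret C: box_algebra A "(2, \<not> s)" by (rule box_algebra_2)
  (* The initial projection f of g can be moved to the right of the Fourier transform, as g = g f. *)
  define f where "f = box_mult A (2, \<not> s) (star A (2, \<not> s) g) g"
  have f: "f \<in> box_space A (2, \<not> s)" using g by (simp add: f_def)
  have F: "fourier A s u \<in> box_space A (2, \<not> s)" by (rule fourier_in[OF u])
  have gf: "box_mult A (2, \<not> s) g f = g" using iso' g by (simp add: f_def C.assoc)
  have fs: "star A (2, \<not> s) f = f" using g by (simp add: f_def C.star_mult)
  have ff: "box_mult A (2, \<not> s) f f = f"
  proof -
    have "box_mult A (2, \<not> s) f f = box_mult A (2, \<not> s) (star A (2, \<not> s) g) (box_mult A (2, \<not> s) g f)"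
      using g f by (subst (1) f_def) (simp add: C.assoc)
    then show ?thesis by (simp add: gf) (simp add: f_def)
  qed
  have "C.ip g (fourier A s u) = C.ip (box_mult A (2, \<not> s) g f) (fourier A s u)" by (simp add: gf)
  also have "\<dots> = C.ip f (box_mult A (2, \<not> s) (star A (2, \<not> s) g) (fourier A s u))"
    by (rule C.ip_mult_left[OF g f F])
  also have "\<dots> = tr A (2, \<not> s) (box_mult A (2, \<not> s) f (box_mult A (2, \<not> s) (star A (2, \<not> s) g) (fourier A s u)))"
    by (simp add: C.ip_def fs)
  also have "\<dots> = tr A (2, \<not> s) (box_mult A (2, \<not> s) (box_mult A (2, \<not> s) (star A (2, \<not> s) g) (fourier A s u)) f)"
    using f g F by (intro C.tr_commute) simp_all
  also have "\<dots> = C.ip g (box_mult A (2, \<not> s) (fourier A s u) f)"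
    using f g F by (simp add: C.ip_def C.assoc)
  finally have eq: "C.ip g (fourier A s u) = C.ip g (box_mult A (2, \<not> s) (fourier A s u) f)" .
  have w: "(norm2 A (2, \<not> s) g)\<^sup>2 = C.weight g" using C.norm2_power2[OF g] by (simp add: C.weight_def)
  have "(norm2 A (2, \<not> s) f)\<^sup>2 = C.weight g"
    using C.norm2_power2[OF f] by (simp add: C.ip_def C.weight_def fs ff) (simp add: f_def)
  with w have nf: "norm2 A (2, \<not> s) f = norm2 A (2, \<not> s) g"
    by (intro power2_eq_imp_eq[OF _ C.norm2_nonneg[OF f] C.norm2_nonneg[OF g]]) simp
  have "cmod (C.ip g (box_mult A (2, \<not> s) (fourier A s u) f))
      \<le> box_algebra.weight A (2, s) u / \<delta> * norm2 A (2, \<not> s) g * norm2 A (2, \<not> s) f"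
    using partial_isometry_bound_neg[of u "\<not> s" g f] u iso g f by simp
  also have "\<dots> = box_algebra.weight A (2, s) u / \<delta> * (norm2 A (2, \<not> s) g)\<^sup>2"
    by (simp add: nf power2_eq_square)
  also have "\<dots> = box_algebra.weight A (2, s) u * C.weight g / \<delta>" by (simp add: w)
  finally show ?thesis by (simp add: eq)
qed

lemma fourier_sum:
  "(\<And>i. i \<in> I \<Longrightarrow> f i \<in> box_space A (2, s)) \<Longrightarrow> fourier A s (\<Sum>i\<in>I. f i) = (\<Sum>i\<in>I. fourier A s (f i))"
proof (induction I rule: infinite_finite_induct)
  have "fourier A s (scl A 0 0) = scl A 0 (fourier A s 0)"
    by (rule fourier_linear(1)) (rule subspace_0[OF space])
  then have "fourier A s 0 = 0" by simp
  then show "fourier A s (\<Sum>i\<in>I. f i) = (\<Sum>i\<in>I. fourier A s (f i))" if "infinite I" for I using that by simp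
  show "fourier A s (\<Sum>i\<in>{}. f i) = (\<Sum>i\<in>{}. fourier A s (f i))" using \<open>fourier A s 0 = 0\<close> by simp
next
  case (insert i I)
  then show ?case by (simp add: fourier_linear(2) subspace_sum[OF space])
qed

text \<open>
  Each singular value \<open>j\<close> of \<open>F(x)\<close> is \<open>\<langle>g\<^sub>j, F(x)\<rangle>\<close> divided by the weight of \<open>g\<^sub>j\<close>, and \<open>x\<close> is a combination of
  partial isometries.
\<close>

lemma Hausdorff_Young_end:
  assumes x: "x \<in> box_space A (2, s)"
  shows "schatten A (2, \<not> s) 0 (fourier A s x) \<le> \<delta> powr (- 1) * schatten A (2, s) 1 x"
proof -
  interpret B: box_algebra A "(2, s)" by (rule box_algebra_2)
  interpret C: box_algebra A "(2, \<not> s)" by (rule box_algebra_2)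
  obtain I u where su: "B.svd x I u" using B.svd_exists[OF x] .
  obtain J g where sg: "C.svd (fourier A s x) J g" using C.svd_exists[OF fourier_in[OF x]] .
  let ?N = "\<Sum>i\<in>I. B.weight (u i) * i"
  have N: "schatten A (2, s) 1 x = ?N"
    using B.schatten_svd[OF su, of 1] B.svd_pos[OF su] B.weight_pos[OF su]
    by (simp add: sum_nonneg less_imp_le cong: sum.cong)
  have "j \<le> \<delta> powr (- 1) * ?N" if j: "j \<in> J" for j
  proof -
    have gj: "g j \<in> box_space A (2, \<not> s)" using C.svd_closed[OF sg j] .
    have wj: "0 < C.weight (g j)" by (rule C.weight_pos[OF sg j])
    note 1 = C.ip_svd_self[OF sg j]
    have "fourier A s x = (\<Sum>i\<in>I. scl A (of_real i) (fourier A s (u i)))"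
      using B.svd_closed[OF su]
      by (subst B.svd_sum[OF su]) (simp add: fourier_sum fourier_linear(1))
    then have 2: "C.ip (g j) (fourier A s x) = (\<Sum>i\<in>I. of_real i * C.ip (g j) (fourier A s (u i)))"
      using gj B.svd_closed[OF su] by (simp add: C.ip_sum_right C.ip_scale_right fourier_in)
    have "j * C.weight (g j) = cmod (C.ip (g j) (fourier A s x))"
      unfolding 1 using wj C.svd_pos[OF sg j] by (simp del: of_real_mult)
    also have "\<dots> \<le> (\<Sum>i\<in>I. i * (B.weight (u i) * C.weight (g j) / \<delta>))"
      unfolding 2
    proof (rule sum_norm_le)
      fix i assume i: "i \<in> I"
      have "cmod (C.ip (g j) (fourier A s (u i))) \<le> B.weight (u i) * C.weight (g j) / \<delta>"
        by (rule partial_isometry_pairing[OF B.svd_closed[OF su i] B.svd_isometry[OF su i]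
              C.svd_closed[OF sg j] C.svd_isometry[OF sg j]])
      then have "i * cmod (C.ip (g j) (fourier A s (u i))) \<le> i * (B.weight (u i) * C.weight (g j) / \<delta>)"
        using B.svd_pos[OF su i] by (intro mult_left_mono) simp_all
      then show "cmod (of_real i * C.ip (g j) (fourier A s (u i))) \<le> i * (B.weight (u i) * C.weight (g j) / \<delta>)"
        using B.svd_pos[OF su i] by (simp add: norm_mult)
    qed
    also have "\<dots> = (?N / \<delta>) * C.weight (g j)"
      unfolding sum_divide_distrib sum_distrib_right by (intro sum.cong refl) simp
    finally have "j \<le> ?N / \<delta>" using wj by (rule mult_right_le_imp_le)
    then show ?thesis using loop_value_pos by (simp add: powr_minus_divide)
  qed
  moreover have "0 \<le> \<delta> powr (- 1) * ?N"
    using B.svd_pos[OF su] B.weight_pos[OF su] by (intro mult_nonneg_nonneg sum_nonneg) (auto intro: less_imp_le)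
  ultimately show ?thesis unfolding N C.schatten_0 by (rule C.op_norm_bounds(2)[OF sg])
qed

text \<open>
  A nonzero partial isometry has operator norm \<open>1\<close>, and is up to an adjoint the transform of the adjoint of
  its own transform.
\<close>

lemma weight_ge_one:
  assumes u: "u \<in> box_space A (2, s)" "u \<noteq> 0"
    and iso: "box_mult A (2, s) (box_mult A (2, s) u (star A (2, s) u)) u = u"
  shows "1 \<le> box_algebra.weight A (2, s) u"
proof -
  interpret B: box_algebra A "(2, s)" by (rule box_algebra_2)
  interpret C: box_algebra A "(2, \<not> s)" by (rule box_algebra_2)
  let ?h = "star A (2, \<not> s) (fourier A s u)"
  have F: "fourier A s u \<in> box_space A (2, \<not> s)" by (rule fourier_in[OF u(1)])
  then have h: "?h \<in> box_space A (2, \<not> s)" by simp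
  have "B.svd u {1} (\<lambda>_. u)" by (rule B.svd_single[OF u iso])
  from B.op_norm_bounds(1)[OF B.svd_star[OF this]] have "1 \<le> schatten A (2, s) 0 (star A (2, s) u)"
    by (simp add: B.schatten_0)
  also have "\<dots> \<le> \<delta> powr (- 1) * schatten A (2, \<not> s) 1 ?h"
    using Hausdorff_Young_end[OF h] u by (simp add: fourier_star_fourier)
  also have "\<dots> \<le> \<delta> powr (- 1) * (\<delta>\<^sup>2 powr (1 - 1 / 2) * schatten A (2, \<not> s) (1 / 2) ?h)"
    using C.schatten_mean[OF h, of "1 / 2" 1] by (intro mult_left_mono) (simp_all add: tr_one_real)
  also have "\<delta>\<^sup>2 powr (1 - 1 / 2) = \<delta>" using loop_value_pos by (simp add: powr_half_sqrt)
  also have "\<delta> powr (- 1) * (\<delta> * schatten A (2, \<not> s) (1 / 2) ?h) = schatten A (2, \<not> s) (1 / 2) ?h"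
    using loop_value_pos by (simp add: powr_minus_divide)
  also have "\<dots> = norm2 A (2, s) u"
    using F by (simp add: C.schatten_star C.schatten_half Plancherel[OF u(1)])
  finally have "1\<^sup>2 \<le> (norm2 A (2, s) u)\<^sup>2" by (intro power_mono) simp_all
  then show ?thesis by (simp add: B.norm2_power2[OF u(1)] B.weight_def)
qed

lemma schatten_mean_2:
  assumes "x \<in> box_space A (2, s)" "0 \<le> t'" "t' \<le> t"
  shows "schatten A (2, s) t x \<le> \<delta> powr (2 * t - 2 * t') * schatten A (2, s) t' x"
proof -
  interpret B: box_algebra A "(2, s)" by (rule box_algebra_2)
  have "\<delta>\<^sup>2 powr (t - t') = \<delta> powr (2 * t - 2 * t')"
    using loop_value_pos by (simp add: powr_powr right_diff_distrib flip: powr_numeral)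
  with B.schatten_mean[OF assms] show ?thesis by (simp add: tr_one_real)
qed

lemma schatten_antimono_2:
  assumes "x \<in> box_space A (2, s)" "0 \<le> t'" "t' \<le> t"
  shows "schatten A (2, s) t' x \<le> schatten A (2, s) t x"
proof -
  interpret B: box_algebra A "(2, s)" by (rule box_algebra_2)
  show ?thesis using assms weight_ge_one by (intro B.schatten_antimono) auto
qed

lemma Plancherel_schatten:
  assumes "x \<in> box_space A (2, s)"
  shows "schatten A (2, \<not> s) (1 / 2) (fourier A s x) = schatten A (2, s) (1 / 2) x"
proof -
  interpret B: box_algebra A "(2, s)" by (rule box_algebra_2)
  interpret C: box_algebra A "(2, \<not> s)" by (rule box_algebra_2)
  show ?thesis using assms by (simp add: B.schatten_half C.schatten_half fourier_in Plancherel)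
qed

text \<open>
  By duality \<open>\<parallel>F(x)\<parallel>\<^sub>q\<close> is the pairing of \<open>F(x)\<close> with the element that has the same partial isometries and the
  normalised singular values \<open>j powr (q - 1)\<close>. This pairing and \<open>x\<close> itself are combinations of the
  entries \<open>\<langle>g\<^sub>j, F(u\<^sub>i)\<rangle>\<close>, to which interpolation applies: the pairing of partial isometries is the first
  bound, and Plancherel is the second.
\<close>

lemma Hausdorff_Young_interior:
  assumes x: "x \<in> box_space A (2, s)" and t: "0 < t" "t < 1 / 2"
  shows "schatten A (2, \<not> s) t (fourier A s x) \<le> \<delta> powr (2 * t - 1) * schatten A (2, s) (1 - t) x"
proof -
  interpret B: box_algebra A "(2, s)" by (rule box_algebra_2)
  interpret C: box_algebra A "(2, \<not> s)" by (rule box_algebra_2)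
  obtain I u where su: "B.svd x I u" using B.svd_exists[OF x] .
  obtain J g where sg: "C.svd (fourier A s x) J g" using C.svd_exists[OF fourier_in[OF x]] .
  define p where "p = 1 / (1 - t)"
  define q where "q = 1 / t"
  have p: "1 < p" "p < 2" "1 / p = 1 - t" "(q - 1) * p = q" "q = 1 / t"
    using t by (auto simp: p_def q_def field_simps)
  define P where "P = (\<Sum>i\<in>I. B.weight (u i) * i powr p)"
  define Q where "Q = (\<Sum>j\<in>J. C.weight (g j) * j powr q)"
  have norms: "schatten A (2, s) (1 - t) x = P powr (1 / p)" "schatten A (2, \<not> s) t (fourier A s x) = Q powr t"
    using B.schatten_svd[OF su, of "1 - t"] C.schatten_svd[OF sg, of t] t by (simp_all add: P_def Q_def p_def q_def)
  show ?thesis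
  proof (cases "J = {}")
    case True
    then have "Q = 0" by (simp add: Q_def)
    then show ?thesis by (simp add: norms)
  next
    case J: False
    have "I \<noteq> {}"
    proof
      assume "I = {}"
      then have "x = 0" using B.svd_sum[OF su] by simp
      then have F0: "fourier A s x = 0" using fourier_sum[of "{}" "\<lambda>_. 0" s] by simp
      obtain j where j: "j \<in> J" using J by auto
      have "C.ip (g j) (fourier A s x) = 0" using C.svd_closed[OF sg j] F0 by simp
      then show False using C.ip_svd_self[OF sg j] C.svd_pos[OF sg j] C.weight_pos[OF sg j] by simp
    qed
    then have pos: "0 < P" "0 < Q"
      unfolding P_def Q_def using J B.svd_finite[OF su] C.svd_finite[OF sg] B.svd_pos[OF su] C.svd_pos[OF sg]
        B.weight_pos[OF su] C.weight_pos[OF sg]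
      by (auto intro!: sum_pos mult_pos_pos simp: less_imp_neq[symmetric])
    define M where "M i j = C.ip (g j) (fourier A s (u i))" for i j
    define a where "a i = i / P powr (1 / p)" for i :: real
    define b where "b j = j powr (q - 1) / Q powr (1 / p)" for j :: real
    have uV: "u i \<in> box_space A (2, s)" if "i \<in> I" for i using B.svd_closed[OF su that] .
    have gV: "g j \<in> box_space A (2, \<not> s)" if "j \<in> J" for j using C.svd_closed[OF sg that] .
    have lin: "(\<Sum>i\<in>I. \<Sum>j\<in>J. c i * d j * M i j)
        = C.ip (\<Sum>j\<in>J. scl A (cnj (d j)) (g j)) (fourier A s (\<Sum>i\<in>I. scl A (c i) (u i)))" for c d
    proof -
      have "fourier A s (\<Sum>i\<in>I. scl A (c i) (u i)) = (\<Sum>i\<in>I. scl A (c i) (fourier A s (u i)))"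
        using uV by (simp add: fourier_sum fourier_linear(1) subspace_scale[OF space])
      then show ?thesis using uV gV fourier_in
        by (simp add: C.ip_sum_left C.ip_sum_right C.ip_scale_left C.ip_scale_right M_def sum_distrib_left mult_ac)
    qed
    have bil: "cmod (\<Sum>i\<in>I. \<Sum>j\<in>J. of_real (a i) * of_real (b j) * M i j) \<le> (1 / \<delta>) powr (2 / p - 1)"
    proof (rule Riesz_Thorin_bilinear[where w = "\<lambda>i. B.weight (u i)" and v = "\<lambda>j. C.weight (g j)"])
      show "finite I" "finite J" by (rule B.svd_finite[OF su], rule C.svd_finite[OF sg])
      show "0 < 1 / \<delta>" using loop_value_pos by simp
      show "1 < p" "p < 2" by (rule p)+
      show "0 < a i" if "i \<in> I" for i using B.svd_pos[OF su that] pos by (simp add: a_def)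
      show "0 < b j" if "j \<in> J" for j using C.svd_pos[OF sg that] pos by (simp add: b_def)
      show "0 \<le> B.weight (u i)" if "i \<in> I" for i using B.weight_pos[OF su that] by simp
      show "0 \<le> C.weight (g j)" if "j \<in> J" for j using C.weight_pos[OF sg that] by simp
      have "(\<Sum>i\<in>I. B.weight (u i) * a i powr p) = (\<Sum>i\<in>I. B.weight (u i) * i powr p / P)"
        using B.svd_pos[OF su] pos p(1) by (intro sum.cong refl) (simp add: a_def powr_divide powr_powr less_imp_le)
      then show "(\<Sum>i\<in>I. B.weight (u i) * a i powr p) = 1"
        using pos by (simp add: P_def flip: sum_divide_distrib)
      have "(\<Sum>j\<in>J. C.weight (g j) * b j powr p) = (\<Sum>j\<in>J. C.weight (g j) * j powr q / Q)"
        using C.svd_pos[OF sg] pos p(1,4) by (intro sum.cong refl) (simp add: b_def powr_divide powr_powr less_imp_le)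
      then show "(\<Sum>j\<in>J. C.weight (g j) * b j powr p) = 1"
        using pos by (simp add: Q_def flip: sum_divide_distrib)
      show "cmod (M i j) \<le> 1 / \<delta> * B.weight (u i) * C.weight (g j)" if "i \<in> I" "j \<in> J" for i j
      proof -
        have "cmod (M i j) \<le> B.weight (u i) * C.weight (g j) / \<delta>"
          unfolding M_def
          by (rule partial_isometry_pairing[OF B.svd_closed[OF su that(1)] B.svd_isometry[OF su that(1)]
                C.svd_closed[OF sg that(2)] C.svd_isometry[OF sg that(2)]])
        then show ?thesis by simp
      qed
      show "cmod (\<Sum>i\<in>I. \<Sum>j\<in>J. c i * d j * M i j)
          \<le> sqrt (\<Sum>i\<in>I. B.weight (u i) * (cmod (c i))\<^sup>2) * sqrt (\<Sum>j\<in>J. C.weight (g j) * (cmod (d j))\<^sup>2)" for c d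
      proof -
        let ?X = "\<Sum>i\<in>I. scl A (c i) (u i)" and ?Y = "\<Sum>j\<in>J. scl A (cnj (d j)) (g j)"
        have X: "?X \<in> box_space A (2, s)" and Y: "?Y \<in> box_space A (2, \<not> s)" using uV gV by auto
        have nX: "norm2 A (2, s) ?X = sqrt (\<Sum>i\<in>I. B.weight (u i) * (cmod (c i))\<^sup>2)"
          using B.norm2_svd[OF su, of c] B.norm2_nonneg[OF X] by (simp add: real_sqrt_unique)
        have nY: "norm2 A (2, \<not> s) ?Y = sqrt (\<Sum>j\<in>J. C.weight (g j) * (cmod (d j))\<^sup>2)"
          using C.norm2_svd[OF sg, of "\<lambda>j. cnj (d j)"] C.norm2_nonneg[OF Y] by (simp add: real_sqrt_unique)
        show ?thesis
          using C.Cauchy_Schwarz[OF Y fourier_in[OF X]]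
          unfolding lin Plancherel[OF X] nX nY by (simp only: mult.commute)
      qed
    qed
    have "(\<Sum>i\<in>I. \<Sum>j\<in>J. of_real i * of_real (j powr (q - 1)) * M i j)
        = C.ip (\<Sum>j\<in>J. scl A (of_real (j powr (q - 1))) (g j)) (\<Sum>j\<in>J. scl A (of_real j) (g j))"
      using lin[of of_real "\<lambda>j. of_real (j powr (q - 1))"] B.svd_sum[OF su] C.svd_sum[OF sg] by simp
    also have "\<dots> = (\<Sum>j\<in>J. \<Sum>j'\<in>J. of_real (j powr (q - 1)) * of_real j' * C.ip (g j) (g j'))"
      using gV by (simp add: C.ip_sum_left C.ip_sum_right C.ip_scale_left C.ip_scale_right sum_distrib_left mult.assoc)
        (rule trans[OF sum.swap], simp add: mult_ac)
    also have "\<dots> = (\<Sum>j\<in>J. \<Sum>j'\<in>J. if j' = j then of_real (C.weight (g j) * j powr q) else 0)"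
    proof (intro sum.cong refl)
      fix j j' assume jj: "j \<in> J" "j' \<in> J"
      have "j powr (q - 1) * j = j powr q" using C.svd_pos[OF sg jj(1)] by (simp add: powr_diff)
      then show "of_real (j powr (q - 1)) * of_real j' * C.ip (g j) (g j')
          = (if j' = j then of_real (C.weight (g j) * j powr q) else (0 :: complex))"
        using jj by (auto simp: C.ip_svd[OF sg] mult.commute simp flip: of_real_mult)
    qed
    also have "\<dots> = of_real Q" using C.svd_finite[OF sg] by (simp add: sum.delta Q_def)
    finally have Q: "(\<Sum>i\<in>I. \<Sum>j\<in>J. of_real i * of_real (j powr (q - 1)) * M i j) = of_real Q" .
    have "(\<Sum>i\<in>I. \<Sum>j\<in>J. of_real (a i) * of_real (b j) * M i j)
        = (\<Sum>i\<in>I. \<Sum>j\<in>J. of_real i * of_real (j powr (q - 1)) * M i j) / of_real (P powr (1 / p) * Q powr (1 / p))"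
      unfolding sum_divide_distrib by (intro sum.cong refl) (simp add: a_def b_def)
    then have "cmod (\<Sum>i\<in>I. \<Sum>j\<in>J. of_real (a i) * of_real (b j) * M i j) = Q / (P powr (1 / p) * Q powr (1 / p))"
      using pos by (simp add: Q norm_divide norm_mult del: of_real_mult)
    with bil have "Q / (P powr (1 / p) * Q powr (1 / p)) \<le> (1 / \<delta>) powr (2 / p - 1)" by simp
    then have "Q / Q powr (1 / p) \<le> (1 / \<delta>) powr (2 / p - 1) * P powr (1 / p)"
      using pos by (simp add: field_simps)
    moreover have "Q / Q powr (1 / p) = Q powr t" using pos p(3) powr_diff[of Q 1 "1 - t"] by simp
    moreover have "(1 / \<delta>) powr (2 / p - 1) = \<delta> powr (2 * t - 1)"
    proof -
      have "2 / p - 1 = 1 - 2 * t" using p(3) by (simp add: divide_inverse) 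
      then show ?thesis using loop_value_pos powr_minus_divide[of \<delta> "1 - 2 * t"] by (simp add: powr_divide)
    qed
    ultimately show ?thesis by (simp add: norms)
  qed
qed

lemma Hausdorff_Young:
  assumes x: "x \<in> box_space A (2, s)" and t: "0 \<le> t" "t \<le> 1 / 2"
  shows "schatten A (2, \<not> s) t (fourier A s x) \<le> \<delta> powr (2 * t - 1) * schatten A (2, s) (1 - t) x"
proof -
  consider "t = 0" | "t = 1 / 2" | "0 < t" "t < 1 / 2" using t by linarith
  then show ?thesis
  proof cases
    case 1
    then show ?thesis using Hausdorff_Young_end[OF x] by simp
  next
    case 2
    have "1 - 1 / 2 = (1 / 2 :: real)" "2 * (1 / 2) - 1 = (0 :: real)" by simp_all
    then show ?thesis using Plancherel_schatten[OF x] loop_value_pos 2 by (simp only:) simp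
  next
    case 3
    then show ?thesis by (rule Hausdorff_Young_interior[OF x])
  qed
qed

text \<open>
  In \<open>R_F\<close>, one reaches \<open>t \<le> 1/2\<close> from \<open>1/2\<close> or from \<open>1 - a\<close> by monotonicity of the norms, according to
  whether \<open>a \<le> 1/2\<close>. In \<open>R_T\<close>, monotonicity is used on the side of \<open>x\<close> instead. In \<open>R_TF\<close>, the
  comparison of power means on both sides leads to Plancherel at \<open>1/2\<close>.
\<close>

lemma fourier_bound:
  assumes x: "x \<in> box_space A (2, s)" and st: "0 \<le> a" "0 \<le> t"
  shows "schatten A (2, \<not> s) t (fourier A s x) \<le> K \<delta> a t * schatten A (2, s) a x"
proof -
  note F = fourier_in[OF x]
  have half: "schatten A (2, \<not> s) (1 / 2) (fourier A s x) = schatten A (2, s) (1 / 2) x"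
    by (rule Plancherel_schatten[OF x])
  have up: "schatten A (2, \<not> s) t (fourier A s x) \<le> \<delta> powr (2 * t - 1) * schatten A (2, s) (1 / 2) x" if "1 / 2 \<le> t"
    using schatten_mean_2[OF F, of "1 / 2" t] that by (simp add: half)
  have low: "schatten A (2, s) (1 / 2) x \<le> \<delta> powr (1 - 2 * a) * schatten A (2, s) a x" if "a \<le> 1 / 2"
    using schatten_mean_2[OF x, of a "1 / 2"] that st by simp
  consider (F) "a + t \<le> 1" "t \<le> 1 / 2" | (T) "\<not> (a + t \<le> 1 \<and> t \<le> 1 / 2)" "1 \<le> a + t" "1 / 2 \<le> a"
    | (TF) "\<not> (a + t \<le> 1 \<and> t \<le> 1 / 2)" "\<not> (1 \<le> a + t \<and> 1 / 2 \<le> a)" "a \<le> 1 / 2" "1 / 2 \<le> t"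
    by linarith
  then show ?thesis
  proof cases
    case F: F
    then have K: "K \<delta> a t = \<delta> powr (1 - 2 * a)" using st by (simp add: K_def R_F_def)
    show ?thesis
    proof (cases "a \<le> 1 / 2")
      case True
      have "schatten A (2, \<not> s) t (fourier A s x) \<le> schatten A (2, s) (1 / 2) x"
        using schatten_antimono_2[OF fourier_in[OF x] st(2) F(2)] by (simp add: half)
      with low[OF True] show ?thesis by (simp add: K)
    next
      case False
      have "schatten A (2, \<not> s) t (fourier A s x) \<le> schatten A (2, \<not> s) (1 - a) (fourier A s x)"
        using F st by (intro schatten_antimono_2[OF fourier_in[OF x]]) auto
      also have "\<dots> \<le> \<delta> powr (2 * (1 - a) - 1) * schatten A (2, s) (1 - (1 - a)) x"
        using False F st by (intro Hausdorff_Young[OF x]) auto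
      finally show ?thesis by (simp add: K)
    qed
  next
    case T
    then have K: "K \<delta> a t = \<delta> powr (2 * t - 1)" using st by (simp add: K_def R_F_def R_T_def)
    show ?thesis
    proof (cases "t \<le> 1 / 2")
      case True
      have "schatten A (2, \<not> s) t (fourier A s x) \<le> \<delta> powr (2 * t - 1) * schatten A (2, s) (1 - t) x"
        by (rule Hausdorff_Young[OF x st(2) True])
      also have "\<dots> \<le> \<delta> powr (2 * t - 1) * schatten A (2, s) a x"
        using T True by (intro mult_left_mono schatten_antimono_2[OF x]) auto
      finally show ?thesis by (simp add: K)
    next
      case False
      have "schatten A (2, \<not> s) t (fourier A s x) \<le> \<delta> powr (2 * t - 1) * schatten A (2, s) (1 / 2) x"
        using False by (intro up) simp
      also have "\<dots> \<le> \<delta> powr (2 * t - 1) * schatten A (2, s) a x"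
        using T by (intro mult_left_mono schatten_antimono_2[OF x]) auto
      finally show ?thesis by (simp add: K)
    qed
  next
    case TF
    then have K: "K \<delta> a t = \<delta> powr (2 * t - 2 * a)" using st by (auto simp: K_def R_F_def R_T_def R_TF_def)
    have "schatten A (2, \<not> s) t (fourier A s x) \<le> \<delta> powr (2 * t - 1) * schatten A (2, s) (1 / 2) x"
      by (rule up[OF TF(4)])
    also have "\<dots> \<le> \<delta> powr (2 * t - 1) * (\<delta> powr (1 - 2 * a) * schatten A (2, s) a x)"
      using low[OF TF(3)] by (intro mult_left_mono) auto
    also have "\<dots> = K \<delta> a t * schatten A (2, s) a x"
      by (simp add: K flip: mult.assoc powr_add)
    finally show ?thesis .
  qed
qed

lemma K_pos:
  assumes "0 \<le> a" "0 \<le> t"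
  shows "0 < K \<delta> a t"
proof -
  have "(a, t) \<in> R_F \<or> (a, t) \<in> R_T \<or> (a, t) \<in> R_TF"
    using assms by (auto simp: R_F_def R_T_def R_TF_def)
  then show ?thesis using loop_value_pos by (auto simp: K_def)
qed

lemma fourier_lower_bound:
  assumes x: "x \<in> box_space A (2, s)" and st: "0 \<le> a" "0 \<le> t"
  shows "inverse (K \<delta> t a) * schatten A (2, s) a x \<le> schatten A (2, \<not> s) t (fourier A s x)"
proof -
  interpret B: box_algebra A "(2, s)" by (rule box_algebra_2)
  interpret C: box_algebra A "(2, \<not> s)" by (rule box_algebra_2)
  let ?h = "star A (2, \<not> s) (fourier A s x)"
  have F: "fourier A s x \<in> box_space A (2, \<not> s)" by (rule fourier_in[OF x])
  then have h: "?h \<in> box_space A (2, \<not> s)" by simp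
  have "schatten A (2, s) a x = schatten A (2, s) a (fourier A (\<not> s) ?h)"
    using x st by (simp add: fourier_star_fourier B.schatten_star)
  also have "\<dots> \<le> K \<delta> t a * schatten A (2, \<not> s) t ?h"
    using fourier_bound[OF h st(2,1)] by simp
  also have "schatten A (2, \<not> s) t ?h = schatten A (2, \<not> s) t (fourier A s x)"
    by (rule C.schatten_star[OF F st(2)])
  finally show ?thesis using K_pos[OF st(2,1)] by (simp add: field_simps)
qed

end

theorem theorem1p1:
  fixes A :: "'a::ab_group_add planar_structure"
    and p q :: ereal and s :: bool and x :: 'a
  assumes "subfactor_planar_algebra A"
    and "irreducible_planar_algebra A"
    and "0 < p" and "0 < q"
    and "x \<in> box_space A (2, s)"
  shows "inverse (K (loop_value A) (recip q) (recip p)) * p_norm A (2, s) p x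
           \<le> p_norm A (2, \<not> s) q (fourier A s x)
       \<and> p_norm A (2, \<not> s) q (fourier A s x)
           \<le> K (loop_value A) (recip p) (recip q) * p_norm A (2, s) p x"
proof -
  interpret irreducible_pa A using assms(1,2) by unfold_locales
  show ?thesis
    unfolding p_norm_schatten[OF assms(3)] p_norm_schatten[OF assms(4)]
    using fourier_lower_bound[OF assms(5)] fourier_bound[OF assms(5)]
      recip_nonneg[OF assms(3)] recip_nonneg[OF assms(4)] by blast
qed


end
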